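(* Let $\Phi\colon\mathbb{R}^n\to\mathbb{R}$ be a convex function. Let $U\colon\mathbb{R}^n\to(-\infty,0]$ be a piecewise affine concave function. Assume there exists a vector $\mathbf{u}_0\in\mathbb{R}^n$ such that $\mathbf{x}\mapsto U(\mathbf{x}+\mathbf{u}_0)$ is 1-homogeneous, and there exists an invertible $n\times n$ matrix $P$ whose column vectors $\mathbf{u}_1,\dots,\mathbf{u}_n\in\mathbb{R}^n$ satisfy $$\{\mathbf{x}\in\mathbb{R}^n\colon U(\mathbf{x}+\mathbf{u}_0)\ge-1\}=\mathrm{co}\left(\bigcup_{j=1}^n\left\{\frac1{a_j}\mathbf{u}_j,-\frac1{b_j}\mathbf{u}_j\right\}\right)$$ for some positive scalars $a_1,\dots,a_n,b_1,\dots,b_n>0$. Let $M$ be the $n\times n$ matrix $M=PP^T$. Let $V\colon\mathbb{R}^n\times[0,+\infty)\to\mathbb{R}$ be defined by $$V(\mathbf{x},t)=\sup_{\mathbf{p}\in\mathbb{R}^n}\left\{\sum_{i=1}^nV\left((P^{-1}\mathbf{x}-P^{-1}\mathbf{u}_0)_i,t;p_i,a_i,b_i\right)-\tilde\Phi^*(\mathbf{p})\right\},$$ where $V(x,t;p,a,b)$ is the explicit function given in the context and $\tilde\Phi^*$ is the Legendre-Fenchel transform of $\tilde\Phi(\mathbf{y}):=\Phi(P\mathbf{y}+\mathbf{u}_0)$. Then $V$ is a continuously differentiable solution to the Hamilton-Jacobi PDE $$\frac{\partial V}{\partial t}(\mathbf{x},t)+\frac12\|\nabla_{\mathbf{x}}V(\mathbf{x},t)\|_M^2+U(\mathbf{x})=0\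 \ (\mathbf{x}\in\mathbb{R}^n,\ t\in(0,+\infty)),\qquad V(\mathbf{x},0)=\Phi(\mathbf{x})\ \ (\mathbf{x}\in\mathbb{R}^n).\tag{HJ}$$ Moreover, if there are constants $C,\delta\ge0$ such that $|\Phi(\mathbf{x})-\Phi(\mathbf{y})|\le C\|\mathbf{x}-\mathbf{y}\|(1+\|\mathbf{x}\|^\delta+\|\mathbf{y}\|^\delta)$ for all $\mathbf{x},\mathbf{y}\in\mathbb{R}^n$, then $V$ is the unique viscosity solution to (HJ) in the set $$\mathcal{G}=\{W\in C(\mathbb{R}^n\times[0,+\infty))\colon\|W\|_R<\infty\ \forall R>0;\ \exists\boldsymbol\alpha\in\mathbb{R}^n\text{ s.t. }\forall T>0\ \exists C_T\in\mathbb{R}\text{ s.t. }W(\mathbf{x},t)-\langle\boldsymbol\alpha,\mathbf{x}\rangle\ge C_T\ \forall\mathbf{x}\in\mathbb{R}^n,\forall t\in[0,T]\},$$ where $\|W\|_R=\sup\{|W(\mathbf{x},t)|+\|\mathbf{q}\|\colon(\mathbf{x},t)\in B_R(\mathbb{R}^n)\times[0,R],\ \mathbf{q}\in D_{\mathbf{x}}^-W(\mathbf{x},t)\}$.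
   Context: Explicit function. For $a,b>0$, $x,p\in\mathbb{R}$, $t\ge0$, define $V(x,t;p,a,b)$ as follows. If $p\ge0$, then $V(x,t;p,a,b)=f_i(x,t;p,a,b)$ whenever $(x,t,p)\in\Omega_i$, $i=1,\dots,5$, where (the regions depend on $a,b$, are subsets of $\mathbb{R}\times[0,+\infty)\times[0,+\infty)$, and partition it) $\Omega_1=\{x\ge pt+\frac a2t^2\}$; $\Omega_2=\{x<0,\ t<\frac pb\}\cup\{x<-\frac b2(t-\frac pb)^2,\ t\ge\frac pb\}$; $\Omega_3=\{0\le x<pt+\frac a2t^2,\ t<\frac pb\}\cup\{\frac a2(t-\frac pb)^2\le x<pt+\frac a2t^2,\ t\ge\frac pb\}$; $\Omega_4=\{0\le x<\frac a2(t-\frac pb)^2,\ t\ge\frac pb\}$; $\Omega_5=\{-\frac b2(t-\frac pb)^2\le x<0,\ t\ge\frac pb\}$; and $f_1=-\frac{a^2}{6}t^3-\frac a2pt^2+atx-\frac12p^2t+px$; $f_2=-\frac{b^2}{6}t^3+\frac b2pt^2-\frac12p^2t+px-btx$; $f_3=\frac{a+b}{3(a+2b)^2}\left((bt-p)^3+((bt-p)^2+2x(a+2b))^{3/2}\right)-\frac{b}{a+2b}(bt-p)x-\frac{b^2}{6}t^3+\frac b2pt^2-\frac12p^2t$; $f_4=\frac{a^2}{3}\left(\frac{2x}{a}\right)^{3/2}-\frac{p^3}{6b}$; $f_5=\frac{b^2}{3}\left(\frac{-2x}{b}\right)^{3/2}-\frac{p^3}{6b}$. If $p<0$, then $V(x,t;p,a,b)=V(-x,t;-p,b,a)$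 (the right-hand side being given by the case $-p>0$ with $a$ and $b$ exchanged). Other notation. The Legendre-Fenchel transform is $g^*(\mathbf{p})=\sup_{\mathbf{x}}\{\langle\mathbf{p},\mathbf{x}\rangle-g(\mathbf{x})\}\in\mathbb{R}\cup\{+\infty\}$. $\|\cdot\|$ and $\langle\cdot,\cdot\rangle$ are the Euclidean norm and inner product; $\|\mathbf{v}\|_M=\sqrt{\langle\mathbf{v},M\mathbf{v}\rangle}$. $\mathrm{co}\,E$ is the convex hull of $E$. A function $g$ is 1-homogeneous if $g(\lambda\mathbf{x})=\lambda g(\mathbf{x})$ for all $\lambda\geq 0$. $(\mathbf{v})_i$ is the $i$-th component of $\mathbf{v}$. $B_R(\mathbb{R}^n)$ is the closed ball with center $\mathbf{0}$ and radius $R$. $D_{\mathbf{x}}^-W(\mathbf{x},t)$ is the (Fréchet/viscosity) subdifferential of $\mathbf{y}\mapsto W(\mathbf{y},t)$ at $\mathbf{y}=\mathbf{x}$. A "continuously differentiable solution" is a function continuous on $\mathbb{R}^n\times[0,+\infty)$, continuously differentiable on $\mathbb{R}^n\times(0,+\infty)$, satisfying the PDE pointwise there and the initial condition at $t=0$. "Viscosity solution" has the standard (Crandall-Lions) meaning, together with the initial condition. *)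

theory Defs
  imports "HOL-Analysis.Analysis"
begin

definition Omega1 :: "real \<Rightarrow> real \<Rightarrow> (real \<times> real \<times> real) set" where
  "Omega1 a b = {(x, t, p). t \<ge> 0 \<and> p \<ge> 0 \<and> x \<ge> p * t + a / 2 * t\<^sup>2}"

definition Omega2 :: "real \<Rightarrow> real \<Rightarrow> (real \<times> real \<times> real) set" where
  "Omega2 a b = {(x, t, p). t \<ge> 0 \<and> p \<ge> 0 \<and>
     ((x < 0 \<and> t < p / b) \<or> (x < - (b / 2) * (t - p / b)\<^sup>2 \<and> t \<ge> p / b))}"

definition Omega3 :: "real \<Rightarrow> real \<Rightarrow> (real \<times> real \<times> real) set" where
  "Omega3 a b = {(x, t, p). t \<ge> 0 \<and> p \<ge> 0 \<and>
     ((0 \<le> x \<and> x < p * t + a / 2 * t\<^sup>2 \<and> t < p / b) \<or>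
      (a / 2 * (t - p / b)\<^sup>2 \<le> x \<and> x < p * t + a / 2 * t\<^sup>2 \<and> t \<ge> p / b))}"

definition Omega4 :: "real \<Rightarrow> real \<Rightarrow> (real \<times> real \<times> real) set" where
  "Omega4 a b = {(x, t, p). t \<ge> 0 \<and> p \<ge> 0 \<and>
     0 \<le> x \<and> x < a / 2 * (t - p / b)\<^sup>2 \<and> t \<ge> p / b}"

definition Omega5 :: "real \<Rightarrow> real \<Rightarrow> (real \<times> real \<times> real) set" where
  "Omega5 a b = {(x, t, p). t \<ge> 0 \<and> p \<ge> 0 \<and>
     - (b / 2) * (t - p / b)\<^sup>2 \<le> x \<and> x < 0 \<and> t \<ge> p / b}"

definition f1 :: "real \<Rightarrow> real \<Rightarrow> real \<Rightarrow> real \<Rightarrow> real \<Rightarrow> real" where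
  "f1 x t p a b = - (a\<^sup>2 / 6) * t ^ 3 - a / 2 * p * t\<^sup>2 + a * t * x - 1 / 2 * p\<^sup>2 * t + p * x"

definition f2 :: "real \<Rightarrow> real \<Rightarrow> real \<Rightarrow> real \<Rightarrow> real \<Rightarrow> real" where
  "f2 x t p a b = - (b\<^sup>2 / 6) * t ^ 3 + b / 2 * p * t\<^sup>2 - 1 / 2 * p\<^sup>2 * t + p * x - b * t * x"

definition f3 :: "real \<Rightarrow> real \<Rightarrow> real \<Rightarrow> real \<Rightarrow> real \<Rightarrow> real" where
  "f3 x t p a b =
     (a + b) / (3 * (a + 2 * b)\<^sup>2) *
       ((b * t - p) ^ 3 + ((b * t - p)\<^sup>2 + 2 * x * (a + 2 * b)) powr (3 / 2))
     - b / (a + 2 * b) * (b * t - p) * x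
     - b\<^sup>2 / 6 * t ^ 3 + b / 2 * p * t\<^sup>2 - 1 / 2 * p\<^sup>2 * t"

definition f4 :: "real \<Rightarrow> real \<Rightarrow> real \<Rightarrow> real \<Rightarrow> real \<Rightarrow> real" where
  "f4 x t p a b = a\<^sup>2 / 3 * (2 * x / a) powr (3 / 2) - p ^ 3 / (6 * b)"

definition f5 :: "real \<Rightarrow> real \<Rightarrow> real \<Rightarrow> real \<Rightarrow> real \<Rightarrow> real" where
  "f5 x t p a b = b\<^sup>2 / 3 * (- 2 * x / b) powr (3 / 2) - p ^ 3 / (6 * b)"

text \<open>
  For \<open>a, b > 0\<close> the five sets partition \<open>{(x, t, p). t \<ge> 0 \<and> p \<ge> 0}\<close>, so the order of the
  case distinction is irrelevant; the final value \<open>0\<close> is only taken outside this set.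
\<close>

definition V1_nonneg :: "real \<Rightarrow> real \<Rightarrow> real \<Rightarrow> real \<Rightarrow> real \<Rightarrow> real" where
  "V1_nonneg x t p a b =
    (if (x, t, p) \<in> Omega1 a b then f1 x t p a b
     else if (x, t, p) \<in> Omega2 a b then f2 x t p a b
     else if (x, t, p) \<in> Omega3 a b then f3 x t p a b
     else if (x, t, p) \<in> Omega4 a b then f4 x t p a b
     else if (x, t, p) \<in> Omega5 a b then f5 x t p a b
     else 0)"

definition V1 :: "real \<Rightarrow> real \<Rightarrow> real \<Rightarrow> real \<Rightarrow> real \<Rightarrow> real" where
  "V1 x t p a b = (if p \<ge> 0 then V1_nonneg x t p a b else V1_nonneg (- x) t (- p) b a)"

definition legendre :: "('a::real_inner \<Rightarrow> real) \<Rightarrow> 'a \<Rightarrow> ereal" where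
  "legendre g p = (SUP x. ereal (p \<bullet> x - g x))"

definition piecewise_affine :: "('a::euclidean_space \<Rightarrow> real) \<Rightarrow> bool" where
  "piecewise_affine f \<longleftrightarrow>
     (\<exists>\<C>. finite \<C> \<and> \<Union>\<C> = UNIV \<and>
          (\<forall>C\<in>\<C>. polyhedron C \<and> (\<exists>g c. \<forall>x\<in>C. f x = g \<bullet> x + c)))"

definition one_homogeneous :: "('a::real_vector \<Rightarrow> real) \<Rightarrow> bool" where
  "one_homogeneous f \<longleftrightarrow> (\<forall>c\<ge>0. \<forall>x. f (c *\<^sub>R x) = c * f x)"

definition frechet_subdifferential :: "('a::real_inner \<Rightarrow> real) \<Rightarrow> 'a \<Rightarrow> 'a set" where
  "frechet_subdifferential f x =
     {q. Liminf (at x) (\<lambda>y. ereal ((f y - f x - q \<bullet> (y - x)) / norm (y - x))) \<ge> 0}"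

definition norm_wrt :: "real^'n^'n \<Rightarrow> real^'n \<Rightarrow> real" where
  "norm_wrt M v = sqrt (v \<bullet> (M *v v))"

definition continuously_differentiable_on ::
    "'a::real_normed_vector set \<Rightarrow> ('a \<Rightarrow> 'b::real_normed_vector) \<Rightarrow> bool" where
  "continuously_differentiable_on S f \<longleftrightarrow>
     (\<exists>f' :: 'a \<Rightarrow> 'a \<Rightarrow>\<^sub>L 'b.
        (\<forall>z\<in>S. (f has_derivative blinfun_apply (f' z)) (at z)) \<and> continuous_on S f')"

definition gradient :: "('a::real_inner \<Rightarrow> real) \<Rightarrow> 'a \<Rightarrow> 'a" where
  "gradient f x = (THE g. GDERIV f x :> g)"

text \<open>
  Functions on \<open>\<real>\<^sup>n \<times> [0, \<infinity>)\<close> are represented by curried total functions; values at negative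
  times are never referred to.  The gradient and the time derivative below are only used where
  the function is continuously differentiable.
\<close>

definition hj_operator ::
    "real^'n^'n \<Rightarrow> (real^'n \<Rightarrow> real) \<Rightarrow> (real^'n \<Rightarrow> real \<Rightarrow> real) \<Rightarrow> real^'n \<Rightarrow> real \<Rightarrow> real" where
  "hj_operator M U W x t =
     deriv (\<lambda>s. W x s) t + 1 / 2 * (norm_wrt M (gradient (\<lambda>y. W y t) x))\<^sup>2 + U x"

definition C1_solution ::
    "real^'n^'n \<Rightarrow> (real^'n \<Rightarrow> real) \<Rightarrow> (real^'n \<Rightarrow> real) \<Rightarrow> (real^'n \<Rightarrow> real \<Rightarrow> real) \<Rightarrow> bool" where
  "C1_solution M U \<Phi> W \<longleftrightarrow>
     continuous_on (UNIV \<times> {0..}) (\<lambda>(x, t). W x t) \<and>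
     continuously_differentiable_on (UNIV \<times> {0<..}) (\<lambda>(x, t). W x t) \<and>
     (\<forall>x. \<forall>t>0. hj_operator M U W x t = 0) \<and>
     (\<forall>x. W x 0 = \<Phi> x)"

definition viscosity_subsolution ::
    "real^'n^'n \<Rightarrow> (real^'n \<Rightarrow> real) \<Rightarrow> (real^'n \<Rightarrow> real \<Rightarrow> real) \<Rightarrow> bool" where
  "viscosity_subsolution M U W \<longleftrightarrow>
     (\<forall>\<phi> x t. continuously_differentiable_on (UNIV \<times> {0<..}) (\<lambda>(y, s). \<phi> y s) \<longrightarrow> t > 0 \<longrightarrow>
        (\<forall>\<^sub>F (y, s) in nhds (x, t). W y s - \<phi> y s \<le> W x t - \<phi> x t) \<longrightarrow>
        hj_operator M U \<phi> x t \<le> 0)"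

definition viscosity_supersolution ::
    "real^'n^'n \<Rightarrow> (real^'n \<Rightarrow> real) \<Rightarrow> (real^'n \<Rightarrow> real \<Rightarrow> real) \<Rightarrow> bool" where
  "viscosity_supersolution M U W \<longleftrightarrow>
     (\<forall>\<phi> x t. continuously_differentiable_on (UNIV \<times> {0<..}) (\<lambda>(y, s). \<phi> y s) \<longrightarrow> t > 0 \<longrightarrow>
        (\<forall>\<^sub>F (y, s) in nhds (x, t). W y s - \<phi> y s \<ge> W x t - \<phi> x t) \<longrightarrow>
        hj_operator M U \<phi> x t \<ge> 0)"

definition viscosity_solution ::
    "real^'n^'n \<Rightarrow> (real^'n \<Rightarrow> real) \<Rightarrow> (real^'n \<Rightarrow> real) \<Rightarrow> (real^'n \<Rightarrow> real \<Rightarrow> real) \<Rightarrow> bool" where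
  "viscosity_solution M U \<Phi> W \<longleftrightarrow>
     continuous_on (UNIV \<times> {0..}) (\<lambda>(x, t). W x t) \<and>
     viscosity_subsolution M U W \<and> viscosity_supersolution M U W \<and>
     (\<forall>x. W x 0 = \<Phi> x)"

text \<open>
  \<open>0 powr 0 = 0\<close> in the library, whereas the growth condition uses \<open>\<parallel>x\<parallel>\<^sup>0 = 1\<close> also for \<open>x = 0\<close>.
\<close>

definition rpow :: "real \<Rightarrow> real \<Rightarrow> real" where
  "rpow r d = (if d = 0 then 1 else r powr d)"

definition growth_condition :: "('a::real_normed_vector \<Rightarrow> real) \<Rightarrow> bool" where
  "growth_condition \<Phi> \<longleftrightarrow>
     (\<exists>C \<delta>. C \<ge> 0 \<and> \<delta> \<ge> 0 \<and>
        (\<forall>x y. \<bar>\<Phi> x - \<Phi> y\<bar> \<le> C * norm (x - y) * (1 + rpow (norm x) \<delta> + rpow (norm y) \<delta>)))"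

definition local_seminorm :: "('a::real_inner \<Rightarrow> real \<Rightarrow> real) \<Rightarrow> real \<Rightarrow> ereal" where
  "local_seminorm W R =
     Sup {ereal (\<bar>W x t\<bar> + norm q) | x t q.
            x \<in> cball 0 R \<and> t \<in> {0..R} \<and> q \<in> frechet_subdifferential (\<lambda>y. W y t) x}"

definition uniqueness_class :: "('a::real_inner \<Rightarrow> real \<Rightarrow> real) set" where
  "uniqueness_class =
     {W. continuous_on (UNIV \<times> {0..}) (\<lambda>(x, t). W x t) \<and>
         (\<forall>R>0. local_seminorm W R < \<infinity>) \<and>
         (\<exists>\<alpha>. \<forall>T>0. \<exists>C. \<forall>x. \<forall>t\<in>{0..T}. W x t - \<alpha> \<bullet> x \<ge> C)}"

end

theory Submission
  imports Defs
begin

text \<open>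
  In the coordinates \<open>y = P\<inverse>(x - u\<^sub>0)\<close> the equation separates and the potential becomes
  \<open>- \<Sum>\<^sub>i max (a\<^sub>i y\<^sub>i) (- b\<^sub>i y\<^sub>i)\<close>.  The function \<open>V1\<close> is the one-dimensional solution with
  linear initial datum \<open>p x\<close>; its space gradient is nondecreasing in \<open>x\<close> and its \<open>p\<close>-derivative
  is strictly decreasing in \<open>p\<close>.  Hence the supremum over \<open>p\<close> is attained at a unique point, which
  depends continuously on \<open>(y, t)\<close>, and the envelope theorem shows that the supremum is continuously
  differentiable and inherits the equation.

  Uniqueness is a comparison argument against smooth functions.  A viscosity subsolution lies below
  \<open>V\<close> because \<open>V\<close> is convex in space, so that a coercive weight can serve as a penalty for the
  equation linearized at \<open>V\<close>.  A viscosity supersolution with a linear lower bound lies above every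
  single member \<open>\<Sum>\<^sub>i V1 - r\<close> of the family, because these have gradients that are bounded on bounded
  time intervals, and hence above their supremum.
\<close>


section \<open>The one-dimensional function\<close>

text \<open>A supremum of smooth functions is in general not differentiable, so the p-dependence of
  \<open>V1\<close> has to be known as precisely as its space dependence. The guide is a control
  problem with running cost v^2 / 2 + max (a x) (- b x): the x-derivative is the final velocity of
  the optimal trajectory and the p-derivative is its starting point. This suggests one closed
  formula for each derivative, valid in all regions at once, so that gradients never have to be
  matched at interfaces. At time 0 \<open>V1\<close> is linear in p: strict concavity is lost and
  the coercivity estimate degenerates. Differentiability is therefore a matter of t > 0, and
  continuity at t = 0 comes from squeezing between explicit bounds. In the comparison the smooth
  function plus a penalty is the test function itself. Expanding the quadratic Hamiltonian leaves
  the square of the penalty gradient, which helps against subsolutions and hurts against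
  supersolutions. Hence the penalty is large in the first case and small in the second, where the
  linear lower bound has to control infinity.\<close>

definition pow32 :: "real \<Rightarrow> real" where
  "pow32 s = max 0 s * sqrt (max 0 s)"

lemma pow32_powr: "s \<ge> 0 \<Longrightarrow> pow32 s = s powr (3/2)"
proof -
  assume "s \<ge> 0"
  have "s powr (3/2) = s powr (1 + 1/2)" by simp
  also have "\<dots> = s * sqrt s"
    using \<open>s \<ge> 0\<close> by (cases "s = 0") (simp_all only: powr_add, simp_all add: powr_half_sqrt)
  finally show ?thesis using \<open>s \<ge> 0\<close> by (simp add: pow32_def)
qed

lemma pow32_square: "s \<ge> 0 \<Longrightarrow> pow32 (s\<^sup>2) = s ^ 3"
  by (simp add: pow32_def power2_eq_square power3_eq_cube)

lemma pow32_nonpos: "s \<le> 0 \<Longrightarrow> pow32 s = 0"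
  by (simp add: pow32_def)

lemma continuous_on_pow32 [continuous_intros]:
  "continuous_on S f \<Longrightarrow> continuous_on S (\<lambda>x. pow32 (f x))"
  unfolding pow32_def by (intro continuous_intros)

text \<open>At 0 the quotient \<open>pow32 h / h\<close> is at most sqrt (max 0 h), so the positive
  part to the power 3/2 is C1 on the whole line. It extends the pieces beyond their regions and
  later serves as a C1 cutoff.\<close>

lemma DERIV_pow32: "(pow32 has_real_derivative (3/2 * sqrt (max 0 s))) (at s)"
proof (cases "s = 0")
  case True
  have "((\<lambda>h. (pow32 h) / h) \<longlongrightarrow> 0) (at 0)"
  proof (rule Lim_null_comparison)
    show "\<forall>\<^sub>F h in at (0::real). norm (pow32 h / h) \<le> sqrt (max 0 h)"
      by (rule always_eventually) (auto simp: pow32_def max_def)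
    have "isCont (\<lambda>h::real. sqrt (max 0 h)) 0" by (intro continuous_intros)
    then show "((\<lambda>h. sqrt (max 0 h)) \<longlongrightarrow> 0) (at (0::real))"
      by (simp add: isCont_def)
  qed
  then show ?thesis using True by (simp add: DERIV_def pow32_def)
next
  case False
  show ?thesis
  proof (cases "s > 0")
    case True
    have "((\<lambda>s. s * sqrt s) has_real_derivative (3/2 * sqrt (max 0 s))) (at s)"
      using True by (auto intro!: derivative_eq_intros simp: field_simps max_def)
    then show ?thesis
      by (rule has_field_derivative_transform_within_open[of _ _ _ "{0<..}"])
         (use True in \<open>auto simp: pow32_def max_def\<close>)
  next
    case F: False
    have "((\<lambda>s. 0) has_real_derivative (3/2 * sqrt (max 0 s))) (at s)"
      using F False by (auto simp: max_def)
    then show ?thesis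
      by (rule has_field_derivative_transform_within_open[of _ _ _ "{..<0}"])
         (use F False in \<open>auto simp: pow32_def max_def\<close>)
  qed
qed

lemma has_derivative_pow32 [derivative_intros]:
  assumes "(f has_derivative f') (at x within S)"
  shows "((\<lambda>x. pow32 (f x)) has_derivative (\<lambda>h. 3/2 * sqrt (max 0 (f x)) * f' h)) (at x within S)"
  using DERIV_compose_FDERIV[OF DERIV_pow32 assms] by (simp add: mult_ac)

text \<open>A closed piece that misses z has filter \<open>bot\<close> at z, and the pieces through
  z share the differential \<open>D\<close>; the difference quotient converges along a finite union
  as soon as it converges along each member.\<close>

lemma has_derivative_on_closed_cover:
  fixes \<A> :: "('a::real_normed_vector set \<times> ('a \<Rightarrow> 'b::real_normed_vector)) set"
  assumes "finite \<A>" "bounded_linear D"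
    and closed: "\<And>A g. (A, g) \<in> \<A> \<Longrightarrow> closed A"
    and eq: "\<And>A g y. (A, g) \<in> \<A> \<Longrightarrow> y \<in> A \<Longrightarrow> f y = g y"
    and deriv: "\<And>A g. (A, g) \<in> \<A> \<Longrightarrow> z \<in> A \<Longrightarrow> (g has_derivative D) (at z within A)"
  shows "(f has_derivative D) (at z within \<Union>(fst ` \<A>))"
proof -
  have *: "((\<lambda>y. (f y - f z - D (y - z)) /\<^sub>R norm (y - z)) \<longlongrightarrow> 0) (at z within A)"
    if "(A, g) \<in> \<A>" for A g
  proof (cases "z \<in> A")
    case True
    have "((\<lambda>y. (g y - g z - D (y - z)) /\<^sub>R norm (y - z)) \<longlongrightarrow> 0) (at z within A)"
      using deriv[OF that True]
      by (simp add: has_derivative_within divide_inverse_commute diff_diff_eq)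
    moreover have "\<forall>\<^sub>F y in at z within A. (g y - g z - D (y - z)) /\<^sub>R norm (y - z)
        = (f y - f z - D (y - z)) /\<^sub>R norm (y - z)"
      using eq[OF that] True by (auto simp: eventually_at_filter)
    ultimately show ?thesis by (rule Lim_transform_eventually)
  next
    case False
    then have "at z within A = bot"
      using closed[OF that] by (simp add: at_within_eq_bot_iff)
    then show ?thesis by simp
  qed
  have "((\<lambda>y. (f y - f z - D (y - z)) /\<^sub>R norm (y - z)) \<longlongrightarrow> 0) (at z within \<Union>(fst ` \<B>))"
    if "finite \<B>" "\<B> \<subseteq> \<A>" for \<B>
    using that by (induction rule: finite_induct) (auto simp: Lim_within_Un intro: *)
  then show ?thesis
    using assms(1,2) by (simp add: has_derivative_within divide_inverse_commute diff_diff_eq)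
qed

lemma max_slopes:
  fixes a b x :: real
  assumes "a > 0" "b > 0"
  shows "x \<ge> 0 \<Longrightarrow> max (a * x) (- b * x) = a * x" "x \<le> 0 \<Longrightarrow> max (a * x) (- b * x) = - b * x"
proof -
  show "max (a * x) (- b * x) = a * x" if "x \<ge> 0"
    using mult_nonneg_nonneg[of a x] mult_nonneg_nonneg[of b x] assms that
    unfolding mult_minus_left by linarith
  show "max (a * x) (- b * x) = - b * x" if "x \<le> 0"
    using mult_nonneg_nonpos[of a x] mult_nonneg_nonpos[of b x] assms that
    unfolding mult_minus_left by linarith
qed

text \<open>Clears the denominators of \<open>f3_ext\<close>, with \<open>k\<close> for a + 2 * b
  and \<open>\<beta>\<close> for b; \<open>C\<close> collects the polynomial terms, so that only a
  polynomial identity is left to check.\<close>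

lemma eq_divide_combination:
  fixes A B C k L \<beta> :: real
  assumes "k > 0" "3 * k * (L + C) = A - 3 * \<beta> * B"
  shows "L = A / (3 * k) - \<beta> / k * B - C"
proof -
  have "L + C = (A - 3 * \<beta> * B) / (3 * k)"
    using assms by (simp add: eq_divide_eq mult.commute)
  also have "\<dots> = A / (3 * k) - \<beta> / k * B"
    using assms(1) by (simp add: diff_divide_distrib)
  finally show ?thesis by simp
qed

text \<open>For \<open>p \<ge> 0\<close>, \<open>V1_cross\<close> is the velocity with which the optimal trajectory arriving at
  \<open>(x, t)\<close> passes the origin, where the acceleration switches from \<open>- b\<close> to \<open>a\<close>.  The value \<open>0\<close>
  means that it rests at the origin for some time, and the value \<open>p\<close> that it starts in the region
  \<open>x \<ge> 0\<close>.  Energy conservation \<open>v\<^sup>2 = q\<^sup>2 + 2 a x\<close> then gives the space gradient.\<close>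

definition V1_vel :: "real \<Rightarrow> real \<Rightarrow> real \<Rightarrow> real \<Rightarrow> real \<Rightarrow> real" where
  "V1_vel x t p a b = (b * sqrt ((b * t - p)\<^sup>2 + 2 * (a + 2 * b) * max 0 x)
     - (a + b) * (b * t - p)) / (a + 2 * b)"

definition V1_cross :: "real \<Rightarrow> real \<Rightarrow> real \<Rightarrow> real \<Rightarrow> real \<Rightarrow> real" where
  "V1_cross x t p a b = max 0 (min p (V1_vel x t p a b))"

text \<open>The velocity at arrival. For x \<ge> 0 the candidates are p + a * t, for a start on the
  same side, and the velocity after a passage through the origin. For x < 0 they are p - b * t, for
  free deceleration, and the velocity after leaving the origin from rest. Minimum and maximum select
  the right one without naming regions.\<close>

definition V1x_nonneg :: "real \<Rightarrow> real \<Rightarrow> real \<Rightarrow> real \<Rightarrow> real \<Rightarrow> real" where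
  "V1x_nonneg x t p a b =
    (if x \<ge> 0 then min (p + a * t) (sqrt ((V1_cross x t p a b)\<^sup>2 + 2 * a * x))
     else max (p - b * t) (- sqrt (- 2 * b * x)))"

text \<open>The starting point of the optimal trajectory, as an envelope principle predicts for the
  datum p x. Energy conservation during the deceleration gives the first summand. The second acts
  only when the start lies at x > 0, the third only when the trajectory stays below the
  origin.\<close>

definition V1p_nonneg :: "real \<Rightarrow> real \<Rightarrow> real \<Rightarrow> real \<Rightarrow> real \<Rightarrow> real" where
  "V1p_nonneg x t p a b = ((V1_cross x t p a b)\<^sup>2 - p\<^sup>2) / (2 * b)
     + max 0 (x - p * t - a / 2 * t\<^sup>2) + min 0 (x + b / 2 * (max 0 (t - p / b))\<^sup>2)"

abbreviation quadrant :: "(real \<times> real \<times> real) set" where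
  "quadrant \<equiv> {(x, t, p). 0 \<le> t \<and> 0 \<le> p}"

text \<open>The four cells are closed versions of the five regions. In \<open>cell2\<close> and
  \<open>cell3\<close>, max 0 (t - p / b) covers t < p / b and t \<ge> p / b by one weak inequality.
  The price of closedness is overlap on the interfaces, where the formulas must agree.
  \<open>cell4\<close> merges the last two regions, since \<open>f45\<close> is C1 across x =
  0.\<close>

definition cell1 :: "real \<Rightarrow> real \<Rightarrow> (real \<times> real \<times> real) set" where
  "cell1 a b = {(x, t, p). 0 \<le> t \<and> 0 \<le> p \<and> p * t + a / 2 * t\<^sup>2 \<le> x}"

definition cell2 :: "real \<Rightarrow> real \<Rightarrow> (real \<times> real \<times> real) set" where
  "cell2 a b = {(x, t, p). 0 \<le> t \<and> 0 \<le> p \<and> x \<le> - (b / 2) * (max 0 (t - p / b))\<^sup>2}"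

definition cell3 :: "real \<Rightarrow> real \<Rightarrow> (real \<times> real \<times> real) set" where
  "cell3 a b = {(x, t, p). 0 \<le> t \<and> 0 \<le> p \<and>
     a / 2 * (max 0 (t - p / b))\<^sup>2 \<le> x \<and> x \<le> p * t + a / 2 * t\<^sup>2}"

definition cell4 :: "real \<Rightarrow> real \<Rightarrow> (real \<times> real \<times> real) set" where
  "cell4 a b = {(x, t, p). 0 \<le> t \<and> 0 \<le> p \<and> p / b \<le> t \<and>
     - (b / 2) * (t - p / b)\<^sup>2 \<le> x \<and> x \<le> a / 2 * (t - p / b)\<^sup>2}"

text \<open>Continuously differentiable extensions to all of \<open>\<real>\<^sup>3\<close> of \<open>f3\<close>, and of \<open>f4\<close> and \<open>f5\<close> together.\<close>

definition f3_ext :: "real \<Rightarrow> real \<Rightarrow> real \<Rightarrow> real \<Rightarrow> real \<Rightarrow> real" where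
  "f3_ext x t p a b =
     (a + b) / (3 * (a + 2 * b)\<^sup>2) *
       ((b * t - p) ^ 3 + pow32 ((b * t - p)\<^sup>2 + 2 * x * (a + 2 * b)))
     - b / (a + 2 * b) * (b * t - p) * x
     - b\<^sup>2 / 6 * t ^ 3 + b / 2 * p * t\<^sup>2 - 1 / 2 * p\<^sup>2 * t"

definition f45 :: "real \<Rightarrow> real \<Rightarrow> real \<Rightarrow> real \<Rightarrow> real \<Rightarrow> real" where
  "f45 x t p a b = a\<^sup>2 / 3 * pow32 (2 * x / a) + b\<^sup>2 / 3 * pow32 (- 2 * x / b) - p ^ 3 / (6 * b)"

section \<open>Agreement of the pieces on the interfaces of the cells\<close>

lemma f3_eq_f3_ext: "x \<ge> 0 \<Longrightarrow> a > 0 \<Longrightarrow> b > 0 \<Longrightarrow> f3 x t p a b = f3_ext x t p a b"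
  by (simp add: f3_def f3_ext_def pow32_powr)

lemma f4_eq_f45: "x \<ge> 0 \<Longrightarrow> a > 0 \<Longrightarrow> b > 0 \<Longrightarrow> f4 x t p a b = f45 x t p a b"
  by (simp add: f4_def f45_def pow32_powr pow32_nonpos)

lemma f5_eq_f45: "x \<le> 0 \<Longrightarrow> a > 0 \<Longrightarrow> b > 0 \<Longrightarrow> f5 x t p a b = f45 x t p a b"
  by (simp add: f5_def f45_def pow32_powr pow32_nonpos divide_nonpos_pos)

lemma f1_eq_f3_ext:
  assumes "a > 0" "b > 0" "t \<ge> 0" "p \<ge> 0" "x = p * t + a / 2 * t\<^sup>2"
  shows "f1 x t p a b = f3_ext x t p a b"
proof -
  \<comment> \<open>On this interface the radicand is a perfect square, so the power 3/2 becomes a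
    cube and a polynomial identity remains.\<close>
  have R: "(b * t - p)\<^sup>2 + 2 * x * (a + 2 * b) = (p + (a + b) * t)\<^sup>2"
    unfolding assms(5) by algebra
  have "(b * t - p) ^ 3 + (p + (a + b) * t) ^ 3
      = (a + 2 * b) * t * ((b * t - p)\<^sup>2 - (b * t - p) * (p + (a + b) * t) + (p + (a + b) * t)\<^sup>2)"
    by algebra
  then have "f3_ext x t p a b = ((a + b) * t * ((b * t - p)\<^sup>2 - (b * t - p) * (p + (a + b) * t)
      + (p + (a + b) * t)\<^sup>2)) / (3 * (a + 2 * b))
      - b / (a + 2 * b) * ((b * t - p) * x)
     - (b\<^sup>2 / 6 * t ^ 3 - b / 2 * p * t\<^sup>2 + 1 / 2 * p\<^sup>2 * t)"
    unfolding f3_ext_def R using assms by (subst pow32_square) (simp_all add: power2_eq_square)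
  moreover have "3 * (a + 2 * b) * (f1 x t p a b + (b\<^sup>2 / 6 * t ^ 3 - b / 2 * p * t\<^sup>2 + 1 / 2 * p\<^sup>2 * t))
     = ((a + b) * t * ((b * t - p)\<^sup>2 - (b * t - p) * (p + (a + b) * t)
      + (p + (a + b) * t)\<^sup>2)) - 3 * b * ((b * t - p) * x)"
    unfolding f1_def assms(5) by (simp add: field_simps power2_eq_square power3_eq_cube)
  moreover have "a + 2 * b > 0" using assms by simp
  ultimately show ?thesis
    by (metis eq_divide_combination)
qed

text \<open>For t \<le> p / b the root at x = 0 is p - b * t, so the two cubes in
  \<open>f3_ext\<close> cancel.\<close>

lemma f2_eq_f3_ext:
  assumes "a > 0" "b > 0" "t \<le> p / b"
  shows "f2 0 t p a b = f3_ext 0 t p a b"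
proof -
  have "p - b * t \<ge> 0" using assms by (simp add: field_simps)
  then have "pow32 ((b * t - p)\<^sup>2) = (p - b * t) ^ 3"
    using pow32_square[of "p - b * t"] by (simp add: power2_commute)
  moreover have "(b * t - p) ^ 3 + (p - b * t) ^ 3 = 0" by algebra
  ultimately show ?thesis by (simp add: f2_def f3_ext_def)
qed

lemma f3_ext_eq_f45:
  assumes "a > 0" "b > 0" "p / b \<le> t" "x = a / 2 * (t - p / b)\<^sup>2"
  shows "f3_ext x t p a b = f45 x t p a b"
proof -
  \<comment> \<open>The time left after the deceleration b has used up the velocity p. In terms of
    \<open>s\<close> the radicand is again a perfect square.\<close>
  define s where "s = t - p / b"
  have s: "s \<ge> 0" "p = b * (t - s)" using assms by (auto simp: s_def field_simps)
  have x: "x = a / 2 * s\<^sup>2" using assms by (simp add: s_def)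
  have "(b * t - p)\<^sup>2 + 2 * x * (a + 2 * b) = ((a + b) * s)\<^sup>2"
    unfolding x s(2) by algebra
  then have R: "pow32 ((b * t - p)\<^sup>2 + 2 * x * (a + 2 * b)) = ((a + b) * s) ^ 3"
    using pow32_square[of "(a + b) * s"] s(1) assms(1,2) by simp
  have 1: "2 * x / a = s\<^sup>2" unfolding x using assms(1) by simp
  have 2: "- 2 * x / b \<le> 0" unfolding x using assms(1,2) by simp
  have 4: "f45 x t p a b = a\<^sup>2 / 3 * s ^ 3 - p ^ 3 / (6 * b)"
    by (simp only: f45_def 1 pow32_square[OF s(1)] pow32_nonpos[OF 2])
  have "(b * t - p) ^ 3 + ((a + b) * s) ^ 3 = (a + 2 * b) * (a\<^sup>2 + a * b + b\<^sup>2) * s ^ 3"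
    unfolding s(2) by algebra
  then have "f3_ext x t p a b = ((a + b) * (a\<^sup>2 + a * b + b\<^sup>2) * s ^ 3) / (3 * (a + 2 * b))
      - b / (a + 2 * b) * ((b * t - p) * x)
     - (b\<^sup>2 / 6 * t ^ 3 - b / 2 * p * t\<^sup>2 + 1 / 2 * p\<^sup>2 * t)"
    unfolding f3_ext_def R by (simp add: power2_eq_square)
  moreover have "3 * (a + 2 * b) * (f45 x t p a b + (b\<^sup>2 / 6 * t ^ 3 - b / 2 * p * t\<^sup>2 + 1 / 2 * p\<^sup>2 * t))
     = (a + b) * (a\<^sup>2 + a * b + b\<^sup>2) * s ^ 3 - 3 * b * ((b * t - p) * x)"
    unfolding 4 unfolding x s(2) using \<open>b > 0\<close> by (simp add: field_simps power2_eq_square power3_eq_cube)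
  moreover have "a + 2 * b > 0" using assms by simp
  ultimately show ?thesis
    by (metis eq_divide_combination)
qed

lemma f2_eq_f45:
  assumes "a > 0" "b > 0" "p / b \<le> t" "x = - (b / 2) * (t - p / b)\<^sup>2"
  shows "f2 x t p a b = f45 x t p a b"
proof -
  define s where "s = t - p / b"
  have s: "s \<ge> 0" "p = b * (t - s)" using assms by (auto simp: s_def field_simps)
  have x: "x = - (b / 2) * s\<^sup>2" using assms by (simp add: s_def)
  have "- 2 * x / b = s\<^sup>2" unfolding x using assms(2) by simp
  moreover have "2 * x / a \<le> 0" using assms x by simp
  ultimately have 4: "f45 x t p a b = b\<^sup>2 / 3 * s ^ 3 - p ^ 3 / (6 * b)"
    using s assms x by (simp add: f45_def pow32_square pow32_nonpos)
  show ?thesis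
    unfolding 4 f2_def unfolding x s(2) using \<open>b > 0\<close> by (simp add: field_simps) algebra
qed

lemma f1_eq_f45:
  assumes "a > 0" "b > 0" "t \<ge> 0"
  shows "f1 (a / 2 * t\<^sup>2) t 0 a b = f45 (a / 2 * t\<^sup>2) t 0 a b"
  using f1_eq_f3_ext[OF assms, of 0] f3_ext_eq_f45[OF assms(1,2), of 0 t] assms by simp

lemma V1_nonneg_cell1:
  assumes "(x, t, p) \<in> cell1 a b"
  shows "V1_nonneg x t p a b = f1 x t p a b"
  using assms by (simp add: cell1_def V1_nonneg_def Omega1_def)

text \<open>Only interface points need work: the case distinction picks \<open>f1\<close> at x = t =
  0, \<open>f5\<close> on the parabola and \<open>f3\<close> on the segment x = 0, and each agrees
  there with \<open>f2\<close>.\<close>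

lemma V1_nonneg_cell2:
  assumes ab: "a > 0" "b > 0" and "(x, t, p) \<in> cell2 a b"
  shows "V1_nonneg x t p a b = f2 x t p a b"
proof -
  have tp: "t \<ge> 0" "p \<ge> 0" and x: "x \<le> - (b / 2) * (max 0 (t - p / b))\<^sup>2"
    using assms by (auto simp: cell2_def)
  have "x \<le> 0" using x ab by (smt (verit) mult_nonneg_nonneg zero_le_power2 divide_nonneg_nonneg mult_minus_left)
  consider "(x, t, p) \<in> Omega1 a b" | "(x, t, p) \<in> Omega2 a b - Omega1 a b"
    | "(x, t, p) \<notin> Omega1 a b" "(x, t, p) \<notin> Omega2 a b" by blast
  then show ?thesis
  proof cases
    case 1
    then have "p * t + a / 2 * t\<^sup>2 \<le> 0" using \<open>x \<le> 0\<close> by (simp add: Omega1_def)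
    moreover have "p * t \<ge> 0" "a / 2 * t\<^sup>2 \<ge> 0" using tp ab by auto
    ultimately have "a / 2 * t\<^sup>2 = 0" "p * t = 0" by linarith+
    then have "t = 0" using ab by auto
    then have "x = 0" using 1 \<open>x \<le> 0\<close> by (simp add: Omega1_def)
    then show ?thesis using 1 \<open>t = 0\<close> by (simp add: V1_nonneg_def f1_def f2_def)
  next
    case 2
    then show ?thesis by (simp add: V1_nonneg_def)
  next
    case 3
    show ?thesis
    proof (cases "x < 0")
      case True
      then have t: "t \<ge> p / b" using 3(2) tp by (auto simp: Omega2_def)
      then have x': "x = - (b / 2) * (t - p / b)\<^sup>2"
        using 3(2) tp x by (auto simp: Omega2_def)
      have "(x, t, p) \<notin> Omega3 a b" "(x, t, p) \<notin> Omega4 a b" "(x, t, p) \<in> Omega5 a b"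
        using True t x' tp ab by (auto simp: Omega3_def Omega4_def Omega5_def)
          (smt (verit) divide_nonneg_nonneg mult_nonneg_nonneg zero_le_power2)
      then show ?thesis
        using 3 f2_eq_f45[OF ab t x'] f5_eq_f45[of x a b t p] True ab
        by (simp add: V1_nonneg_def)
    next
      case False
      then have "x = 0" using \<open>x \<le> 0\<close> by simp
      then have "(b / 2) * (max 0 (t - p / b))\<^sup>2 \<le> 0" using x by simp
      then have t: "t \<le> p / b" using ab
        by (smt (verit) divide_pos_pos mult_pos_pos zero_less_power2)
      have "(x, t, p) \<in> Omega3 a b"
        using 3(1) t tp \<open>x = 0\<close> by (auto simp: Omega1_def Omega3_def)
      then show ?thesis
        using 3 f2_eq_f3_ext[OF ab t] f3_eq_f3_ext[of x a b t p] \<open>x = 0\<close> ab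
        by (simp add: V1_nonneg_def)
    qed
  qed
qed

lemma V1_nonneg_cell3:
  assumes ab: "a > 0" "b > 0" and "(x, t, p) \<in> cell3 a b"
  shows "V1_nonneg x t p a b = f3_ext x t p a b"
proof -
  have tp: "t \<ge> 0" "p \<ge> 0" and x: "a / 2 * (max 0 (t - p / b))\<^sup>2 \<le> x" "x \<le> p * t + a / 2 * t\<^sup>2"
    using assms by (auto simp: cell3_def)
  have "x \<ge> 0" using x ab by (smt (verit) mult_nonneg_nonneg zero_le_power2 divide_nonneg_nonneg)
  show ?thesis
  proof (cases "(x, t, p) \<in> Omega1 a b")
    case True
    then have "x = p * t + a / 2 * t\<^sup>2" using x by (auto simp: Omega1_def)
    then show ?thesis
      using True f1_eq_f3_ext[OF ab tp] by (simp add: V1_nonneg_def)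
  next
    case False
    have "(x, t, p) \<notin> Omega2 a b"
      using \<open>x \<ge> 0\<close> ab by (auto simp: Omega2_def)
        (smt (verit) divide_nonneg_nonneg mult_nonneg_nonneg zero_le_power2)
    moreover have "(x, t, p) \<in> Omega3 a b"
      using False x tp \<open>x \<ge> 0\<close> by (auto simp: Omega1_def Omega3_def)
    ultimately show ?thesis
      using False f3_eq_f3_ext[OF \<open>x \<ge> 0\<close> ab] by (simp add: V1_nonneg_def)
  qed
qed

lemma V1_nonneg_cell4:
  assumes ab: "a > 0" "b > 0" and "(x, t, p) \<in> cell4 a b"
  shows "V1_nonneg x t p a b = f45 x t p a b"
proof -
  have tp: "t \<ge> 0" "p \<ge> 0" and t: "p / b \<le> t"
    and x: "- (b / 2) * (t - p / b)\<^sup>2 \<le> x" "x \<le> a / 2 * (t - p / b)\<^sup>2"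
    using assms by (auto simp: cell4_def)
  have nO2: "(x, t, p) \<notin> Omega2 a b" using t x by (auto simp: Omega2_def)
  consider "(x, t, p) \<in> Omega1 a b" | "(x, t, p) \<notin> Omega1 a b" "(x, t, p) \<in> Omega3 a b"
    | "(x, t, p) \<notin> Omega1 a b" "(x, t, p) \<notin> Omega3 a b" by blast
  then show ?thesis
  proof cases
    case 1
    \<comment> \<open>Membership in \<open>Omega1\<close> squeezes x between two parabolas that can
      meet only for p = 0.\<close>
    have "p / b \<ge> 0" using tp ab by simp
    then have "(t - p / b)\<^sup>2 \<le> t\<^sup>2" using t by (intro power_mono) auto
    then have "a / 2 * (t - p / b)\<^sup>2 \<le> a / 2 * t\<^sup>2" using ab by (intro mult_left_mono) auto
    moreover have "p * t \<ge> 0" using tp by simp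
    moreover have "p * t + a / 2 * t\<^sup>2 \<le> x" using 1 by (simp add: Omega1_def)
    ultimately have x': "x = a / 2 * t\<^sup>2" and "p * t = 0" using x(2) by linarith+
    then have "p = 0" using t tp ab by (auto simp: divide_le_0_iff)
    then show ?thesis
      using 1 f1_eq_f45[OF ab tp(1)] by (simp add: V1_nonneg_def x')
  next
    case 2
    then have "x = a / 2 * (t - p / b)\<^sup>2" using x t by (auto simp: Omega3_def)
    moreover from this ab have "x \<ge> 0" by (simp only: mult_nonneg_nonneg zero_le_power2 divide_nonneg_pos less_imp_le zero_less_numeral)
    ultimately show ?thesis
      using 2 nO2 f3_ext_eq_f45[OF ab t] f3_eq_f3_ext[OF _ ab] by (simp add: V1_nonneg_def)
  next
    case 3
    show ?thesis
    proof (cases "x \<ge> 0")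
      case True
      have "(x, t, p) \<in> Omega4 a b \<or> (x, t, p) \<in> Omega3 a b \<or> (x, t, p) \<in> Omega1 a b"
        using True x t tp by (auto simp: Omega4_def Omega3_def Omega1_def)
      then show ?thesis using 3 nO2 f4_eq_f45[OF True ab] by (simp add: V1_nonneg_def)
    next
      case False
      have "(x, t, p) \<notin> Omega4 a b" "(x, t, p) \<in> Omega5 a b"
        using False x t tp by (auto simp: Omega4_def Omega5_def)
      then show ?thesis using 3 nO2 f5_eq_f45[of x a b] False ab by (simp add: V1_nonneg_def)
    qed
  qed
qed

lemma cells_cover:
  assumes "a > 0" "b > 0"
  shows "cell1 a b \<union> cell2 a b \<union> cell3 a b \<union> cell4 a b = quadrant"
  using assms
  by (auto simp: cell1_def cell2_def cell3_def cell4_def max_def not_le)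

lemma closed_cells:
  shows "closed (cell1 a b)" "closed (cell2 a b)" "closed (cell3 a b)" "closed (cell4 a b)"
  unfolding cell1_def cell2_def cell3_def cell4_def case_prod_unfold divide_inverse
  by (intro closed_Collect_conj closed_Collect_le continuous_intros)+

text \<open>\<open>V1_vel\<close> is the larger root q of the quadratic given by x = q * s + a / 2 *
  s^2 with s = t - (p - q) / b, the arrival condition after crossing the origin with velocity q.
  Since q - p is a positive multiple of R - Q, its sign is that of R^2 - Q^2, which is a multiple of
  x - (p * t + a / 2 * t^2).\<close>

lemma V1_vel_le_iff:
  assumes ab: "a > 0" "b > 0" and "t \<ge> 0" "p \<ge> 0" "x \<ge> 0"
  shows "V1_vel x t p a b \<le> p \<longleftrightarrow> x \<le> p * t + a / 2 * t\<^sup>2"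
    and V1_vel_ge_iff: "p \<le> V1_vel x t p a b \<longleftrightarrow> p * t + a / 2 * t\<^sup>2 \<le> x"
proof -
  define R where "R = sqrt ((b * t - p)\<^sup>2 + 2 * (a + 2 * b) * x)"
  define Q where "Q = p + (a + b) * t"
  have RQ: "R \<ge> 0" "Q \<ge> 0" using assms by (auto simp: R_def Q_def)
  have vel: "V1_vel x t p a b = p + b * (R - Q) / (a + 2 * b)"
    using assms by (simp add: V1_vel_def R_def Q_def field_simps)
  have "R\<^sup>2 = (b * t - p)\<^sup>2 + 2 * (a + 2 * b) * x" using assms by (simp add: R_def)
  then have "R\<^sup>2 - Q\<^sup>2 = 2 * (a + 2 * b) * (x - (p * t + a / 2 * t\<^sup>2))"
    by (simp add: Q_def power2_eq_square algebra_simps)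
  moreover have "R \<le> Q \<longleftrightarrow> R\<^sup>2 - Q\<^sup>2 \<le> 0" "Q \<le> R \<longleftrightarrow> 0 \<le> R\<^sup>2 - Q\<^sup>2"
    using RQ by simp_all
  ultimately have "R \<le> Q \<longleftrightarrow> x \<le> p * t + a / 2 * t\<^sup>2" "Q \<le> R \<longleftrightarrow> p * t + a / 2 * t\<^sup>2 \<le> x"
    using ab by (simp_all add: mult_le_0_iff zero_le_mult_iff)
  then show "V1_vel x t p a b \<le> p \<longleftrightarrow> x \<le> p * t + a / 2 * t\<^sup>2"
    "p \<le> V1_vel x t p a b \<longleftrightarrow> p * t + a / 2 * t\<^sup>2 \<le> x"
    using ab by (simp_all add: vel divide_le_0_iff zero_le_divide_iff mult_le_0_iff zero_le_mult_iff)
qed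

text \<open>The same comparison of squares around the value 0. For negative \<open>s\<close> squares
  would not reflect the order, but then Q \<le> 0 \<le> R.\<close>

lemma V1_vel_sign:
  assumes ab: "a > 0" "b > 0" and "x \<ge> 0"
  shows V1_vel_nonneg_iff: "0 \<le> V1_vel x t p a b \<longleftrightarrow> a / 2 * (max 0 (t - p / b))\<^sup>2 \<le> x"
    and V1_vel_nonpos_iff: "p / b \<le> t \<Longrightarrow> V1_vel x t p a b \<le> 0 \<longleftrightarrow> x \<le> a / 2 * (t - p / b)\<^sup>2"
proof -
  define s where "s = t - p / b"
  have s: "b * t - p = b * s" using ab by (simp add: s_def field_simps)
  define R where "R = sqrt ((b * s)\<^sup>2 + 2 * (a + 2 * b) * x)"
  define Q where "Q = (a + b) * s"
  have R: "R \<ge> 0" using assms by (simp add: R_def)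
  have vel: "V1_vel x t p a b = b * (R - Q) / (a + 2 * b)"
    using assms by (simp add: V1_vel_def R_def Q_def s algebra_simps)
  have "R\<^sup>2 = (b * s)\<^sup>2 + 2 * (a + 2 * b) * x" using assms by (simp add: R_def)
  then have RQ: "R\<^sup>2 - Q\<^sup>2 = 2 * (a + 2 * b) * (x - a / 2 * s\<^sup>2)"
    by (simp add: Q_def power2_eq_square algebra_simps)
  have pos: "(Q \<le> R \<longleftrightarrow> a / 2 * s\<^sup>2 \<le> x) \<and> (R \<le> Q \<longleftrightarrow> x \<le> a / 2 * s\<^sup>2)" if "s \<ge> 0"
  proof -
    have "R \<le> Q \<longleftrightarrow> R\<^sup>2 - Q\<^sup>2 \<le> 0" "Q \<le> R \<longleftrightarrow> 0 \<le> R\<^sup>2 - Q\<^sup>2"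
      using R ab that by (simp_all add: Q_def)
    then show ?thesis using ab by (simp add: RQ mult_le_0_iff zero_le_mult_iff)
  qed
  have neg: "Q \<le> R" if "s \<le> 0"
    using R ab that mult_nonneg_nonpos[of "a + b" s] by (simp add: Q_def)
  show "0 \<le> V1_vel x t p a b \<longleftrightarrow> a / 2 * (max 0 (t - p / b))\<^sup>2 \<le> x"
    unfolding s_def[symmetric] vel using pos neg assms
    by (cases "s \<ge> 0") (simp_all add: zero_le_divide_iff zero_le_mult_iff)
  show "V1_vel x t p a b \<le> 0 \<longleftrightarrow> x \<le> a / 2 * (t - p / b)\<^sup>2" if "p / b \<le> t"
    unfolding s_def[symmetric] vel using pos that ab
    by (simp add: s_def divide_le_0_iff mult_le_0_iff)
qed

lemma V1_cross_neg:
  assumes "a > 0" "b > 0" "t \<ge> 0" "p \<ge> 0" "x \<le> 0"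
  shows "V1_cross x t p a b = max 0 (p - b * t)"
proof -
  have v: "V1_vel x t p a b = (b * \<bar>b * t - p\<bar> - (a + b) * (b * t - p)) / (a + 2 * b)"
    using assms by (simp add: V1_vel_def)
  show ?thesis
  proof (cases "p \<le> b * t")
    case True
    have "V1_vel x t p a b = - (a * (b * t - p) / (a + 2 * b))"
      unfolding v minus_divide_left using True by (simp add: algebra_simps)
    also have "\<dots> \<le> 0" using assms True by simp
    finally show ?thesis using True by (simp add: V1_cross_def)
  next
    case False
    have "V1_vel x t p a b = (p - b * t) * (a + 2 * b) / (a + 2 * b)"
      unfolding v using False by (simp add: algebra_simps)
    also have "\<dots> = p - b * t" using assms by simp
    finally show ?thesis using False assms by (simp add: V1_cross_def)
  qed
qed

section \<open>Values of the derivative formulas on the cells\<close>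

lemma cell1_values:
  assumes ab: "a > 0" "b > 0" and "(x, t, p) \<in> cell1 a b"
  shows "x \<ge> 0" "V1x_nonneg x t p a b = p + a * t"
    "V1p_nonneg x t p a b = x - p * t - a / 2 * t\<^sup>2"
proof -
  have tp: "t \<ge> 0" "p \<ge> 0" and x: "p * t + a / 2 * t\<^sup>2 \<le> x" using assms by (auto simp: cell1_def)
  have "p * t \<ge> 0" "a / 2 * t\<^sup>2 \<ge> 0" using tp ab by auto
  then show "x \<ge> 0" using x by linarith
  have q: "V1_cross x t p a b = p"
    using V1_vel_ge_iff[OF ab tp \<open>x \<ge> 0\<close>] x tp by (simp add: V1_cross_def)
  have "(p + a * t)\<^sup>2 = p\<^sup>2 + 2 * a * (p * t + a / 2 * t\<^sup>2)" by algebra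
  also have "\<dots> \<le> p\<^sup>2 + 2 * a * x" using x ab by simp
  finally have "p + a * t \<le> sqrt (p\<^sup>2 + 2 * a * x)" by (rule real_le_rsqrt)
  then show "V1x_nonneg x t p a b = p + a * t"
    using \<open>x \<ge> 0\<close> by (simp add: V1x_nonneg_def q)
  have "x + b / 2 * (max 0 (t - p / b))\<^sup>2 \<ge> 0" using \<open>x \<ge> 0\<close> ab by simp
  then show "V1p_nonneg x t p a b = x - p * t - a / 2 * t\<^sup>2"
    using x by (simp add: V1p_nonneg_def q)
qed

lemma cell2_values:
  assumes ab: "a > 0" "b > 0" and "(x, t, p) \<in> cell2 a b"
  shows "x \<le> 0" "V1x_nonneg x t p a b = p - b * t"
    "V1p_nonneg x t p a b = b / 2 * t\<^sup>2 - p * t + x"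
proof -
  have tp: "t \<ge> 0" "p \<ge> 0" and x: "x \<le> - (b / 2) * (max 0 (t - p / b))\<^sup>2"
    using assms by (auto simp: cell2_def)
  have "b / 2 * (max 0 (t - p / b))\<^sup>2 \<ge> 0" using ab by simp
  then show x0: "x \<le> 0" using x by linarith
  have q: "V1_cross x t p a b = max 0 (p - b * t)" using V1_cross_neg ab tp x0 by simp
  define s where "s = t - p / b"
  have bs: "b * t - p = b * s" using ab by (simp add: s_def field_simps)
  have xs: "x \<le> - (b / 2) * (max 0 s)\<^sup>2" using x by (simp add: s_def)
  show "V1x_nonneg x t p a b = p - b * t"
  proof (cases "x = 0")
    case True
    then have "(max 0 s)\<^sup>2 \<le> 0" using xs ab by (simp add: mult_le_0_iff)
    then have "s \<le> 0" by (simp add: max_def split: if_splits)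
    then have "b * s \<le> 0" using ab by (simp add: mult_nonneg_nonpos)
    moreover have "a * t \<ge> 0" "b * t \<ge> 0" using ab tp by auto
    ultimately show ?thesis using bs unfolding V1x_nonneg_def q using True by simp
  next
    case False
    have "- sqrt (- 2 * b * x) \<le> p - b * t"
    proof (cases "s \<ge> 0")
      case True
      have "2 * b * (b / 2 * s\<^sup>2) \<le> 2 * b * (- x)"
        using xs ab True by (intro mult_left_mono) auto
      then have "(b * s)\<^sup>2 \<le> - 2 * b * x"
        by (simp add: power_mult_distrib power2_eq_square[of b])
      then have "b * s \<le> sqrt (- 2 * b * x)" by (rule real_le_rsqrt)
      then show ?thesis using bs by linarith
    next
      case False
      then have "b * s \<le> 0" using ab by (simp add: mult_nonneg_nonpos)
      moreover have "sqrt (- 2 * b * x) \<ge> 0" using ab x0 by (simp add: mult_nonneg_nonpos)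
      ultimately show ?thesis using bs by linarith
    qed
    then show ?thesis using False x0 by (simp add: V1x_nonneg_def max_def)
  qed
  have "p * t \<ge> 0" "a / 2 * t\<^sup>2 \<ge> 0" using tp ab by auto
  then have 1: "x - p * t - a / 2 * t\<^sup>2 \<le> 0" using x0 by linarith
  have 2: "x + b / 2 * (max 0 s)\<^sup>2 \<le> 0" using xs by simp
  have p: "p = b * t - b * s" using bs by simp
  have "((max 0 (- (b * s)))\<^sup>2 - p\<^sup>2) / (2 * b) + b / 2 * (max 0 s)\<^sup>2 = b / 2 * t\<^sup>2 - p * t"
  proof (cases "s \<ge> 0")
    case True
    then have "max 0 (- (b * s)) = 0" "max 0 s = s" using ab by auto
    then show ?thesis unfolding p using ab by (simp add: field_simps power2_eq_square)
  next
    case False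
    then have "max 0 (- (b * s)) = - (b * s)" "max 0 s = 0"
      using ab by (auto simp: mult_le_0_iff max_def)
    then show ?thesis unfolding p using ab by (simp add: field_simps power2_eq_square)
  qed
  moreover have "p - b * t = - (b * s)" using bs by simp
  ultimately show "V1p_nonneg x t p a b = b / 2 * t\<^sup>2 - p * t + x"
    using 1 2 unfolding V1p_nonneg_def q s_def[symmetric] by simp
qed

lemma cell3_values:
  assumes ab: "a > 0" "b > 0" and "(x, t, p) \<in> cell3 a b"
  shows "x \<ge> 0"
    "V1x_nonneg x t p a b =
      ((a + b) * sqrt ((b * t - p)\<^sup>2 + 2 * x * (a + 2 * b)) - b * (b * t - p)) / (a + 2 * b)"
    "V1p_nonneg x t p a b = ((V1_vel x t p a b)\<^sup>2 - p\<^sup>2) / (2 * b)"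
proof -
  define k where "k = a + 2 * b"
  have k: "k > 0" using ab by (simp add: k_def)
  define c where "c = b * t - p"
  define R where "R = sqrt (c\<^sup>2 + 2 * x * k)"
  have tp: "t \<ge> 0" "p \<ge> 0" and x: "a / 2 * (max 0 (t - p / b))\<^sup>2 \<le> x" "x \<le> p * t + a / 2 * t\<^sup>2"
    using assms by (auto simp: cell3_def)
  have "a / 2 * (max 0 (t - p / b))\<^sup>2 \<ge> 0" using ab by simp
  then show x0: "x \<ge> 0" using x by linarith
  have vel: "V1_vel x t p a b = (b * R - (a + b) * c) / k"
    using x0 by (simp add: V1_vel_def c_def R_def k_def mult_ac)
  have q: "V1_cross x t p a b = V1_vel x t p a b" "V1_vel x t p a b \<ge> 0" "V1_vel x t p a b \<le> p"
    using V1_vel_nonneg_iff[OF ab x0, of t p] V1_vel_le_iff[OF ab tp x0] x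
    by (auto simp: V1_cross_def)
  have R: "R\<^sup>2 = c\<^sup>2 + 2 * x * k" using x0 k by (simp add: R_def)
  have "\<bar>c\<bar> \<le> R" unfolding R_def using x0 k by (intro real_le_rsqrt) simp
  have "b * c \<le> b * \<bar>c\<bar>" using ab by simp
  also have "\<dots> \<le> (a + b) * R" using ab \<open>\<bar>c\<bar> \<le> R\<close> by (intro mult_mono) auto
  finally have v0: "((a + b) * R - b * c) / k \<ge> 0" using k by simp
  have "(V1_vel x t p a b)\<^sup>2 + 2 * a * x = (((a + b) * R - b * c) / k)\<^sup>2"
  proof -
    have "(b * R - (a + b) * c)\<^sup>2 + 2 * a * x * k\<^sup>2 = ((a + b) * R - b * c)\<^sup>2"
      using R unfolding k_def by algebra
    then show ?thesis unfolding vel power_divide using k by (simp add: field_simps)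
  qed
  then have v: "sqrt ((V1_vel x t p a b)\<^sup>2 + 2 * a * x) = ((a + b) * R - b * c) / k"
    using v0 by (simp only: real_sqrt_abs abs_of_nonneg)
  \<comment> \<open>The final velocity is an increasing affine function of the crossing velocity, so
    the bound of the latter by p becomes the bound p + a * t.\<close>
  have "b * (((a + b) * R - b * c) / k) = (a + b) * V1_vel x t p a b + a * c"
  proof -
    have "b * ((a + b) * R - b * c) = (a + b) * (b * R - (a + b) * c) + a * c * k"
      unfolding k_def by algebra
    then show ?thesis unfolding vel using k by (simp add: field_simps)
  qed
  also have "\<dots> \<le> (a + b) * p + a * c" using q ab by simp
  also have "\<dots> = b * (p + a * t)" by (simp add: c_def algebra_simps)
  finally have "((a + b) * R - b * c) / k \<le> p + a * t" using ab by (simp only: mult_le_cancel_left_pos)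
  then show "V1x_nonneg x t p a b = ((a + b) * sqrt ((b * t - p)\<^sup>2 + 2 * x * (a + 2 * b)) - b * (b * t - p)) / (a + 2 * b)"
    using x0 v by (simp add: V1x_nonneg_def q c_def R_def k_def)
  have "x + b / 2 * (max 0 (t - p / b))\<^sup>2 \<ge> 0" using x0 ab by simp
  then show "V1p_nonneg x t p a b = ((V1_vel x t p a b)\<^sup>2 - p\<^sup>2) / (2 * b)"
    using x by (simp add: V1p_nonneg_def q)
qed

lemma cell4_values:
  assumes ab: "a > 0" "b > 0" and "(x, t, p) \<in> cell4 a b"
  shows "V1x_nonneg x t p a b = a * sqrt (max 0 (2 * x / a)) - b * sqrt (max 0 (- 2 * x / b))"
    "V1p_nonneg x t p a b = - p\<^sup>2 / (2 * b)"
proof -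
  have tp: "t \<ge> 0" "p \<ge> 0" and t: "p / b \<le> t"
    and x: "- (b / 2) * (t - p / b)\<^sup>2 \<le> x" "x \<le> a / 2 * (t - p / b)\<^sup>2"
    using assms by (auto simp: cell4_def)
  have bt: "b * t \<ge> p" using t ab by (simp add: field_simps)
  have "p / b \<ge> 0" using tp ab by simp
  then have "(t - p / b)\<^sup>2 \<le> t\<^sup>2" using t by (intro power_mono) auto
  then have "a / 2 * (t - p / b)\<^sup>2 \<le> a / 2 * t\<^sup>2" using ab by (intro mult_left_mono) auto
  then have xt: "x \<le> a / 2 * t\<^sup>2" using x by linarith
  have q: "V1_cross x t p a b = 0"
  proof (cases "x \<ge> 0")
    case True
    then show ?thesis using V1_vel_nonpos_iff[OF ab True t] x by (simp add: V1_cross_def)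
  qed (use V1_cross_neg ab tp bt in simp)
  have sq: "c * sqrt (y / c) = sqrt (c * y)" if "c > 0" for c y :: real
    using that by (simp add: real_sqrt_divide real_sqrt_mult field_simps)
  show "V1x_nonneg x t p a b = a * sqrt (max 0 (2 * x / a)) - b * sqrt (max 0 (- 2 * x / b))"
  proof (cases "x \<ge> 0")
    case True
    have "2 * a * x \<le> a * (2 * (a / 2 * t\<^sup>2))" using xt ab by simp
    also have "\<dots> = (a * t)\<^sup>2" by algebra
    finally have "sqrt (2 * a * x) \<le> a * t" using tp ab by (intro real_le_lsqrt) auto
    then have "sqrt (2 * a * x) \<le> p + a * t" using tp by simp
    moreover have "- 2 * x / b \<le> 0" using True ab by simp
    moreover have "2 * x / a \<ge> 0" using True ab by simp
    ultimately show ?thesis using True sq[OF ab(1), of "2 * x"]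
      by (simp add: V1x_nonneg_def q max_def mult_ac)
  next
    case False
    have "2 * b * (- x) \<le> 2 * b * (b / 2 * (t - p / b)\<^sup>2)"
      using x ab by (intro mult_left_mono) auto
    then have "- 2 * b * x \<le> (b * (t - p / b))\<^sup>2"
      by (simp add: power_mult_distrib power2_eq_square[of b])
    also have "b * (t - p / b) = b * t - p" using ab by (simp add: field_simps)
    finally have "sqrt (- 2 * b * x) \<le> b * t - p" using bt by (intro real_le_lsqrt) auto
    moreover have "- 2 * x / b \<ge> 0" using False ab by (simp add: field_simps)
    moreover have "2 * x / a \<le> 0" using False ab by (simp add: field_simps)
    ultimately show ?thesis using False sq[OF ab(2), of "- 2 * x"]
      by (simp add: V1x_nonneg_def max_def mult_ac)
  qed
  have "x - p * t - a / 2 * t\<^sup>2 \<le> 0" using xt mult_nonneg_nonneg[OF tp(2,1)] by linarith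
  moreover have "x + b / 2 * (max 0 (t - p / b))\<^sup>2 \<ge> 0" using x t by simp
  ultimately show "V1p_nonneg x t p a b = - p\<^sup>2 / (2 * b)"
    by (simp add: V1p_nonneg_def q)
qed

section \<open>Differentials of the pieces and their gluing\<close>

lemma f1_has_derivative:
  "((\<lambda>(x, t, p). f1 x t p a b) has_derivative
     (\<lambda>(dx, dt, dp). (p + a * t) * dx + (a * x - (p + a * t)\<^sup>2 / 2) * dt
        + (x - p * t - a / 2 * t\<^sup>2) * dp)) (at (x, t, p))"
  unfolding f1_def case_prod_unfold
  by (rule derivative_eq_intros refl)+ (auto simp: fun_eq_iff field_simps power2_eq_square)

lemma f2_has_derivative:
  "((\<lambda>(x, t, p). f2 x t p a b) has_derivative
     (\<lambda>(dx, dt, dp). (p - b * t) * dx + (- b * x - (p - b * t)\<^sup>2 / 2) * dt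
        + (b / 2 * t\<^sup>2 - p * t + x) * dp)) (at (x, t, p))"
  unfolding f2_def case_prod_unfold
  by (rule derivative_eq_intros refl)+ (auto simp: fun_eq_iff field_simps power2_eq_square)

text \<open>The identities \<open>dx\<close>, \<open>dt\<close>, \<open>dp\<close> bring the
  components of the raw differential into the required form. Of these, \<open>dt\<close> is the
  Hamilton-Jacobi equation on this cell; cleared of denominators it is an algebraic consequence of
  R^2 = c^2 + 2 * x * k. Writing a as k - 2 * b keeps the denominator \<open>k\<close>
  atomic.\<close>

lemma f3_ext_has_derivative:
  fixes x t p a b :: real
  assumes ab: "a > 0" "b > 0" and x: "x \<ge> 0"
  defines "X \<equiv> ((a + b) * sqrt ((b * t - p)\<^sup>2 + 2 * x * (a + 2 * b)) - b * (b * t - p)) / (a + 2 * b)"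
  shows "((\<lambda>(x, t, p). f3_ext x t p a b) has_derivative
     (\<lambda>(dx, dt, dp). X * dx + (a * x - X\<^sup>2 / 2) * dt
        + ((V1_vel x t p a b)\<^sup>2 - p\<^sup>2) / (2 * b) * dp)) (at (x, t, p))"
proof -
  define k where "k = a + 2 * b"
  define c where "c = b * t - p"
  define R where "R = sqrt (c\<^sup>2 + 2 * x * k)"
  have k: "k > 0" "a = k - 2 * b" using ab by (auto simp: k_def)
  have R2: "R\<^sup>2 = c\<^sup>2 + 2 * x * k" using k x by (simp add: R_def)
  have R: "sqrt (max 0 (c\<^sup>2 + 2 * x * k)) = R" using k x by (simp add: R_def)
  have t: "t = (c + p) / b" using ab by (simp add: c_def)
  have X: "X = ((k - b) * R - b * c) / k"
    by (simp add: X_def R_def c_def k_def)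
  have vel: "V1_vel x t p a b = (b * R - (k - b) * c) / k"
    using x by (simp add: V1_vel_def c_def R_def k_def mult_ac)
  define \<alpha> where "\<alpha> = (k - b) / (3 * k\<^sup>2)"
  define \<beta> where "\<beta> = b / k"
  have f3_ext: "f3_ext x t p a b = \<alpha> * ((b * t - p) ^ 3 + pow32 ((b * t - p)\<^sup>2 + 2 * x * k)) - \<beta> * (b * t - p) * x
     - b\<^sup>2 / 6 * t ^ 3 + b / 2 * p * t\<^sup>2 - 1 / 2 * p\<^sup>2 * t" for x t p
    by (simp add: f3_ext_def \<alpha>_def \<beta>_def k_def)
  have "((\<lambda>(x, t, p). f3_ext x t p a b) has_derivative
    (\<lambda>(dx, dt, dp). \<alpha> * (3 * (b * t - p)\<^sup>2 * (b * dt - dp)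
       + 3 / 2 * sqrt (max 0 ((b * t - p)\<^sup>2 + 2 * x * k)) * (2 * (b * t - p) * (b * dt - dp) + 2 * dx * k))
     - \<beta> * ((b * t - p) * dx + (b * dt - dp) * x) - b\<^sup>2 / 6 * (3 * t\<^sup>2 * dt)
     + b / 2 * (dp * t\<^sup>2 + p * (2 * t * dt)) - 1 / 2 * (2 * p * dp * t + p\<^sup>2 * dt))) (at (x, t, p))"
    unfolding f3_ext case_prod_unfold
    by (auto intro!: derivative_eq_intros simp: fun_eq_iff) (simp add: field_simps)
  note 1 = this[folded c_def, unfolded R]
  have dx: "\<alpha> * (3 / 2 * R * (2 * k)) - \<beta> * c = X"
    unfolding X \<alpha>_def \<beta>_def using k(1) by (simp add: field_simps power2_eq_square)
  have dt: "\<alpha> * (3 * c\<^sup>2 * b + 3 / 2 * R * (2 * c * b)) - \<beta> * (b * x)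
      - b\<^sup>2 / 6 * (3 * t\<^sup>2) + b / 2 * (p * (2 * t)) - 1 / 2 * p\<^sup>2 = a * x - X\<^sup>2 / 2"
  proof -
    have e1: "2 * ((k - b) * (c\<^sup>2 * b + R * c * b)) - 2 * b * b * x * k - c\<^sup>2 * k\<^sup>2
       = 2 * (k - 2 * b) * x * k\<^sup>2 - ((k - b) * R - b * c)\<^sup>2"
      using R2 by algebra
    have e2: "b\<^sup>2 / 6 * (3 * t\<^sup>2) - b / 2 * (p * (2 * t)) + 1 / 2 * p\<^sup>2 = c\<^sup>2 / 2"
      by (simp add: c_def power2_eq_square algebra_simps)
    have e3: "\<alpha> * (3 * c\<^sup>2 * b + 3 / 2 * R * (2 * c * b)) - \<beta> * (b * x) - c\<^sup>2 / 2
       = (2 * ((k - b) * (c\<^sup>2 * b + R * c * b)) - 2 * b * b * x * k - c\<^sup>2 * k\<^sup>2) / (2 * k\<^sup>2)"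
      unfolding \<alpha>_def \<beta>_def using k(1) by (simp add: field_simps power2_eq_square)
    have e4: "(2 * (k - 2 * b) * x * k\<^sup>2 - ((k - b) * R - b * c)\<^sup>2) / (2 * k\<^sup>2) = a * x - X\<^sup>2 / 2"
      unfolding X k(2) using k(1) by (simp add: field_simps power2_eq_square)
    show ?thesis using e2 e3[unfolded e1] e4 by linarith
  qed
  have dp: "\<alpha> * (3 * c\<^sup>2 * (-1) + 3 / 2 * R * (2 * c * (-1))) - \<beta> * (- x)
      + b / 2 * t\<^sup>2 - 1 / 2 * (2 * p * t) = ((V1_vel x t p a b)\<^sup>2 - p\<^sup>2) / (2 * b)"
  proof -
    have e1: "- 2 * b * ((k - b) * (c\<^sup>2 + R * c)) + 2 * b\<^sup>2 * x * k + c\<^sup>2 * k\<^sup>2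
       = (b * R - (k - b) * c)\<^sup>2"
      using R2 by algebra
    have e2: "b / 2 * t\<^sup>2 - 1 / 2 * (2 * p * t) = (c\<^sup>2 - p\<^sup>2) / (2 * b)"
      using ab by (simp add: c_def power2_eq_square field_simps)
    have e3: "\<alpha> * (3 * c\<^sup>2 * (-1) + 3 / 2 * R * (2 * c * (-1))) - \<beta> * (- x)
       + (c\<^sup>2 - p\<^sup>2) / (2 * b)
       = (- 2 * b * ((k - b) * (c\<^sup>2 + R * c)) + 2 * b\<^sup>2 * x * k + c\<^sup>2 * k\<^sup>2) / (k\<^sup>2 * (2 * b)) - p\<^sup>2 / (2 * b)"
      unfolding \<alpha>_def \<beta>_def using k(1) ab by (simp add: field_simps power2_eq_square)
    have e4: "(b * R - (k - b) * c)\<^sup>2 / (k\<^sup>2 * (2 * b)) - p\<^sup>2 / (2 * b)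
       = ((V1_vel x t p a b)\<^sup>2 - p\<^sup>2) / (2 * b)"
      unfolding vel power_divide by (simp add: diff_divide_distrib)
    show ?thesis using e2 e3[unfolded e1] e4 by linarith
  qed
  define Xt where "Xt = a * x - X\<^sup>2 / 2"
  have split: "\<alpha> * (3 * c\<^sup>2 * (b * u - w)
       + 3 / 2 * R * (2 * c * (b * u - w) + 2 * h * k))
     - \<beta> * (c * h + (b * u - w) * x) - b\<^sup>2 / 6 * (3 * t\<^sup>2 * u)
     + b / 2 * (w * t\<^sup>2 + p * (2 * t * u)) - 1 / 2 * (2 * p * w * t + p\<^sup>2 * u)
    = X * h + Xt * u + ((V1_vel x t p a b)\<^sup>2 - p\<^sup>2) / (2 * b) * w" for h u w
    unfolding dt[folded Xt_def, symmetric] dp[symmetric] dx[symmetric] by (simp add: algebra_simps)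
  show ?thesis
    by (rule has_derivative_eq_rhs[OF 1]) (simp only: split Xt_def)
qed

lemma f45_has_derivative:
  fixes x t p a b :: real
  assumes ab: "a > 0" "b > 0"
  defines "X \<equiv> a * sqrt (max 0 (2 * x / a)) - b * sqrt (max 0 (- 2 * x / b))"
  shows "((\<lambda>(x, t, p). f45 x t p a b) has_derivative
     (\<lambda>(dx, dt, dp). X * dx + (max (a * x) (- b * x) - X\<^sup>2 / 2) * dt
        + (- p\<^sup>2 / (2 * b)) * dp)) (at (x, t, p))"
proof -
  have 1: "((\<lambda>(x, t, p). f45 x t p a b) has_derivative
    (\<lambda>(dx, dt, dp). a\<^sup>2 / 3 * (3 / 2 * sqrt (max 0 (2 * x / a)) * (2 * dx / a))
      + b\<^sup>2 / 3 * (3 / 2 * sqrt (max 0 (- 2 * x / b)) * (- 2 * dx / b)) - 3 * p\<^sup>2 * dp / (6 * b))) (at (x, t, p))"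
    unfolding f45_def case_prod_unfold using ab
    by (auto intro!: derivative_eq_intros simp: fun_eq_iff)
  \<comment> \<open>This piece has no time derivative, so the equation reduces to the eikonal
    equation X^2 / 2 = max (a * x) (- b * x).\<close>
  have 2: "max (a * x) (- b * x) - X\<^sup>2 / 2 = 0"
  proof (cases "x \<ge> 0")
    case True
    then have "- 2 * x / b \<le> 0" "2 * x / a \<ge> 0" using ab by auto
    then have "sqrt (max 0 (- 2 * x / b)) = 0" "(sqrt (max 0 (2 * x / a)))\<^sup>2 = 2 * x / a"
      by auto
    then show ?thesis
      unfolding X_def using ab max_slopes(1)[OF ab True] by (simp add: power_mult_distrib, simp add: power2_eq_square)
  next
    case False
    then have "- 2 * x / b \<ge> 0" "2 * x / a \<le> 0"
      using ab by (auto simp: divide_le_0_iff)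
    then have "sqrt (max 0 (2 * x / a)) = 0" "(sqrt (max 0 (- 2 * x / b)))\<^sup>2 = - 2 * x / b"
      by (auto simp: max_def)
    then show ?thesis
      unfolding X_def using ab max_slopes(2)[OF ab, of x] False by (simp add: power_mult_distrib, simp add: power2_eq_square)
  qed
  have 3: "a\<^sup>2 / 3 * (3 / 2 * A * (2 * dx / a)) + b\<^sup>2 / 3 * (3 / 2 * B * (- 2 * dx / b)) - 3 * p\<^sup>2 * dp / (6 * b)
     = (a * A - b * B) * dx + (- p\<^sup>2 / (2 * b)) * dp" for A B dx dp
    using ab by (simp add: field_simps power2_eq_square)
  show ?thesis
    by (rule has_derivative_eq_rhs[OF 1])
       (simp only: 2 3 X_def[symmetric] mult_zero_left add_0_right)
qed

text \<open>The formulas \<open>V1x_nonneg\<close> and \<open>V1p_nonneg\<close> take the right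
  value on every cell, so all pieces through a point have the same differential \<open>?D\<close>
  and can be glued. Its time component is the equation itself.\<close>

lemma V1_nonneg_has_derivative:
  fixes a b x t p :: real
  assumes ab: "a > 0" "b > 0" and "t > 0" "p \<ge> 0"
  shows "((\<lambda>(x, t, p). V1_nonneg x t p a b) has_derivative
     (\<lambda>(dx, dt, dp). V1x_nonneg x t p a b * dx
        + (max (a * x) (- b * x) - (V1x_nonneg x t p a b)\<^sup>2 / 2) * dt
        + V1p_nonneg x t p a b * dp)) (at (x, t, p) within quadrant)"
    (is "(?f has_derivative ?D) _")
proof -
  let ?\<A> = "{(cell1 a b, \<lambda>(x, t, p). f1 x t p a b), (cell2 a b, \<lambda>(x, t, p). f2 x t p a b),
    (cell3 a b, \<lambda>(x, t, p). f3_ext x t p a b), (cell4 a b, \<lambda>(x, t, p). f45 x t p a b)}"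
  note m = max_slopes[OF ab]
  have "(?f has_derivative ?D) (at (x, t, p) within \<Union>(fst ` ?\<A>))"
  proof (rule has_derivative_on_closed_cover)
    show "bounded_linear ?D"
      unfolding case_prod_unfold by (intro bounded_linear_intros bounded_linear_compose[OF bounded_linear_fst])
    show "closed A" if "(A, g) \<in> ?\<A>" for A g
      using that closed_cells by auto
    show "?f y = g y" if "(A, g) \<in> ?\<A>" "y \<in> A" for A g y
      using that V1_nonneg_cell1 V1_nonneg_cell2[OF ab] V1_nonneg_cell3[OF ab] V1_nonneg_cell4[OF ab]
      by (cases y) auto
    show "(g has_derivative ?D) (at (x, t, p) within A)"
      if A: "(A, g) \<in> ?\<A>" "(x, t, p) \<in> A" for A g
    proof (rule has_derivative_at_withinI)
      consider "A = cell1 a b" "g = (\<lambda>(x, t, p). f1 x t p a b)"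
        | "A = cell2 a b" "g = (\<lambda>(x, t, p). f2 x t p a b)"
        | "A = cell3 a b" "g = (\<lambda>(x, t, p). f3_ext x t p a b)"
        | "A = cell4 a b" "g = (\<lambda>(x, t, p). f45 x t p a b)"
        using A by blast
      then show "(g has_derivative ?D) (at (x, t, p))"
      proof cases
        case 1
        with A have "(x, t, p) \<in> cell1 a b" by simp
        note v = cell1_values[OF ab this]
        show ?thesis unfolding 1 v(2,3) m(1)[OF v(1)] by (rule f1_has_derivative)
      next
        case 2
        with A have "(x, t, p) \<in> cell2 a b" by simp
        note v = cell2_values[OF ab this]
        show ?thesis unfolding 2 v(2,3) m(2)[OF v(1)] by (rule f2_has_derivative)
      next
        case 3
        with A have "(x, t, p) \<in> cell3 a b" by simp
        note v = cell3_values[OF ab this]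
        show ?thesis unfolding 3 v(2,3) m(1)[OF v(1)] by (rule f3_ext_has_derivative[OF ab v(1)])
      next
        case 4
        with A have "(x, t, p) \<in> cell4 a b" by simp
        note v = cell4_values[OF ab this]
        show ?thesis unfolding 4 v by (rule f45_has_derivative[OF ab])
      qed
    qed
  qed simp
  moreover have "\<Union>(fst ` ?\<A>) = quadrant"
    by (simp flip: cells_cover[OF ab] add: Un_ac)
  ultimately show ?thesis by simp
qed

lemma continuous_on_V1_nonneg:
  assumes ab: "a > 0" "b > 0"
  shows "continuous_on quadrant (\<lambda>(x, t, p). V1_nonneg x t p a b)"
    (is "continuous_on _ ?f")
proof -
  have 1: "continuous_on (cell1 a b) ?f"
    by (rule continuous_on_eq[where f = "\<lambda>(x, t, p). f1 x t p a b"], unfold f1_def case_prod_unfold)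
       (use ab in \<open>auto intro!: continuous_intros simp: V1_nonneg_cell1 f1_def\<close>)
  have 2: "continuous_on (cell2 a b) ?f"
    by (rule continuous_on_eq[where f = "\<lambda>(x, t, p). f2 x t p a b"], unfold f2_def case_prod_unfold)
       (use ab in \<open>auto intro!: continuous_intros simp: V1_nonneg_cell2 f2_def\<close>)
  have 3: "continuous_on (cell3 a b) ?f"
    by (rule continuous_on_eq[where f = "\<lambda>(x, t, p). f3_ext x t p a b"], unfold f3_ext_def case_prod_unfold)
       (use ab in \<open>auto intro!: continuous_intros simp: V1_nonneg_cell3 f3_ext_def\<close>)
  have 4: "continuous_on (cell4 a b) ?f"
    by (rule continuous_on_eq[where f = "\<lambda>(x, t, p). f45 x t p a b"], unfold f45_def case_prod_unfold)
       (use ab in \<open>auto intro!: continuous_intros simp: V1_nonneg_cell4 f45_def\<close>)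
  show ?thesis
    unfolding cells_cover[OF ab, symmetric]
    by (intro continuous_on_closed_Un closed_Un closed_cells 1 2 3 4)
qed

section \<open>Reflection to negative slopes\<close>

definition V1x :: "real \<Rightarrow> real \<Rightarrow> real \<Rightarrow> real \<Rightarrow> real \<Rightarrow> real" where
  "V1x x t p a b = (if p \<ge> 0 then V1x_nonneg x t p a b else - V1x_nonneg (- x) t (- p) b a)"

definition V1p :: "real \<Rightarrow> real \<Rightarrow> real \<Rightarrow> real \<Rightarrow> real \<Rightarrow> real" where
  "V1p x t p a b = (if p \<ge> 0 then V1p_nonneg x t p a b else - V1p_nonneg (- x) t (- p) b a)"

text \<open>At p = 0 the third cell shrinks to the interface between the first and the fourth, and
  reflection with a and b exchanged swaps the first two.\<close>

lemma cell_reflect_cases: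
  assumes ab: "a > 0" "b > 0" and t: "t \<ge> 0"
  obtains "(x, t, 0) \<in> cell1 a b" "(- x, t, 0) \<in> cell2 b a"
  | "(x, t, 0) \<in> cell2 a b" "(- x, t, 0) \<in> cell1 b a"
  | "(x, t, 0) \<in> cell4 a b" "(- x, t, 0) \<in> cell4 b a"
proof -
  have "max 0 t = t" using t by simp
  then show ?thesis
    using that t by (auto simp: cell1_def cell2_def cell4_def)
      (smt (verit) divide_minus_left mult_minus_left)
qed

text \<open>Both branches of \<open>V1\<close> and of its derivatives agree at p = 0, so the closed
  half-spaces p \<ge> 0 and p \<le> 0 can be glued like the cells.\<close>

lemma V1_nonneg_reflect:
  assumes ab: "a > 0" "b > 0" and t: "t \<ge> 0"
  shows "V1_nonneg (- x) t 0 b a = V1_nonneg x t 0 a b"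
    "V1x_nonneg (- x) t 0 b a = - V1x_nonneg x t 0 a b"
    "V1p_nonneg (- x) t 0 b a = - V1p_nonneg x t 0 a b"
  by (rule cell_reflect_cases[OF ab t, of x];
      simp add: V1_nonneg_cell1 V1_nonneg_cell2 V1_nonneg_cell4 cell1_values cell2_values
        cell4_values ab f1_def f2_def f45_def)+

lemma V1_nonpos:
  assumes ab: "a > 0" "b > 0" and "t \<ge> 0" "p \<le> 0"
  shows "V1 x t p a b = V1_nonneg (- x) t (- p) b a"
    "V1x x t p a b = - V1x_nonneg (- x) t (- p) b a"
    "V1p x t p a b = - V1p_nonneg (- x) t (- p) b a"
  using V1_nonneg_reflect[OF ab, of t x] assms
  by (cases "p = 0"; simp add: V1_def V1x_def V1p_def)+

lemma V1_has_derivative: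
  fixes a b x t p :: real
  assumes ab: "a > 0" "b > 0" and t: "t > 0"
  shows "((\<lambda>(x, t, p). V1 x t p a b) has_derivative
     (\<lambda>(dx, dt, dp). V1x x t p a b * dx
        + (max (a * x) (- b * x) - (V1x x t p a b)\<^sup>2 / 2) * dt
        + V1p x t p a b * dp)) (at (x, t, p))"
    (is "(?f has_derivative ?D) _")
proof -
  let ?S = quadrant
  let ?T = "{(x, t, p). 0 \<le> t \<and> p \<le> 0} :: (real \<times> real \<times> real) set"
  define refl :: "real \<times> real \<times> real \<Rightarrow> real \<times> real \<times> real" where
    "refl = (\<lambda>(x, t, p). (- x, t, - p))"
  let ?\<A> = "{(?S, \<lambda>(x, t, p). V1_nonneg x t p a b),
    (?T, \<lambda>z. (\<lambda>(x, t, p). V1_nonneg x t p b a) (refl z))}"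
  have "(?f has_derivative ?D) (at (x, t, p) within \<Union>(fst ` ?\<A>))"
  proof (rule has_derivative_on_closed_cover)
    show "bounded_linear ?D"
      unfolding case_prod_unfold by (intro bounded_linear_intros bounded_linear_compose[OF bounded_linear_fst])
    have "closed ?S" "closed ?T"
      unfolding case_prod_unfold by (intro closed_Collect_conj closed_Collect_le continuous_intros)+
    then show "closed A" if "(A, g) \<in> ?\<A>" for A g
      using that by auto
    show "?f y = g y" if "(A, g) \<in> ?\<A>" "y \<in> A" for A g y
      using that V1_nonpos(1)[OF ab]
      by (cases y) (auto simp: V1_def refl_def V1_nonneg_reflect ab)
    show "(g has_derivative ?D) (at (x, t, p) within A)"
      if A: "(A, g) \<in> ?\<A>" "(x, t, p) \<in> A" for A g
    proof -
      consider "A = ?S" "g = (\<lambda>(x, t, p). V1_nonneg x t p a b)"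
        | "A = ?T" "g = (\<lambda>z. (\<lambda>(x, t, p). V1_nonneg x t p b a) (refl z))"
        using A by blast
      then show ?thesis
      proof cases
        case 1
        then have "p \<ge> 0" using A by simp
        then show ?thesis
          using V1_nonneg_has_derivative[OF ab t, of p x] by (simp add: 1 V1x_def V1p_def)
      next
        case 2
        then have p: "p \<le> 0" using A by simp
        have refl: "(refl has_derivative refl) (at (x, t, p) within ?T)"
          unfolding refl_def case_prod_unfold by (intro derivative_intros)
        let ?E = "\<lambda>(dx, dt, dp). V1x_nonneg (- x) t (- p) b a * dx
            + (max (b * - x) (- a * - x) - (V1x_nonneg (- x) t (- p) b a)\<^sup>2 / 2) * dt
            + V1p_nonneg (- x) t (- p) b a * dp"
        have "refl ` ?T = ?S"
        proof (intro equalityI subsetI)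
          fix z :: "real \<times> real \<times> real" assume "z \<in> ?S"
          then show "z \<in> refl ` ?T"
            by (intro image_eqI[of _ _ "refl z"]) (auto simp: refl_def)
        qed (auto simp: refl_def)
        moreover have "((\<lambda>(x, t, p). V1_nonneg x t p b a) has_derivative ?E) (at (refl (x, t, p)) within ?S)"
          using V1_nonneg_has_derivative[OF ab(2,1) t, of "- p" "- x"] p by (simp add: refl_def)
        ultimately have "(g has_derivative (\<lambda>h. ?E (refl h))) (at (x, t, p) within ?T)"
          unfolding 2 using has_derivative_in_compose[OF refl] by simp
        moreover have "(\<lambda>h. ?E (refl h)) = ?D"
          using t p ab by (auto simp: fun_eq_iff refl_def V1_nonpos max.commute)
        ultimately show ?thesis unfolding 2(1) by (simp only:)
      qed
    qed
  qed simp
  \<comment> \<open>The two pieces cover only t \<ge> 0; because t > 0 the point is interior and the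
    derivative within the union is a full one.\<close>
  moreover have "at (x, t, p) within \<Union>(fst ` ?\<A>) = at (x, t, p)"
  proof (rule at_within_open_subset)
    show "(x, t, p) \<in> {(x, t, p). 0 < t}" using t by simp
    show "open {(x :: real, t :: real, p :: real). 0 < t}"
      unfolding case_prod_unfold by (intro open_Collect_less continuous_intros)
  qed auto
  ultimately show ?thesis by simp
qed

lemma continuous_on_reflect:
  assumes f: "continuous_on quadrant (\<lambda>(x :: real, t :: real, p :: real). f x t p)"
    and g: "continuous_on quadrant (\<lambda>(x :: real, t :: real, p :: real). g x t p)"
    and h: "\<And>x t p. t \<ge> 0 \<Longrightarrow> p \<ge> 0 \<Longrightarrow> h x t p = f x t p"
      "\<And>x t p. t \<ge> 0 \<Longrightarrow> p \<le> 0 \<Longrightarrow> h x t p = (g (- x) t (- p) :: real)"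
  shows "continuous_on {(x, t, p). 0 \<le> t} (\<lambda>(x, t, p). h x t p)"
proof -
  let ?S = quadrant
  let ?T = "{(x, t, p). 0 \<le> t \<and> p \<le> 0} :: (real \<times> real \<times> real) set"
  have "continuous_on ?T (\<lambda>z. (\<lambda>(x, t, p). g x t p) ((\<lambda>(x, t, p). (- x, t, - p)) z))"
    by (rule continuous_on_compose2[OF g]) (auto simp: case_prod_unfold intro!: continuous_intros)
  then have "continuous_on ?T (\<lambda>(x, t, p). h x t p)"
    by (rule continuous_on_eq) (auto simp: h(2))
  moreover have "continuous_on ?S (\<lambda>(x, t, p). h x t p)"
    by (rule continuous_on_eq[OF f]) (auto simp: h(1))
  moreover have "closed ?S" "closed ?T"
    unfolding case_prod_unfold by (intro closed_Collect_conj closed_Collect_le continuous_intros)+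
  ultimately have "continuous_on (?S \<union> ?T) (\<lambda>(x, t, p). h x t p)"
    by (intro continuous_on_closed_Un)
  moreover have "?S \<union> ?T = {(x, t, p). 0 \<le> t}" by auto
  ultimately show ?thesis by simp
qed

lemma continuous_on_V1:
  assumes ab: "a > 0" "b > 0"
  shows "continuous_on {(x, t, p). 0 \<le> t} (\<lambda>(x, t, p). V1 x t p a b)"
  by (rule continuous_on_reflect[OF continuous_on_V1_nonneg[OF ab] continuous_on_V1_nonneg[OF ab(2,1)]])
     (auto simp: V1_def V1_nonneg_reflect ab)

text \<open>Both branches of \<open>V1x_nonneg\<close> give this value at x = 0; continuity and
  monotonicity across the origin rest on it.\<close>

lemma V1x_nonneg_zero:
  assumes "a > 0" "b > 0" "t \<ge> 0" "p \<ge> 0"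
  shows "V1x_nonneg 0 t p a b = max 0 (p - b * t)"
proof -
  have "max 0 (p - b * t) \<le> p + a * t"
  proof -
    have "a * t \<ge> 0" "b * t \<ge> 0" using assms by auto
    then have "p - b * t \<le> p + a * t" "0 \<le> p + a * t" using assms(4) by linarith+
    then show ?thesis by simp
  qed
  then show ?thesis
    unfolding V1x_nonneg_def V1_cross_neg[OF assms order_refl] by simp
qed

lemma continuous_on_V1x_nonneg:
  assumes ab: "a > 0" "b > 0"
  shows "continuous_on quadrant (\<lambda>(x, t, p). V1x_nonneg x t p a b)"
    (is "continuous_on _ ?f")
proof -
  let ?S = "{(x, t, p). 0 \<le> t \<and> 0 \<le> p \<and> 0 \<le> x} :: (real \<times> real \<times> real) set"
  let ?T = "{(x, t, p). 0 \<le> t \<and> 0 \<le> p \<and> x \<le> 0} :: (real \<times> real \<times> real) set"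
  have "continuous_on ?S (\<lambda>(x, t, p). min (p + a * t) (sqrt ((V1_cross x t p a b)\<^sup>2 + 2 * a * x)))"
    unfolding V1_cross_def V1_vel_def case_prod_unfold using ab by (intro continuous_intros) auto
  then have "continuous_on ?S ?f"
    by (rule continuous_on_eq) (auto simp: V1x_nonneg_def)
  moreover have "continuous_on ?T (\<lambda>(x, t, p). max (p - b * t) (- sqrt (- 2 * b * x)))"
    unfolding case_prod_unfold by (intro continuous_intros)
  then have "continuous_on ?T ?f"
    by (rule continuous_on_eq)
       (use V1x_nonneg_zero[OF ab] in \<open>force simp: V1x_nonneg_def[of x for x] max.commute\<close>)
  moreover have "closed ?S" "closed ?T"
    unfolding case_prod_unfold by (intro closed_Collect_conj closed_Collect_le continuous_intros)+
  ultimately have "continuous_on (?S \<union> ?T) ?f"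
    by (intro continuous_on_closed_Un)
  moreover have "?S \<union> ?T = quadrant" by auto
  ultimately show ?thesis by simp
qed

lemma continuous_on_V1x:
  assumes ab: "a > 0" "b > 0"
  shows "continuous_on {(x, t, p). 0 \<le> t} (\<lambda>(x, t, p). V1x x t p a b)"
proof -
  have "continuous_on quadrant (\<lambda>(x, t, p). - V1x_nonneg x t p b a)"
    using continuous_on_V1x_nonneg[OF ab(2,1)] by (auto simp: case_prod_unfold intro: continuous_on_minus)
  then show ?thesis
    by (rule continuous_on_reflect[OF continuous_on_V1x_nonneg[OF ab]])
       (auto simp: V1x_def V1_nonneg_reflect ab)
qed


section \<open>Monotonicity and bounds in one dimension\<close>

lemma V1_cross_bounds:
  assumes "p \<ge> 0"
  shows "0 \<le> V1_cross x t p a b" "V1_cross x t p a b \<le> p"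
  using assms by (auto simp: V1_cross_def)

lemma V1_vel_mono:
  assumes "a > 0" "b > 0" "x \<le> y"
  shows "V1_vel x t p a b \<le> V1_vel y t p a b"
  unfolding V1_vel_def using assms
  by (intro divide_right_mono diff_right_mono mult_left_mono real_sqrt_le_mono add_left_mono) auto

lemma V1x_nonneg_mono:
  assumes ab: "a > 0" "b > 0" and tp: "t \<ge> 0" "p \<ge> 0" and "x \<le> y"
  shows "V1x_nonneg x t p a b \<le> V1x_nonneg y t p a b"
proof -
  have 1: "V1x_nonneg x t p a b \<le> V1x_nonneg y t p a b" if "0 \<le> x" "x \<le> y" for x y
  proof -
    have "V1_cross x t p a b \<le> V1_cross y t p a b"
      using V1_vel_mono[OF ab that(2), of t p] by (auto simp: V1_cross_def max_def min_def)
    then have "(V1_cross x t p a b)\<^sup>2 \<le> (V1_cross y t p a b)\<^sup>2"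
      using V1_cross_bounds[OF tp(2)] by (intro power_mono) auto
    then have "sqrt ((V1_cross x t p a b)\<^sup>2 + 2 * a * x) \<le> sqrt ((V1_cross y t p a b)\<^sup>2 + 2 * a * y)"
      using that ab by (intro real_sqrt_le_mono add_mono) auto
    then have "min (p + a * t) (sqrt ((V1_cross x t p a b)\<^sup>2 + 2 * a * x))
        \<le> min (p + a * t) (sqrt ((V1_cross y t p a b)\<^sup>2 + 2 * a * y))"
      by (intro min.mono order_refl)
    then show ?thesis using that by (simp add: V1x_nonneg_def)
  qed
  have 2: "V1x_nonneg x t p a b \<le> max (p - b * t) (- sqrt (- 2 * b * y))" if "x < 0" "x \<le> y" for x y
  proof -
    have "sqrt (- 2 * b * y) \<le> sqrt (- 2 * b * x)" using that ab by (intro real_sqrt_le_mono) simp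
    then have "max (p - b * t) (- sqrt (- 2 * b * x)) \<le> max (p - b * t) (- sqrt (- 2 * b * y))"
      by (intro max.mono) auto
    then show ?thesis using that by (simp add: V1x_nonneg_def)
  qed
  show ?thesis
  proof (cases "x < 0")
    case True
    show ?thesis
    proof (cases "y < 0")
      case False
      have "V1x_nonneg x t p a b \<le> V1x_nonneg 0 t p a b"
        using 2[OF True less_imp_le[OF True]] V1x_nonneg_zero[OF ab tp] by (simp add: max.commute)
      also have "\<dots> \<le> V1x_nonneg y t p a b" using 1 False by simp
      finally show ?thesis .
    qed (use 2[OF True \<open>x \<le> y\<close>] in \<open>simp add: V1x_nonneg_def\<close>)
  qed (use 1 \<open>x \<le> y\<close> in simp)
qed

lemma V1x_mono:
  assumes "a > 0" "b > 0" "t \<ge> 0" "x \<le> y"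
  shows "V1x x t p a b \<le> V1x y t p a b"
  using V1x_nonneg_mono[of a b t p x y] V1x_nonneg_mono[of b a t "- p" "- y" "- x"] assms
  by (auto simp: V1x_def)

lemma V1x_nonneg_bound:
  assumes ab: "a > 0" "b > 0" and tp: "t \<ge> 0" "p \<ge> 0"
  shows "\<bar>V1x_nonneg x t p a b\<bar> \<le> p + max a b * t"
proof -
  have "a * t \<le> max a b * t" "b * t \<le> max a b * t" "0 \<le> a * t" "0 \<le> b * t"
    using ab tp by (auto intro: mult_right_mono)
  moreover have "0 \<le> V1x_nonneg x t p a b \<and> V1x_nonneg x t p a b \<le> p + a * t" if "x \<ge> 0"
    using that ab tp \<open>0 \<le> a * t\<close> by (auto simp: V1x_nonneg_def)
  moreover have "- (b * t) \<le> V1x_nonneg x t p a b \<and> V1x_nonneg x t p a b \<le> p" if "\<not> x \<ge> 0"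
  proof -
    have "sqrt (- 2 * b * x) \<ge> 0" using that ab by (simp add: mult_nonneg_nonpos)
    then have "max (p - b * t) (- sqrt (- 2 * b * x)) \<le> p"
      using tp \<open>0 \<le> b * t\<close> by (intro max.boundedI) linarith+
    moreover have "- (b * t) \<le> max (p - b * t) (- sqrt (- 2 * b * x))"
      using tp by (intro max.coboundedI1) linarith
    ultimately show ?thesis using that by (simp add: V1x_nonneg_def)
  qed
  ultimately show ?thesis using tp(2) by (cases "x \<ge> 0"; unfold abs_le_iff; linarith)
qed

lemma V1x_bound:
  assumes "a > 0" "b > 0" "t \<ge> 0"
  shows "\<bar>V1x x t p a b\<bar> \<le> \<bar>p\<bar> + max a b * t"
  using V1x_nonneg_bound[of a b t p x] V1x_nonneg_bound[of b a t "- p" "- x"] assms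
  by (auto simp: V1x_def max.commute)

section \<open>Strict concavity in the dual slope\<close>

lemma sqrt_add_nonneg_contraction:
  fixes c d s :: real
  assumes "s \<ge> 0"
  shows "\<bar>sqrt (c\<^sup>2 + s) - sqrt (d\<^sup>2 + s)\<bar> \<le> \<bar>c - d\<bar>"
proof -
  \<comment> \<open>The triangle inequality in the plane for the vectors (c - d, 0) and (d, sqrt
    s).\<close>
  have "sqrt (c\<^sup>2 + s) \<le> \<bar>c - d\<bar> + sqrt (d\<^sup>2 + s)" for c d
    using real_sqrt_sum_squares_triangle_ineq[of "c - d" d 0 "sqrt s"] assms by simp
  from this[of c d] this[of d c] show ?thesis by (simp add: abs_minus_commute)
qed

text \<open>The crossing velocity gains at most what the initial velocity gains; this makes q^2 -
  p^2 nonincreasing in p.\<close>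

lemma V1_vel_lipschitz:
  assumes ab: "a > 0" "b > 0" and "p \<le> r"
  shows "V1_vel x t p a b \<le> V1_vel x t r a b" "V1_vel x t r a b - V1_vel x t p a b \<le> r - p"
proof -
  define k where "k = a + 2 * b"
  have k: "k > 0" using ab by (simp add: k_def)
  define R where "R = (\<lambda>p. sqrt ((b * t - p)\<^sup>2 + 2 * (a + 2 * b) * max 0 x))"
  have "\<bar>R r - R p\<bar> \<le> \<bar>(b * t - r) - (b * t - p)\<bar>"
    unfolding R_def using ab by (intro sqrt_add_nonneg_contraction) simp
  then have R: "\<bar>R r - R p\<bar> \<le> r - p" using assms by simp
  have eq: "V1_vel x t r a b - V1_vel x t p a b = (b * (R r - R p) + (a + b) * (r - p)) / k"
    by (simp add: V1_vel_def R_def k_def diff_divide_distrib[symmetric] algebra_simps)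
  have "b * (R r - R p) \<le> b * (r - p)" "- (b * (r - p)) \<le> b * (R r - R p)"
    using R ab by (auto simp flip: mult_minus_right intro!: mult_left_mono)
  moreover have "a * (r - p) \<ge> 0" using assms by simp
  ultimately have *: "0 \<le> b * (R r - R p) + (a + b) * (r - p)"
     "b * (R r - R p) + (a + b) * (r - p) \<le> (r - p) * k"
    by (auto simp: k_def algebra_simps)
  show "V1_vel x t p a b \<le> V1_vel x t r a b"
    using eq *(1) k divide_nonneg_pos[of _ k] by (metis diff_ge_0_iff_ge)
  show "V1_vel x t r a b - V1_vel x t p a b \<le> r - p"
    unfolding eq using *(2) k by (simp add: pos_divide_le_eq)
qed

lemma V1p_nonneg_strict_antimono:
  assumes ab: "a > 0" "b > 0" and t: "t > 0" and p: "0 \<le> p" "p < r"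
  shows "V1p_nonneg x t r a b < V1p_nonneg x t p a b"
proof -
  define q where "q = (\<lambda>p. V1_cross x t p a b)"
  have q: "q p \<le> q r" "q r - q p \<le> r - p"
    using V1_vel_lipschitz[OF ab less_imp_le[OF p(2)], of x t] p
    by (auto simp: q_def V1_cross_def max_def min_def)
  have qb: "0 \<le> q p" "q p \<le> p" "q r \<le> r"
    using p V1_cross_bounds by (auto simp: q_def)
  have A: "x - r * t - a / 2 * t\<^sup>2 < x - p * t - a / 2 * t\<^sup>2" using p t by simp
  have "r / b \<ge> p / b" using p ab by (simp add: divide_right_mono)
  then have "(max 0 (t - r / b))\<^sup>2 \<le> (max 0 (t - p / b))\<^sup>2"
    by (intro power_mono) auto
  then have B: "b / 2 * (max 0 (t - r / b))\<^sup>2 \<le> b / 2 * (max 0 (t - p / b))\<^sup>2"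
    using ab by (intro mult_left_mono) auto
  have C: "(q r)\<^sup>2 - r\<^sup>2 \<le> (q p)\<^sup>2 - p\<^sup>2"
  proof -
    have "(q r - q p) * (q r + q p) \<le> (r - p) * (r + p)"
      using q qb p by (intro mult_mono) auto
    then show ?thesis by (simp add: algebra_simps power2_eq_square)
  qed
  \<comment> \<open>All three summands are nonincreasing in the slope, so one strict drop suffices.
    The first drops strictly unless q r = r; in that case x \<ge> r * t + a / 2 * t^2, and the
    second summand drops strictly.\<close>
  show ?thesis
  proof (cases "q r = r")
    case True
    have r: "r > 0" using p by simp
    have "r * t + a / 2 * t\<^sup>2 \<le> x"
    proof (cases "x \<ge> 0")
      case x: True
      have "V1_vel x t r a b \<ge> r" using True r by (auto simp: q_def V1_cross_def max_def min_def split: if_splits)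
      then show ?thesis using V1_vel_ge_iff[OF ab _ _ x, of t r] t r by simp
    next
      case False
      then have "q r = max 0 (r - b * t)" using V1_cross_neg[OF ab, of t r x] t r by (simp add: q_def)
      moreover have "b * t > 0" using t ab by simp
      ultimately show ?thesis using True r by simp
    qed
    then have "max 0 (x - r * t - a / 2 * t\<^sup>2) < max 0 (x - p * t - a / 2 * t\<^sup>2)"
      using A by simp
    then show ?thesis
      using B divide_right_mono[OF C, of "2 * b"] ab unfolding V1p_nonneg_def q_def by linarith
  next
    case False
    then have "(q r + q p) < r + p" using qb by simp
    then have "(q r - q p) * (q r + q p) < (r - p) * (r + p)"
    proof -
      have "(q r - q p) * (q r + q p) \<le> (r - p) * (q r + q p)"
        using q qb by (intro mult_right_mono) auto
      also have "\<dots> < (r - p) * (r + p)" using p \<open>(q r + q p) < r + p\<close> by simp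
      finally show ?thesis .
    qed
    then have "(q r)\<^sup>2 - r\<^sup>2 < (q p)\<^sup>2 - p\<^sup>2"
      by (simp add: algebra_simps power2_eq_square)
    then have "((q r)\<^sup>2 - r\<^sup>2) / (2 * b) < ((q p)\<^sup>2 - p\<^sup>2) / (2 * b)"
      using ab by (intro divide_strict_right_mono) auto
    moreover have "max 0 (x - r * t - a / 2 * t\<^sup>2) \<le> max 0 (x - p * t - a / 2 * t\<^sup>2)"
      using A by auto
    ultimately show ?thesis
      using B unfolding V1p_nonneg_def q_def by linarith
  qed
qed

lemma V1p_strict_antimono:
  assumes ab: "a > 0" "b > 0" and t: "t > 0" and p: "p < r"
  shows "V1p x t r a b < V1p x t p a b"
proof -
  have *: "V1p x t r a b < V1p x t p a b" if "0 \<le> p" "p < r" for p r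
    using V1p_nonneg_strict_antimono[OF ab t that] that by (simp add: V1p_def)
  have **: "V1p x t r a b < V1p x t p a b" if "r \<le> 0" "p < r" for p r
    using V1p_nonneg_strict_antimono[OF ab(2,1) t, of "- r" "- p" "- x"] that t
    by (simp add: V1_nonpos ab)
  show ?thesis
    using *[of p r] **[of r p] *[of 0 r] **[of 0 p] p by (smt (verit))
qed

lemma V1_DERIV_line:
  fixes x t p c d e s :: real
  assumes "a > 0" "b > 0" "t + s * d > 0"
  defines "x' \<equiv> x + s * c" and "t' \<equiv> t + s * d" and "p' \<equiv> p + s * e"
  shows "((\<lambda>s. V1 (x + s * c) (t + s * d) (p + s * e) a b) has_real_derivative
    V1x x' t' p' a b * c + (max (a * x') (- b * x') - (V1x x' t' p' a b)\<^sup>2 / 2) * d + V1p x' t' p' a b * e) (at s)"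
proof -
  have "((\<lambda>s. (x + s * c, t + s * d, p + s * e)) has_derivative (\<lambda>h. (h * c, h * d, h * e))) (at s)"
    by (auto intro!: derivative_eq_intros)
  from has_derivative_compose[OF this V1_has_derivative[OF assms(1,2,3)], unfolded prod.case]
  show ?thesis
    unfolding x'_def t'_def p'_def
    by (rule has_derivative_imp_has_field_derivative) (simp add: algebra_simps)
qed

lemma V1_DERIV_p:
  assumes "a > 0" "b > 0" "t > 0"
  shows "((\<lambda>p. V1 x t p a b) has_real_derivative V1p x t p a b) (at p)"
  using V1_DERIV_line[of a b t p 0 x 0 0 1] assms by simp

text \<open>Mean values on the two halves are compared through the strict monotonicity of
  \<open>V1p\<close>. The midpoint form suits the later uniqueness argument, which tests the
  midpoint of two maximizers.\<close>

lemma V1_strict_concave_midpoint: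
  assumes ab: "a > 0" "b > 0" and t: "t > 0" and "p \<noteq> r"
  shows "V1 x t p a b + V1 x t r a b < 2 * V1 x t ((p + r) / 2) a b"
proof -
  have *: "V1 x t p a b + V1 x t r a b < 2 * V1 x t ((p + r) / 2) a b" if pr: "p < r" for p r
  proof -
    define m where "m = (p + r) / 2"
    have m: "p < m" "m < r" "m - p = r - m" using pr by (auto simp: m_def field_simps)
    obtain u where u: "p < u" "u < m" "V1 x t m a b - V1 x t p a b = (m - p) * V1p x t u a b"
      using MVT2[OF m(1), of "\<lambda>p. V1 x t p a b" "\<lambda>p. V1p x t p a b"] V1_DERIV_p[OF ab t] by blast
    obtain v where v: "m < v" "v < r" "V1 x t r a b - V1 x t m a b = (r - m) * V1p x t v a b"
      using MVT2[OF m(2), of "\<lambda>p. V1 x t p a b" "\<lambda>p. V1p x t p a b"] V1_DERIV_p[OF ab t] by blast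
    have "V1p x t v a b < V1p x t u a b"
      using V1p_strict_antimono[OF ab t] u v by simp
    then have "(r - m) * V1p x t v a b < (m - p) * V1p x t u a b"
      unfolding m(3)[symmetric] using m(1) by (intro mult_strict_left_mono) auto
    then show ?thesis using u v by (simp add: m_def)
  qed
  show ?thesis
    using *[of p r] *[of r p] \<open>p \<noteq> r\<close> by (cases "p < r") (auto simp: add.commute)
qed

lemma V1_concave_midpoint:
  assumes "a > 0" "b > 0" "t > 0"
  shows "V1 x t p a b + V1 x t r a b \<le> 2 * V1 x t ((p + r) / 2) a b"
  using V1_strict_concave_midpoint[OF assms, of p r x] by (cases "p = r") auto

section \<open>Convexity in space and growth bounds\<close>

lemma V1_DERIV_x:
  assumes "a > 0" "b > 0" "t > 0"
  shows "((\<lambda>x. V1 x t p a b) has_real_derivative V1x x t p a b) (at x)"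
  using V1_DERIV_line[of a b t x 0 0 1 p 0] assms by simp

lemma V1_zero_time: "V1 x 0 p a b = p * x"
  if "a > 0" "b > 0"
proof -
  have *: "V1_nonneg x 0 p a b = p * x" if "p \<ge> 0" "a > 0" "b > 0" for x p a b
  proof (cases "x \<ge> 0")
    case False
    then have "(x, 0, p) \<in> cell2 a b" using that by (simp add: cell2_def)
    then show ?thesis using that by (simp add: V1_nonneg_cell2 f2_def)
  qed (use that in \<open>simp add: V1_nonneg_def Omega1_def f1_def\<close>)
  show ?thesis using *[of p a b x] *[of "- p" b a "- x"] that by (simp add: V1_def)
qed

lemma V1_convex:
  assumes ab: "a > 0" "b > 0" and t: "t \<ge> 0"
  shows "convex_on UNIV (\<lambda>x. V1 x t p a b)"
proof (cases "t = 0")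
  case True
  then show ?thesis
    by (simp add: V1_zero_time ab convex_on_def algebra_simps)
next
  case False
  then show ?thesis
    using t V1x_mono[OF ab t] V1_DERIV_x[OF ab]
    by (intro convex_on_realI[where f' = "\<lambda>x. V1x x t p a b"]) auto
qed

text \<open>Along any curve the equation bounds the growth of \<open>V1\<close> by the running cost; the curve here is
  the segment from \<open>(y, 0)\<close> to \<open>(x, t)\<close>.\<close>

lemma V1_upper_bound:
  assumes ab: "a > 0" "b > 0" and t: "t > 0"
  shows "V1 x t p a b \<le> p * y + (x - y)\<^sup>2 / (2 * t) + t * max a b * (\<bar>x\<bar> + \<bar>y\<bar>)"
proof -
  define c where "c = (x - y) / t"
  define f where "f = (\<lambda>s. V1 (y + s * c) s p a b)"
  define m where "m = max a b * (\<bar>x\<bar> + \<bar>y\<bar>)"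
  have f': "(f has_real_derivative (V1x (y + s * c) s p a b * c
      + (max (a * (y + s * c)) (- b * (y + s * c)) - (V1x (y + s * c) s p a b)\<^sup>2 / 2))) (at s)"
    if "s > 0" for s
    using V1_DERIV_line[OF ab, of 0 s 1 y c p 0] that by (simp add: f_def)
  have "continuous_on {0..t} (\<lambda>s. (\<lambda>(x, t, p). V1 x t p a b) (y + s * c, s, p))"
    by (rule continuous_on_compose2[OF continuous_on_V1[OF ab]])
       (auto intro!: continuous_intros)
  then have cont: "continuous_on {0..t} f" by (simp add: f_def)
  obtain z where z: "0 < z" "z < t" "f t - f 0 = t * (V1x (y + z * c) z p a b * c
      + (max (a * (y + z * c)) (- b * (y + z * c)) - (V1x (y + z * c) z p a b)\<^sup>2 / 2))"
  proof -
    have "\<exists>l z. 0 < z \<and> z < t \<and> (f has_real_derivative l) (at z) \<and> f t - f 0 = (t - 0) * l"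
      using f' by (intro MVT[OF t cont]) (auto simp: real_differentiable_def)
    then obtain l z where z: "0 < z" "z < t" "(f has_real_derivative l) (at z)" "f t - f 0 = t * l"
      by auto
    then show ?thesis using that[of z] DERIV_unique[OF z(3) f'[OF z(1)]] by simp
  qed
  define w where "w = y + z * c"
  have "w = (1 - z / t) * y + (z / t) * x" using t by (simp add: w_def c_def field_simps)
  also have "\<bar>\<dots>\<bar> \<le> \<bar>(1 - z / t) * y\<bar> + \<bar>(z / t) * x\<bar>" by (rule abs_triangle_ineq)
  also have "\<dots> \<le> 1 * \<bar>y\<bar> + 1 * \<bar>x\<bar>"
    unfolding abs_mult using z t by (intro add_mono mult_right_mono) auto
  finally have w: "\<bar>w\<bar> \<le> \<bar>x\<bar> + \<bar>y\<bar>" by simp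
  have "a * w \<le> a * \<bar>w\<bar>" "b * - w \<le> b * \<bar>w\<bar>"
    "a * \<bar>w\<bar> \<le> max a b * \<bar>w\<bar>" "b * \<bar>w\<bar> \<le> max a b * \<bar>w\<bar>"
    using ab by (intro mult_left_mono mult_right_mono; simp)+
  then have "a * w \<le> max a b * \<bar>w\<bar>" "- b * w \<le> max a b * \<bar>w\<bar>" by linarith+
  moreover have "max a b * \<bar>w\<bar> \<le> m" unfolding m_def using w ab by (intro mult_left_mono) auto
  ultimately have 1: "max (a * w) (- b * w) \<le> m" by linarith
  define v where "v = V1x (y + z * c) z p a b"
  \<comment> \<open>Young's inequality trades the unknown gradient \<open>v\<close> at the
    intermediate time for the known speed \<open>c\<close> of the segment.\<close>
  have "v * c - v\<^sup>2 / 2 \<le> c\<^sup>2 / 2"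
    using zero_le_power2[of "v - c"] by (simp add: power2_eq_square algebra_simps)
  then have "f t - f 0 \<le> t * (c\<^sup>2 / 2 + m)"
    unfolding z(3) w_def[symmetric] v_def[symmetric]
    using 1 t by (intro mult_left_mono) (auto simp: w_def v_def)
  moreover have "f t = V1 x t p a b" "f 0 = p * y"
    using t by (auto simp: f_def c_def V1_zero_time ab)
  moreover have "t * (c\<^sup>2 / 2) = (x - y)\<^sup>2 / (2 * t)"
    using t by (simp add: c_def power2_eq_square field_simps)
  ultimately show ?thesis by (simp add: m_def algebra_simps)
qed

text \<open>Along the constant curve at x the potential term is nonnegative, and
  \<open>V1x_bound\<close> limits the loss from the squared gradient.\<close>

lemma V1_lower_bound:
  assumes ab: "a > 0" "b > 0" and t: "t \<ge> 0"
  shows "p * x - t * (\<bar>p\<bar> + max a b * t)\<^sup>2 / 2 \<le> V1 x t p a b"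
proof (cases "t = 0")
  case False
  then have t: "t > 0" using t by simp
  define f where "f = (\<lambda>s. V1 x s p a b)"
  have f': "(f has_real_derivative (max (a * x) (- b * x) - (V1x x s p a b)\<^sup>2 / 2)) (at s)"
    if "s > 0" for s
    using V1_DERIV_line[OF ab, of 0 s 1 x 0 p 0] that by (simp add: f_def)
  have "continuous_on {0..t} (\<lambda>s. (\<lambda>(x, t, p). V1 x t p a b) (x, s, p))"
    by (rule continuous_on_compose2[OF continuous_on_V1[OF ab]])
       (auto intro!: continuous_intros)
  then have cont: "continuous_on {0..t} f" by (simp add: f_def)
  obtain z where z: "0 < z" "z < t" "f t - f 0 = t * (max (a * x) (- b * x) - (V1x x z p a b)\<^sup>2 / 2)"
  proof -
    have "\<exists>l z. 0 < z \<and> z < t \<and> (f has_real_derivative l) (at z) \<and> f t - f 0 = (t - 0) * l"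
      using f' by (intro MVT[OF t cont]) (auto simp: real_differentiable_def)
    then obtain l z where z: "0 < z" "z < t" "(f has_real_derivative l) (at z)" "f t - f 0 = t * l"
      by auto
    then show ?thesis using that[of z] DERIV_unique[OF z(3) f'[OF z(1)]] by simp
  qed
  have "max (a * x) (- b * x) \<ge> 0"
    using ab by (cases "x \<ge> 0") (auto simp: le_max_iff_disj mult_nonneg_nonpos)
  moreover have "(V1x x z p a b)\<^sup>2 \<le> (\<bar>p\<bar> + max a b * t)\<^sup>2"
  proof -
    have "max a b * z \<le> max a b * t" using z ab by (intro mult_left_mono) auto
    then have "\<bar>V1x x z p a b\<bar> \<le> \<bar>p\<bar> + max a b * t"
      using V1x_bound[OF ab, of z x p] z by simp
    then show ?thesis using abs_le_square_iff by fastforce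
  qed
  ultimately have "f t - f 0 \<ge> t * (- (\<bar>p\<bar> + max a b * t)\<^sup>2 / 2)"
    unfolding z(3) using t by (intro mult_left_mono) auto
  then show ?thesis by (simp add: f_def V1_zero_time ab)
qed (simp add: V1_zero_time ab)


section \<open>Envelope theorem and subgradients\<close>

text \<open>Uniqueness identifies the graph of \<open>\<kappa>\<close> with the pairs that satisfy
  all the closed conditions of maximality, and a map into a compact set with closed graph is
  continuous.\<close>

lemma argmax_continuous:
  fixes G :: "'a::euclidean_space \<Rightarrow> 'b::euclidean_space \<Rightarrow> real"
  assumes N: "closed N" and C: "compact C"
    and G: "continuous_on (N \<times> C) (\<lambda>(z, k). G z k)"
    and \<kappa>: "\<And>z. z \<in> N \<Longrightarrow> \<kappa> z \<in> C"
    and max: "\<And>z k. z \<in> N \<Longrightarrow> k \<in> C \<Longrightarrow> G z k \<le> G z (\<kappa> z)"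
    and unique: "\<And>z k. z \<in> N \<Longrightarrow> k \<in> C \<Longrightarrow> G z k = G z (\<kappa> z) \<Longrightarrow> k = \<kappa> z"
  shows "continuous_on N \<kappa>"
proof (rule continuous_from_closed_graph[OF C])
  have "((\<lambda>z. (z, \<kappa> z)) ` N) = {w \<in> N \<times> C. \<forall>k\<in>C. G (fst w) k \<le> G (fst w) (snd w)}"
  proof (intro equalityI subsetI)
    fix w assume "w \<in> (\<lambda>z. (z, \<kappa> z)) ` N"
    then show "w \<in> {w \<in> N \<times> C. \<forall>k\<in>C. G (fst w) k \<le> G (fst w) (snd w)}"
      using \<kappa> max by auto
  next
    fix w assume w: "w \<in> {w \<in> N \<times> C. \<forall>k\<in>C. G (fst w) k \<le> G (fst w) (snd w)}"
    then have "fst w \<in> N" "snd w \<in> C" by auto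
    moreover from this have "G (fst w) (snd w) = G (fst w) (\<kappa> (fst w))"
      using w \<kappa> max by (intro antisym) auto
    ultimately have "snd w = \<kappa> (fst w)" using unique by blast
    then show "w \<in> (\<lambda>z. (z, \<kappa> z)) ` N"
      using \<open>fst w \<in> N\<close> by (intro image_eqI[of _ _ "fst w"]) (simp_all add: prod_eq_iff)
  qed
  also have "\<dots> = (N \<times> C) \<inter> (\<Inter>k\<in>C. {w \<in> N \<times> C. G (fst w) k \<le> G (fst w) (snd w)})"
    by auto
  also have "closed \<dots>"
  proof (intro closed_Int closed_INT ballI)
    show NC: "closed (N \<times> C)" using N C by (simp add: closed_Times compact_imp_closed)
    fix k assume k: "k \<in> C"
    have 1: "continuous_on (N \<times> C) (\<lambda>w. G (fst w) (snd w))"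
      using G by (simp add: case_prod_unfold)
    have "continuous_on (N \<times> C) (\<lambda>w. (\<lambda>(z, k). G z k) (fst w, k))"
      by (rule continuous_on_compose2[OF G]) (use k in \<open>auto intro!: continuous_intros\<close>)
    then have 2: "continuous_on (N \<times> C) (\<lambda>w. G (fst w) k)" by simp
    show "closed {w \<in> N \<times> C. G (fst w) k \<le> G (fst w) (snd w)}"
      by (rule continuous_on_closed_Collect_le[OF 2 1 NC])
  qed
  finally show "closed ((\<lambda>z. (z, \<kappa> z)) ` N)" .
qed (use \<kappa> in auto)

text \<open>By maximality the increment of the maximum lies between the increments of G with k
  frozen at \<open>\<kappa> z0\<close> and at \<open>\<kappa> z\<close>. Joint continuity of
  \<open>D\<close> makes the linearization error uniform for k near \<open>\<kappa> z0\<close>, and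
  continuity of \<open>\<kappa>\<close> keeps \<open>\<kappa> z\<close> there; no derivative in k
  enters.\<close>

lemma envelope_has_derivative:
  fixes G :: "'a::euclidean_space \<Rightarrow> 'b::metric_space \<Rightarrow> real"
  assumes N: "open N" "z0 \<in> N"
    and deriv: "\<And>z k. z \<in> N \<Longrightarrow> k \<in> C \<Longrightarrow> ((\<lambda>z. G z k) has_derivative (\<lambda>h. D z k \<bullet> h)) (at z)"
    and D: "continuous_on (N \<times> C) (\<lambda>(z, k). D z k)"
    and \<kappa>: "continuous_on N \<kappa>" "\<And>z. z \<in> N \<Longrightarrow> \<kappa> z \<in> C"
    and max: "\<And>z k. z \<in> N \<Longrightarrow> k \<in> C \<Longrightarrow> G z k \<le> G z (\<kappa> z)"
  shows "((\<lambda>z. G z (\<kappa> z)) has_derivative (\<lambda>h. D z0 (\<kappa> z0) \<bullet> h)) (at z0)"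
  unfolding has_derivative_at_alt
proof (intro conjI allI impI)
  show "bounded_linear (\<lambda>h. D z0 (\<kappa> z0) \<bullet> h)" by (rule bounded_linear_inner_right)
  fix e :: real assume e: "e > 0"
  define D0 where "D0 = D z0 (\<kappa> z0)"
  have "(z0, \<kappa> z0) \<in> N \<times> C" using N \<kappa>(2) by simp
  from D[unfolded continuous_on_iff, rule_format, OF this e]
  obtain d1 where d1: "d1 > 0" and *: "\<And>w. w \<in> N \<times> C \<Longrightarrow> dist w (z0, \<kappa> z0) < d1 \<Longrightarrow>
      dist ((\<lambda>(z, k). D z k) w) ((\<lambda>(z, k). D z k) (z0, \<kappa> z0)) < e" by blast
  have d1': "dist (D z k) D0 < e" if "z \<in> N" "k \<in> C" "dist (z, k) (z0, \<kappa> z0) < d1" for z k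
    using *[of "(z, k)"] that by (simp add: D0_def)
  have "d1 / 2 > 0" using d1 by simp
  from \<kappa>(1)[unfolded continuous_on_iff, rule_format, OF N(2) this]
  obtain d2 where d2: "d2 > 0" "\<And>z. z \<in> N \<Longrightarrow> dist z z0 < d2 \<Longrightarrow> dist (\<kappa> z) (\<kappa> z0) < d1 / 2"
    by blast
  obtain d3 where d3: "d3 > 0" "ball z0 d3 \<subseteq> N" using N open_contains_ball by blast
  define d where "d = min (min (d1 / 2) d2) d3"
  have d: "d > 0" "d \<le> d1 / 2" "d \<le> d2" "d \<le> d3" using d1 d2 d3 by (auto simp: d_def)
  have key: "\<bar>G z k - G z0 k - D0 \<bullet> (z - z0)\<bar> \<le> e * norm (z - z0)"
    if z: "z \<in> ball z0 d" and k: "k \<in> C" "dist k (\<kappa> z0) < d1 / 2" for z k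
  proof -
    have "norm ((G z k - D0 \<bullet> z) - (G z0 k - D0 \<bullet> z0)) \<le> e * norm (z - z0)"
    proof (rule differentiable_bound[where S = "ball z0 d" and f' = "\<lambda>\<zeta> h. D \<zeta> k \<bullet> h - D0 \<bullet> h"])
      fix \<zeta> assume \<zeta>: "\<zeta> \<in> ball z0 d"
      then have \<zeta>N: "\<zeta> \<in> N" using d3 d by (auto simp: subset_iff)
      show "((\<lambda>z. G z k - D0 \<bullet> z) has_derivative (\<lambda>h. D \<zeta> k \<bullet> h - D0 \<bullet> h)) (at \<zeta> within ball z0 d)"
        by (rule has_derivative_at_withinI[OF has_derivative_diff[OF deriv[OF \<zeta>N k(1)]
              bounded_linear_imp_has_derivative[OF bounded_linear_inner_right]]])
      have "dist (\<zeta>, k) (z0, \<kappa> z0) \<le> dist \<zeta> z0 + dist k (\<kappa> z0)"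
        by (simp add: dist_Pair_Pair sqrt_sum_squares_le_sum)
      also have "\<dots> < d1" using \<zeta> k d by (simp add: dist_commute)
      finally have "norm (D \<zeta> k - D0) < e" using d1' \<zeta>N k by (simp add: dist_norm)
      show "onorm (\<lambda>h. D \<zeta> k \<bullet> h - D0 \<bullet> h) \<le> e"
      proof (rule onorm_bound)
        fix h
        have "norm (D \<zeta> k \<bullet> h - D0 \<bullet> h) = \<bar>(D \<zeta> k - D0) \<bullet> h\<bar>" by (simp add: inner_diff_left)
        also have "\<dots> \<le> norm (D \<zeta> k - D0) * norm h" by (rule Cauchy_Schwarz_ineq2)
        also have "\<dots> \<le> e * norm h" using \<open>norm (D \<zeta> k - D0) < e\<close> by (intro mult_right_mono) auto
        finally show "norm (D \<zeta> k \<bullet> h - D0 \<bullet> h) \<le> e * norm h" .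
      qed (use e in simp)
    qed (use z d in auto)
    then show ?thesis by (simp add: inner_diff_right algebra_simps)
  qed
  show "\<exists>d>0. \<forall>y. norm (y - z0) < d \<longrightarrow>
      norm (G y (\<kappa> y) - G z0 (\<kappa> z0) - D z0 (\<kappa> z0) \<bullet> (y - z0)) \<le> e * norm (y - z0)"
  proof (intro exI[of _ d] conjI allI impI d(1))
    fix z assume "norm (z - z0) < d"
    then have z: "z \<in> ball z0 d" by (simp add: dist_norm norm_minus_commute)
    then have zN: "z \<in> N" using d3 d by (auto simp: subset_iff)
    have "dist (\<kappa> z) (\<kappa> z0) < d1 / 2" using z d by (intro d2(2)[OF zN]) (simp add: dist_commute)
    then have "\<bar>G z (\<kappa> z) - G z0 (\<kappa> z) - D0 \<bullet> (z - z0)\<bar> \<le> e * norm (z - z0)"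
      using key[OF z] \<kappa>(2)[OF zN] by simp
    moreover have "\<bar>G z (\<kappa> z0) - G z0 (\<kappa> z0) - D0 \<bullet> (z - z0)\<bar> \<le> e * norm (z - z0)"
      using key[OF z] \<kappa>(2)[OF N(2)] d1 by simp
    moreover have "G z (\<kappa> z0) \<le> G z (\<kappa> z)" "G z0 (\<kappa> z) \<le> G z0 (\<kappa> z0)"
      using max zN N \<kappa>(2) by auto
    ultimately show "norm (G z (\<kappa> z) - G z0 (\<kappa> z0) - D z0 (\<kappa> z0) \<bullet> (z - z0)) \<le> e * norm (z - z0)"
      unfolding D0_def[symmetric] real_norm_def by linarith
  qed
qed

text \<open>A supporting hyperplane of the epigraph at (x, f x) cannot be vertical: a normal (v, 0)
  would satisfy v . x \<le> v . y for all y in the whole space, which forces v = 0.\<close>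

lemma convex_on_subgradient:
  fixes f :: "'a::euclidean_space \<Rightarrow> real"
  assumes f: "convex_on UNIV f"
  obtains q where "\<And>y. f x + q \<bullet> (y - x) \<le> f y"
proof -
  have contf: "continuous_on UNIV f"
    using convex_on_continuous[OF open_UNIV f] .
  define E where "E = epigraph UNIV f"
  have "convex E" unfolding E_def using f by (simp add: convex_epigraph)
  have "{(y, r). f y < r} \<subseteq> E" by (auto simp: E_def epigraph_def)
  have notint: "(x, f x) \<notin> interior E"
  proof
    assume "(x, f x) \<in> interior E"
    then obtain e where e: "e > 0" "ball (x, f x) e \<subseteq> E" using mem_interior by blast
    have "(x, f x - e / 2) \<in> ball (x, f x) e" using e by (simp add: dist_Pair_Pair dist_real_def)
    then show False using e by (auto simp: E_def epigraph_def)
  qed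
  have openS: "open {w :: 'a \<times> real. f (fst w) < snd w}"
    by (intro open_Collect_less continuous_intros continuous_on_compose2[OF contf]) auto
  have "(x, f x + 1) \<in> {w. f (fst w) < snd w}" by simp
  moreover have "{w. f (fst w) < snd w} \<subseteq> E" by (auto simp: E_def epigraph_def)
  ultimately have "interior E \<noteq> {}" using openS interior_maximal by blast
  then have "rel_interior E = interior E" by (rule rel_interior_nonempty_interior)
  then have "(x, f x) \<notin> rel_interior E" using notint by simp
  moreover have "(x, f x) \<in> E" by (simp add: E_def epigraph_def)
  ultimately obtain n where n: "n \<noteq> 0" "\<And>w. w \<in> E \<Longrightarrow> n \<bullet> (x, f x) \<le> n \<bullet> w"
    using supporting_hyperplane_rel_boundary[OF \<open>convex E\<close>] by metis
  obtain v s where vs: "n = (v, s)" by (cases n)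
  have le: "v \<bullet> x + s * f x \<le> v \<bullet> y + s * r" if "f y \<le> r" for y r
    using n(2)[of "(y, r)"] that by (simp add: vs E_def epigraph_def)
  have "s \<ge> 0" using le[of x "f x + 1"] by (simp add: algebra_simps)
  moreover have "s \<noteq> 0"
  proof
    assume "s = 0"
    then have "v \<bullet> v \<le> 0" using le[of "x - v" "f (x - v)"] by (simp add: inner_diff_right)
    then have "v = 0" using inner_gt_zero_iff[of v] by linarith
    then show False using n(1) \<open>s = 0\<close> vs by (simp add: zero_prod_def)
  qed
  ultimately have s: "s > 0" by simp
  show ?thesis
  proof (rule that)
    fix y
    have "s * (f x + (- (1 / s) *\<^sub>R v) \<bullet> (y - x)) \<le> s * f y"
      using le[of y "f y"] s by (simp add: inner_diff_right algebra_simps)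
    then show "f x + (- (1 / s) *\<^sub>R v) \<bullet> (y - x) \<le> f y" using s by (simp only: mult_le_cancel_left_pos)
  qed
qed


section \<open>Separable problem\<close>

type_synonym 'n spacetime = "(real^'n) \<times> real"

abbreviation l1 :: "real^'n \<Rightarrow> real" where
  "l1 y \<equiv> (\<Sum>i\<in>UNIV. \<bar>y $ i\<bar>)"

definition sep_V :: "('n::finite \<Rightarrow> real) \<Rightarrow> ('n \<Rightarrow> real) \<Rightarrow> real^'n \<Rightarrow> real \<Rightarrow> real^'n \<Rightarrow> real" where
  "sep_V a b y t p = (\<Sum>i\<in>UNIV. V1 (y $ i) t (p $ i) (a i) (b i))"

definition sep_grad :: "('n::finite \<Rightarrow> real) \<Rightarrow> ('n \<Rightarrow> real) \<Rightarrow> real^'n \<Rightarrow> real \<Rightarrow> real^'n \<Rightarrow> real^'n" where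
  "sep_grad a b y t p = (\<chi> i. V1x (y $ i) t (p $ i) (a i) (b i))"

definition sep_cost :: "('n::finite \<Rightarrow> real) \<Rightarrow> ('n \<Rightarrow> real) \<Rightarrow> real^'n \<Rightarrow> real" where
  "sep_cost a b y = (\<Sum>i\<in>UNIV. max (a i * y $ i) (- b i * y $ i))"

text \<open>The epigraph of the Legendre-Fenchel transform; it replaces extended real values.\<close>

definition conj_epi :: "('a::real_inner \<Rightarrow> real) \<Rightarrow> ('a \<times> real) set" where
  "conj_epi \<Phi> = {(p, r). \<forall>x. p \<bullet> x - \<Phi> x \<le> r}"

locale separable_hj =
  fixes a b :: "'n::finite \<Rightarrow> real" and \<Phi> :: "real^'n \<Rightarrow> real"
  assumes a_pos: "a i > 0" and b_pos: "b i > 0" and convex: "convex_on UNIV \<Phi>"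
begin

text \<open>A sum instead of a maximum, because it has to bound each coefficient and also their
  total in \<open>norm_sep_grad_le\<close>.\<close>

definition slope :: real where "slope = (\<Sum>i\<in>UNIV. max (a i) (b i))"

lemma slope: "max (a i) (b i) \<le> slope" "slope \<ge> 0"
proof -
  have "max (a i) (b i) \<ge> 0" for i using a_pos[of i] by simp
  then show "max (a i) (b i) \<le> slope" "slope \<ge> 0"
    unfolding slope_def using member_le_sum[of i UNIV "\<lambda>i. max (a i) (b i)"] by (simp_all add: sum_nonneg)
qed

lemma sep_V_has_derivative:
  assumes "t > 0"
  shows "((\<lambda>z. sep_V a b (fst z) (snd z) p) has_derivative
    (\<lambda>h. (sep_grad a b y t p, sep_cost a b y - (norm (sep_grad a b y t p))\<^sup>2 / 2) \<bullet> h)) (at (y, t))"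
proof -
  let ?D = "\<lambda>i h. V1x (y $ i) t (p $ i) (a i) (b i) * fst h $ i
      + (max (a i * y $ i) (- b i * y $ i) - (V1x (y $ i) t (p $ i) (a i) (b i))\<^sup>2 / 2) * snd h"
  have "((\<lambda>z. V1 (fst z $ i) (snd z) (p $ i) (a i) (b i)) has_derivative ?D i) (at (y, t))" for i
  proof -
    have "((\<lambda>z. (fst z $ i, snd z, p $ i)) has_derivative (\<lambda>h. (fst h $ i, snd h, 0))) (at (y, t))"
      by (intro has_derivative_Pair derivative_intros has_derivative_const
          bounded_linear_imp_has_derivative bounded_linear_compose[OF bounded_linear_vec_nth]
          bounded_linear_fst)
    moreover have "((\<lambda>(x, t, p). V1 x t p (a i) (b i)) has_derivative
     (\<lambda>(dx, dt, dp). V1x (y $ i) t (p $ i) (a i) (b i) * dx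
        + (max (a i * y $ i) (- b i * y $ i) - (V1x (y $ i) t (p $ i) (a i) (b i))\<^sup>2 / 2) * dt
        + V1p (y $ i) t (p $ i) (a i) (b i) * dp)) (at (fst (y, t) $ i, snd (y, t), p $ i))"
      using V1_has_derivative[OF a_pos b_pos assms] by simp
    ultimately show ?thesis
      using has_derivative_compose[of "\<lambda>z. (fst z $ i, snd z, p $ i)"] by fastforce
  qed
  then have "((\<lambda>z. sep_V a b (fst z) (snd z) p) has_derivative (\<lambda>h. \<Sum>i\<in>UNIV. ?D i h)) (at (y, t))"
    unfolding sep_V_def by (intro has_derivative_sum)
  moreover have "(\<Sum>i\<in>UNIV. ?D i h) = (sep_grad a b y t p, sep_cost a b y - (norm (sep_grad a b y t p))\<^sup>2 / 2) \<bullet> h" for h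
  proof -
    have "(norm (sep_grad a b y t p))\<^sup>2 = (\<Sum>i\<in>UNIV. (V1x (y $ i) t (p $ i) (a i) (b i))\<^sup>2)"
      unfolding power2_norm_eq_inner inner_vec_def by (simp add: sep_grad_def power2_eq_square)
    then have "sep_cost a b y - (norm (sep_grad a b y t p))\<^sup>2 / 2
       = (\<Sum>i\<in>UNIV. max (a i * y $ i) (- b i * y $ i) - (V1x (y $ i) t (p $ i) (a i) (b i))\<^sup>2 / 2)"
      by (simp add: sep_cost_def sum_subtractf sum_divide_distrib)
    then show ?thesis
      by (simp add: inner_prod_def inner_vec_def sep_grad_def sum.distrib sum_distrib_right)
  qed
  ultimately show ?thesis by simp
qed

lemma continuous_on_sep_V:
  "continuous_on {w. 0 \<le> fst (snd w)} (\<lambda>w. sep_V a b (fst w) (fst (snd w)) (snd (snd w)))"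
proof -
  have "continuous_on {w. 0 \<le> fst (snd w)}
    (\<lambda>w. (\<lambda>(x, t, p). V1 x t p (a i) (b i)) (fst w $ i, fst (snd w), snd (snd w) $ i))" for i
    by (rule continuous_on_compose2[OF continuous_on_V1[OF a_pos b_pos]])
       (auto intro!: continuous_intros)
  then show ?thesis unfolding sep_V_def by (intro continuous_on_sum) auto
qed

lemma continuous_on_sep_grad:
  "continuous_on {w. 0 \<le> fst (snd w)} (\<lambda>w. sep_grad a b (fst w) (fst (snd w)) (snd (snd w)))"
proof -
  have "continuous_on {w. 0 \<le> fst (snd w)}
    (\<lambda>w. (\<lambda>(x, t, p). V1x x t p (a i) (b i)) (fst w $ i, fst (snd w), snd (snd w) $ i))" for i
    by (rule continuous_on_compose2[OF continuous_on_V1x[OF a_pos b_pos]])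
       (auto intro!: continuous_intros)
  then show ?thesis unfolding sep_grad_def by (intro continuous_on_vec_lambda) auto
qed

lemma continuous_on_sep_cost: "continuous_on S (sep_cost a b)"
  unfolding sep_cost_def by (intro continuous_intros)

lemma sep_V_zero: "sep_V a b y 0 p = p \<bullet> y"
  unfolding sep_V_def by (simp add: V1_zero_time a_pos b_pos inner_vec_def)

lemma sep_V_convex:
  assumes "t \<ge> 0"
  shows "convex_on UNIV (\<lambda>y. sep_V a b y t p)"
proof (intro convex_onI)
  fix s :: real and x y :: "real^'n" assume s: "0 < s" "s < 1"
  have "V1 (((1 - s) *\<^sub>R x + s *\<^sub>R y) $ i) t (p $ i) (a i) (b i)
     \<le> (1 - s) * V1 (x $ i) t (p $ i) (a i) (b i) + s * V1 (y $ i) t (p $ i) (a i) (b i)" for i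
    using convex_onD[OF V1_convex[OF a_pos b_pos assms], of s "x $ i" "y $ i"] s by simp
  then have "(\<Sum>i\<in>UNIV. V1 (((1 - s) *\<^sub>R x + s *\<^sub>R y) $ i) t (p $ i) (a i) (b i))
    \<le> (\<Sum>i\<in>UNIV. (1 - s) * V1 (x $ i) t (p $ i) (a i) (b i) + s * V1 (y $ i) t (p $ i) (a i) (b i))"
    by (intro sum_mono)
  then show "sep_V a b ((1 - s) *\<^sub>R x + s *\<^sub>R y) t p \<le> (1 - s) * sep_V a b x t p + s * sep_V a b y t p"
    by (simp add: sep_V_def sum.distrib sum_distrib_left)
qed simp

lemma sep_V_strict_concave_midpoint:
  assumes "t > 0" "p \<noteq> r"
  shows "sep_V a b y t p + sep_V a b y t r < 2 * sep_V a b y t ((1/2) *\<^sub>R (p + r))"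
proof -
  obtain j where j: "p $ j \<noteq> r $ j" using assms by (metis vec_eq_iff)
  have "(\<Sum>i\<in>UNIV. V1 (y $ i) t (p $ i) (a i) (b i) + V1 (y $ i) t (r $ i) (a i) (b i))
     < (\<Sum>i\<in>UNIV. 2 * V1 (y $ i) t ((p $ i + r $ i) / 2) (a i) (b i))"
  proof (rule sum_strict_mono_ex1)
    show "\<exists>i\<in>UNIV. V1 (y $ i) t (p $ i) (a i) (b i) + V1 (y $ i) t (r $ i) (a i) (b i)
       < 2 * V1 (y $ i) t ((p $ i + r $ i) / 2) (a i) (b i)"
      using V1_strict_concave_midpoint[OF a_pos b_pos assms(1) j, of "y $ j" j j] by blast
  qed (auto intro: V1_concave_midpoint[OF a_pos b_pos assms(1)])
  then show ?thesis
    by (simp add: sep_V_def sum.distrib sum_distrib_left)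
qed

lemma l1_le_norm: "l1 y \<le> real CARD('n) * norm (y :: real^'n)"
  using sum_bounded_above[of UNIV "\<lambda>i. \<bar>y $ i\<bar>" "norm y"] component_le_norm_cart by auto

lemma sep_V_upper_bound:
  assumes t: "t > 0"
  shows "sep_V a b y t p \<le> p \<bullet> z + (norm (y - z))\<^sup>2 / (2 * t)
     + t * slope * (l1 y + l1 z)"
proof -
  have "V1 (y $ i) t (p $ i) (a i) (b i) \<le> p $ i * z $ i + (y $ i - z $ i)\<^sup>2 / (2 * t)
     + t * slope * (\<bar>y $ i\<bar> + \<bar>z $ i\<bar>)" for i
  proof -
    have "t * max (a i) (b i) * (\<bar>y $ i\<bar> + \<bar>z $ i\<bar>) \<le> t * slope * (\<bar>y $ i\<bar> + \<bar>z $ i\<bar>)"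
      using slope t by (intro mult_right_mono mult_left_mono) auto
    then show ?thesis
      using V1_upper_bound[OF a_pos b_pos t, of "y $ i" "p $ i" i i "z $ i"] by linarith
  qed
  then have "sep_V a b y t p \<le> (\<Sum>i\<in>UNIV. p $ i * z $ i + (y $ i - z $ i)\<^sup>2 / (2 * t)
     + t * slope * (\<bar>y $ i\<bar> + \<bar>z $ i\<bar>))"
    unfolding sep_V_def by (intro sum_mono)
  also have "\<dots> = p \<bullet> z + (norm (y - z))\<^sup>2 / (2 * t)
     + t * slope * (l1 y + l1 z)"
    unfolding power2_norm_eq_inner inner_vec_def
    by (simp add: sum.distrib sum_distrib_left sum_divide_distrib power2_eq_square distrib_left)
  finally show ?thesis .
qed

lemma sep_V_upper_bound_same:
  assumes "t \<ge> 0"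
  shows "sep_V a b y t p \<le> p \<bullet> y + 2 * t * slope * l1 y"
  using sep_V_upper_bound[of t y p y] assms
  by (cases "t = 0") (auto simp: sep_V_zero algebra_simps)

lemma sep_V_coercive:
  assumes t: "t > 0"
  shows "sep_V a b y t p \<le> (norm y + CARD('n))\<^sup>2 / (2 * t)
     + t * slope * (CARD('n) * norm y + CARD('n)) - norm p"
proof -
  \<comment> \<open>Starting at minus the sign vector of p turns the linear term into - l1 p, at a
    cost that does not depend on p. The cardinality bounds both norms of \<open>z\<close>.\<close>
  define z :: "real^'n" where "z = (\<chi> i. - sgn (p $ i))"
  have "p \<bullet> z = - l1 p"
    by (simp add: z_def inner_vec_def sum_negf abs_sgn)
  then have 1: "p \<bullet> z \<le> - norm p" using norm_le_l1_cart[of p] by simp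
  have "l1 z \<le> (\<Sum>i\<in>(UNIV :: 'n set). 1)"
    by (intro sum_mono) (simp add: z_def abs_sgn_eq)
  then have 2: "l1 z \<le> CARD('n)" by simp
  then have "norm z \<le> CARD('n)" using norm_le_l1_cart[of z] by simp
  then have "norm (y - z) \<le> norm y + CARD('n)" using norm_triangle_ineq4[of y z] by simp
  then have 3: "(norm (y - z))\<^sup>2 / (2 * t) \<le> (norm y + CARD('n))\<^sup>2 / (2 * t)"
    using t by (intro divide_right_mono power_mono) auto
  have "t * slope * (l1 y + l1 z)
     \<le> t * slope * (CARD('n) * norm y + CARD('n))"
    using t slope(2) 2 l1_le_norm[of y] by (intro mult_left_mono add_mono) auto
  then show ?thesis using sep_V_upper_bound[OF t, of y p z] 1 3 by linarith
qed

definition drift :: "real^'n \<Rightarrow> real \<Rightarrow> real" where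
  "drift p t = (\<Sum>i\<in>UNIV. (\<bar>p $ i\<bar> + max (a i) (b i) * t)\<^sup>2 / 2)"

lemma drift_mono: "0 \<le> s \<Longrightarrow> s \<le> t \<Longrightarrow> drift p s \<le> drift p t"
  unfolding drift_def using a_pos b_pos
  by (intro sum_mono divide_right_mono power_mono add_left_mono mult_left_mono)
     (auto intro!: add_nonneg_nonneg mult_nonneg_nonneg simp: le_max_iff_disj less_imp_le)

lemma drift_nonneg: "drift p t \<ge> 0"
  unfolding drift_def by (intro sum_nonneg) simp

lemma sep_V_lower_bound:
  assumes "t \<ge> 0"
  shows "p \<bullet> y - t * drift p t \<le> sep_V a b y t p"
proof -
  have "(\<Sum>i\<in>UNIV. p $ i * y $ i - t * (\<bar>p $ i\<bar> + max (a i) (b i) * t)\<^sup>2 / 2) \<le> sep_V a b y t p"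
    unfolding sep_V_def using V1_lower_bound[OF a_pos b_pos assms] by (intro sum_mono) auto
  then show ?thesis
    by (simp add: inner_vec_def drift_def sum_subtractf sum_distrib_left)
qed

lemma norm_sep_grad_le:
  assumes "0 \<le> t"
  shows "norm (sep_grad a b y t p) \<le> l1 p + slope * t"
proof -
  have "norm (sep_grad a b y t p) \<le> (\<Sum>i\<in>UNIV. \<bar>sep_grad a b y t p $ i\<bar>)" by (rule norm_le_l1_cart)
  also have "\<dots> \<le> (\<Sum>i\<in>UNIV. \<bar>p $ i\<bar> + max (a i) (b i) * t)"
    unfolding sep_grad_def using V1x_bound[OF a_pos b_pos assms] by (intro sum_mono) simp
  also have "\<dots> = l1 p + slope * t"
    by (simp add: sum.distrib slope_def sum_distrib_right)
  finally show ?thesis .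
qed

end


section \<open>Value function\<close>

lemma closed_conj_epi: "closed (conj_epi \<Phi>)"
proof -
  have "conj_epi \<Phi> = (\<Inter>x. {k. fst k \<bullet> x - \<Phi> x \<le> snd k})"
    by (auto simp: conj_epi_def)
  also have "closed \<dots>" by (intro closed_INT ballI closed_Collect_le continuous_intros)
  finally show ?thesis .
qed

lemma conj_epiD: "k \<in> conj_epi \<Phi> \<Longrightarrow> fst k \<bullet> x - \<Phi> x \<le> snd k"
  by (auto simp: conj_epi_def)

lemma conj_epi_midpoint:
  assumes "(p, r) \<in> conj_epi \<Phi>" "(q, s) \<in> conj_epi \<Phi>"
  shows "((1/2) *\<^sub>R (p + q), (r + s) / 2) \<in> conj_epi \<Phi>"
proof -
  have "((1/2) *\<^sub>R (p + q)) \<bullet> x - \<Phi> x \<le> (r + s) / 2" for x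
  proof -
    have "p \<bullet> x - \<Phi> x \<le> r" "q \<bullet> x - \<Phi> x \<le> s" using assms by (auto simp: conj_epi_def)
    moreover have "((1/2) *\<^sub>R (p + q)) \<bullet> x = (p \<bullet> x + q \<bullet> x) / 2" by (simp add: inner_add_left)
    ultimately show ?thesis unfolding add_divide_distrib by linarith
  qed
  then show ?thesis by (simp add: conj_epi_def)
qed

text \<open>A subgradient p at x gives equality in the Fenchel-Young inequality, that is, an affine
  minorant touching at x. It yields the initial value and the lower half of the squeeze near time
  0.\<close>

lemma conj_epi_exact:
  fixes \<Phi> :: "'a::euclidean_space \<Rightarrow> real"
  assumes "convex_on UNIV \<Phi>"
  obtains p where "(p, p \<bullet> x - \<Phi> x) \<in> conj_epi \<Phi>"
proof -
  obtain p where p: "\<And>y. \<Phi> x + p \<bullet> (y - x) \<le> \<Phi> y" using convex_on_subgradient[OF assms] by metis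
  have "p \<bullet> y - \<Phi> y \<le> p \<bullet> x - \<Phi> x" for y using p[of y] by (simp add: inner_diff_right)
  then show ?thesis by (intro that[of p]) (simp add: conj_epi_def)
qed

context separable_hj
begin

text \<open>The pair (p, r) acts as the control. The objective is then jointly continuous for t
  \<ge> 0 over a closed set, while the conjugate itself may be infinite or discontinuous.\<close>

definition payoff :: "'n spacetime \<Rightarrow> (real^'n) \<times> real \<Rightarrow> real" where
  "payoff z k = sep_V a b (fst z) (snd z) (fst k) - snd k"

definition val :: "real^'n \<Rightarrow> real \<Rightarrow> real" where
  "val y t = (SUP k\<in>conj_epi \<Phi>. payoff (y, t) k)"

lemma conj_epi_nonempty: "conj_epi \<Phi> \<noteq> {}"
  using conj_epi_exact[OF convex] by blast

lemma payoff_upper_bound: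
  assumes "k \<in> conj_epi \<Phi>" "t \<ge> 0"
  shows "payoff (y, t) k \<le> \<Phi> y + 2 * t * slope * l1 y"
  using sep_V_upper_bound_same[OF assms(2), of y "fst k"] conj_epiD[OF assms(1), of y]
  by (simp add: payoff_def)

lemma bdd_above_payoff: "t \<ge> 0 \<Longrightarrow> bdd_above (payoff (y, t) ` conj_epi \<Phi>)"
  using payoff_upper_bound by (intro bdd_aboveI2)

lemma payoff_le_val: "t \<ge> 0 \<Longrightarrow> k \<in> conj_epi \<Phi> \<Longrightarrow> payoff (y, t) k \<le> val y t"
  unfolding val_def by (intro cSUP_upper bdd_above_payoff)

lemma val_upper_bound: "t \<ge> 0 \<Longrightarrow> val y t \<le> \<Phi> y + 2 * t * slope * l1 y"
  unfolding val_def by (intro cSUP_least conj_epi_nonempty payoff_upper_bound)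

lemma val_lower_bound:
  assumes "t \<ge> 0" "(p, r) \<in> conj_epi \<Phi>"
  shows "p \<bullet> y - r - t * drift p t \<le> val y t"
  using payoff_le_val[OF assms, of y] sep_V_lower_bound[OF assms(1), of p y]
  by (simp add: payoff_def)

lemma val_zero: "val y 0 = \<Phi> y"
proof (rule antisym)
  show "val y 0 \<le> \<Phi> y" using val_upper_bound[of 0 y] by simp
  obtain p where "(p, p \<bullet> y - \<Phi> y) \<in> conj_epi \<Phi>" by (rule conj_epi_exact[OF convex])
  then show "\<Phi> y \<le> val y 0" using val_lower_bound[of 0 p "p \<bullet> y - \<Phi> y" y] by simp
qed

lemma val_convex:
  assumes "t \<ge> 0"
  shows "convex_on UNIV (\<lambda>y. val y t)"
proof (intro convex_onI)
  fix s :: real and x y :: "real^'n" assume s: "0 < s" "s < 1"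
  have "payoff ((1 - s) *\<^sub>R x + s *\<^sub>R y, t) k \<le> (1 - s) * val x t + s * val y t"
    if k: "k \<in> conj_epi \<Phi>" for k
  proof -
    have "sep_V a b ((1 - s) *\<^sub>R x + s *\<^sub>R y) t (fst k)
       \<le> (1 - s) * sep_V a b x t (fst k) + s * sep_V a b y t (fst k)"
      using convex_onD[OF sep_V_convex[OF assms], of s x y "fst k"] s by simp
    then have "payoff ((1 - s) *\<^sub>R x + s *\<^sub>R y, t) k \<le> (1 - s) * payoff (x, t) k + s * payoff (y, t) k"
      by (simp add: payoff_def algebra_simps)
    also have "\<dots> \<le> (1 - s) * val x t + s * val y t"
      using s payoff_le_val[OF assms k] by (intro add_mono mult_left_mono) auto
    finally show ?thesis .
  qed
  then show "val ((1 - s) *\<^sub>R x + s *\<^sub>R y) t \<le> (1 - s) * val x t + s * val y t"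
    unfolding val_def[of "(1 - s) *\<^sub>R x + s *\<^sub>R y"] by (intro cSUP_least conj_epi_nonempty)
qed simp

lemma continuous_on_payoff:
  "continuous_on {w. 0 \<le> snd (fst w)} (\<lambda>w. payoff (fst w) (snd w))"
proof -
  have "continuous_on {w. 0 \<le> snd (fst w)} (\<lambda>w. (\<lambda>w. sep_V a b (fst w) (fst (snd w)) (snd (snd w)))
      (fst (fst w), snd (fst w), fst (snd w)))"
    by (rule continuous_on_compose2[OF continuous_on_sep_V]) (auto intro!: continuous_intros)
  then have "continuous_on {w. 0 \<le> snd (fst w)} (\<lambda>w. sep_V a b (fst (fst w)) (snd (fst w)) (fst (snd w)))"
    by simp
  then show ?thesis unfolding payoff_def by (intro continuous_intros)
qed

definition payoff_grad :: "'n spacetime \<Rightarrow> (real^'n) \<times> real \<Rightarrow> 'n spacetime" where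
  "payoff_grad z k = (sep_grad a b (fst z) (snd z) (fst k),
     sep_cost a b (fst z) - (norm (sep_grad a b (fst z) (snd z) (fst k)))\<^sup>2 / 2)"

lemma continuous_on_payoff_grad:
  "continuous_on {w. 0 \<le> snd (fst w)} (\<lambda>w. payoff_grad (fst w) (snd w))"
proof -
  have "continuous_on {w. 0 \<le> snd (fst w)} (\<lambda>w. (\<lambda>w. sep_grad a b (fst w) (fst (snd w)) (snd (snd w)))
      (fst (fst w), snd (fst w), fst (snd w)))"
    by (rule continuous_on_compose2[OF continuous_on_sep_grad]) (auto intro!: continuous_intros)
  then have 1: "continuous_on {w. 0 \<le> snd (fst w)} (\<lambda>w. sep_grad a b (fst (fst w)) (snd (fst w)) (fst (snd w)))"
    by simp
  have "continuous_on {w. 0 \<le> snd (fst w)} (\<lambda>w. sep_cost a b (fst (fst w)))"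
    by (rule continuous_on_compose2[OF continuous_on_sep_cost[of UNIV]]) (auto intro!: continuous_intros)
  with 1 show ?thesis unfolding payoff_grad_def by (intro continuous_intros) auto
qed

lemma payoff_has_derivative:
  assumes "snd z > 0"
  shows "((\<lambda>z. payoff z k) has_derivative (\<lambda>h. payoff_grad z k \<bullet> h)) (at z)"
  using sep_V_has_derivative[OF assms, of "fst k" "fst z"]
  unfolding payoff_def payoff_grad_def by (auto intro: derivative_eq_intros)

text \<open>Two maximizers with different slopes would be beaten by their midpoint; equal slopes and
  equal payoffs force equal r.\<close>

lemma payoff_unique_max:
  assumes t: "snd z > 0" and k: "k \<in> conj_epi \<Phi>" "l \<in> conj_epi \<Phi>"
    and max: "\<And>m. m \<in> conj_epi \<Phi> \<Longrightarrow> payoff z m \<le> payoff z k" "payoff z l = payoff z k"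
  shows "l = k"
proof -
  obtain p r q s where pr: "k = (p, r)" "l = (q, s)" by (cases k, cases l)
  have "q = p"
  proof (rule ccontr)
    assume "q \<noteq> p"
    define m where "m = ((1/2) *\<^sub>R (q + p), (s + r) / 2)"
    have "m \<in> conj_epi \<Phi>" unfolding m_def using conj_epi_midpoint k pr by blast
    moreover have "payoff z l + payoff z k < 2 * payoff z m"
    proof -
      have "X - s + (Y - r) < 2 * (M - (s + r) / 2)" if "X + Y < 2 * M" for X Y M :: real
        using that by (simp add: field_simps)
      then show ?thesis
        using sep_V_strict_concave_midpoint[OF t \<open>q \<noteq> p\<close>, of "fst z"]
        unfolding payoff_def pr m_def fst_conv snd_conv by blast
    qed
    ultimately show False using max(1)[of m] max(2) by simp
  qed
  then show ?thesis using max(2) by (simp add: payoff_def pr)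
qed

text \<open>Coercivity in the dual variable confines the maximizers locally to a compact set.\<close>

lemma compact_argmax:
  assumes t0: "0 < t0"
  obtains C where "compact C" "C \<subseteq> conj_epi \<Phi>"
    "\<And>z. z \<in> cball y0 \<rho> \<times> {t0..T} \<Longrightarrow> \<exists>k\<in>C. \<forall>l\<in>conj_epi \<Phi>. payoff z l \<le> payoff z k"
    "\<And>z k. z \<in> cball y0 \<rho> \<times> {t0..T} \<Longrightarrow> k \<in> conj_epi \<Phi> \<Longrightarrow>
       (\<And>l. l \<in> conj_epi \<Phi> \<Longrightarrow> payoff z l \<le> payoff z k) \<Longrightarrow> k \<in> C"
proof -
  define Z where "Z = cball y0 \<rho> \<times> {t0..T}"
  have Z: "compact Z" unfolding Z_def by (intro compact_Times compact_cball compact_Icc)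
  have Zt: "0 < snd z" if "z \<in> Z" for z using that t0 by (auto simp: Z_def)
  obtain k0 where k0: "k0 \<in> conj_epi \<Phi>" using conj_epi_nonempty by blast
  have "continuous_on Z (\<lambda>z. (\<lambda>w. payoff (fst w) (snd w)) (z, k0))"
    by (rule continuous_on_compose2[OF continuous_on_payoff])
       (auto intro!: continuous_intros less_imp_le[OF Zt])
  then have "bdd_below ((\<lambda>z. payoff z k0) ` Z)"
    using Z by (intro bounded_imp_bdd_below compact_imp_bounded compact_continuous_image) simp_all
  then obtain m where m: "\<And>z. z \<in> Z \<Longrightarrow> m \<le> payoff z k0" by (auto simp: bdd_below_def)
  define B where "B = (\<lambda>z :: 'n spacetime. (norm (fst z) + CARD('n))\<^sup>2 / (2 * snd z)
     + snd z * slope * (CARD('n) * norm (fst z) + CARD('n)))"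
  have "continuous_on Z B" unfolding B_def using less_imp_neq[OF Zt] by (intro continuous_intros) auto
  then have "bdd_above (B ` Z)"
    using Z by (intro bounded_imp_bdd_above compact_imp_bounded compact_continuous_image)
  then obtain c where c: "\<And>z. z \<in> Z \<Longrightarrow> B z \<le> c" by (auto simp: bdd_above_def)
  \<comment> \<open>The box contains every control that is at least as good as the fixed
    \<open>k0\<close> at some point of \<open>Z\<close>: the payoff is then at least
    \<open>m\<close> and at most c - norm p - r, while r \<ge> - \<Phi> 0.\<close>
  define C where "C = conj_epi \<Phi> \<inter> (cball 0 (c + \<Phi> 0 - m) \<times> {- \<Phi> 0..c - m})"
  have inC: "k \<in> C" if z: "z \<in> Z" and k: "k \<in> conj_epi \<Phi>" "payoff z k0 \<le> payoff z k" for z k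
  proof -
    have "m \<le> c - norm (fst k) - snd k"
      using m[OF z] c[OF z] k(2) sep_V_coercive[OF Zt[OF z], of "fst z" "fst k"]
      by (simp add: payoff_def B_def)
    moreover have "- \<Phi> 0 \<le> snd k" using conj_epiD[OF k(1), of 0] by simp
    ultimately have "norm (fst k) \<le> c + \<Phi> 0 - m" "snd k \<le> c - m" "- \<Phi> 0 \<le> snd k"
      using norm_ge_zero[of "fst k"] by linarith+
    then show ?thesis using k by (cases k) (auto simp: C_def)
  qed
  have C: "compact C" unfolding C_def
    by (intro closed_Int_compact closed_conj_epi compact_Times compact_cball compact_Icc)
  show ?thesis
  proof (rule that[OF C])
    show "C \<subseteq> conj_epi \<Phi>" by (auto simp: C_def)
    show "k \<in> C" if "z \<in> cball y0 \<rho> \<times> {t0..T}" "k \<in> conj_epi \<Phi>"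
      "\<And>l. l \<in> conj_epi \<Phi> \<Longrightarrow> payoff z l \<le> payoff z k" for z k
      using inC[OF _ that(2) that(3)[OF k0]] that(1) by (simp add: Z_def)
    fix z assume "z \<in> cball y0 \<rho> \<times> {t0..T}"
    then have z: "z \<in> Z" by (simp add: Z_def)
    have "k0 \<in> C" using inC[OF z k0] by simp
    have "continuous_on C (\<lambda>k. (\<lambda>w. payoff (fst w) (snd w)) (z, k))"
      by (rule continuous_on_compose2[OF continuous_on_payoff])
         (use Zt[OF z] in \<open>auto intro!: continuous_intros\<close>)
    then have "continuous_on C (payoff z)" by simp
    then have "\<exists>k\<in>C. \<forall>l\<in>C. payoff z l \<le> payoff z k"
      using \<open>k0 \<in> C\<close> by (intro continuous_attains_sup[OF C]) auto
    then obtain k where k: "k \<in> C" "\<And>l. l \<in> C \<Longrightarrow> payoff z l \<le> payoff z k" by blast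
    have "payoff z l \<le> payoff z k" if l: "l \<in> conj_epi \<Phi>" for l
    proof (cases "payoff z k0 \<le> payoff z l")
      case True
      then show ?thesis using inC[OF z l] k(2) by blast
    next
      case False
      then show ?thesis using k(2)[OF \<open>k0 \<in> C\<close>] by simp
    qed
    then show "\<exists>k\<in>C. \<forall>l\<in>conj_epi \<Phi>. payoff z l \<le> payoff z k" using k by blast
  qed
qed

definition opt :: "'n spacetime \<Rightarrow> (real^'n) \<times> real" where
  "opt z = (SOME k. k \<in> conj_epi \<Phi> \<and> (\<forall>l\<in>conj_epi \<Phi>. payoff z l \<le> payoff z k))"

lemma opt:
  assumes "snd z > 0"
  shows "opt z \<in> conj_epi \<Phi>" "\<And>l. l \<in> conj_epi \<Phi> \<Longrightarrow> payoff z l \<le> payoff z (opt z)"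
proof -
  have z: "z \<in> cball (fst z) 0 \<times> {snd z..snd z}" by (cases z) simp
  have "\<exists>k. k \<in> conj_epi \<Phi> \<and> (\<forall>l\<in>conj_epi \<Phi>. payoff z l \<le> payoff z k)"
    by (rule compact_argmax[OF assms, of "fst z" 0 "snd z"]) (use z in blast)
  from someI_ex[OF this] show "opt z \<in> conj_epi \<Phi>"
    "\<And>l. l \<in> conj_epi \<Phi> \<Longrightarrow> payoff z l \<le> payoff z (opt z)"
    by (auto simp: opt_def)
qed

lemma val_eq_payoff_opt:
  assumes "snd z > 0"
  shows "val (fst z) (snd z) = payoff z (opt z)"
proof (rule antisym)
  show "val (fst z) (snd z) \<le> payoff z (opt z)"
    unfolding val_def using opt[OF assms] by (intro cSUP_least conj_epi_nonempty) auto
  show "payoff z (opt z) \<le> val (fst z) (snd z)"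
    using payoff_le_val[of "snd z" "opt z" "fst z"] opt[OF assms] assms by simp
qed

definition val_grad :: "real^'n \<Rightarrow> real \<Rightarrow> real^'n" where
  "val_grad y t = sep_grad a b y t (fst (opt (y, t)))"

text \<open>The time interval stays away from 0, where the coercive bound blows up. On the closed
  box the maximizers are unique and lie in one compact set, so they depend continuously on z; the
  envelope theorem then needs an open set inside the box.\<close>

lemma opt_local:
  assumes "snd z0 > 0"
  obtains N C where "open N" "z0 \<in> N" "N \<subseteq> {z. snd z > 0}" "compact C" "C \<subseteq> conj_epi \<Phi>"
    "\<And>z. z \<in> N \<Longrightarrow> opt z \<in> C" "continuous_on N opt"
proof -
  define t0 where "t0 = snd z0"
  have t0: "t0 / 2 > 0" using assms by (simp add: t0_def)
  let ?Z = "cball (fst z0) 1 \<times> {t0 / 2..2 * t0}"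
  obtain C where C: "compact C" "C \<subseteq> conj_epi \<Phi>"
    and Cmax: "\<And>z k. z \<in> ?Z \<Longrightarrow> k \<in> conj_epi \<Phi> \<Longrightarrow>
       (\<And>l. l \<in> conj_epi \<Phi> \<Longrightarrow> payoff z l \<le> payoff z k) \<Longrightarrow> k \<in> C"
    using compact_argmax[OF t0, of "fst z0" 1 "2 * t0"] by metis
  have Zt: "snd z > 0" if "z \<in> ?Z" for z using that t0 by auto
  have optC: "opt z \<in> C" if "z \<in> ?Z" for z
    using Cmax[OF that] opt[OF Zt[OF that]] by blast
  define N where "N = ball (fst z0) 1 \<times> {t0 / 2<..<2 * t0}"
  have NZ: "N \<subseteq> ?Z" by (auto simp: N_def)
  have "continuous_on ?Z opt"
  proof (rule argmax_continuous[where G = payoff and C = C])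
    show "closed ?Z" by (intro closed_Times closed_cball closed_atLeastAtMost)
    show "continuous_on (?Z \<times> C) (\<lambda>(z, k). payoff z k)"
      unfolding case_prod_unfold
      by (rule continuous_on_subset[OF continuous_on_payoff]) (auto intro!: less_imp_le[OF Zt])
    show "k = opt z" if "z \<in> ?Z" "k \<in> C" "payoff z k = payoff z (opt z)" for z k
      using C that(2)
      by (intro payoff_unique_max[OF Zt[OF that(1)] opt(1)[OF Zt[OF that(1)]] _ opt(2)[OF Zt[OF that(1)]] that(3)]) auto
    show "payoff z k \<le> payoff z (opt z)" if "z \<in> ?Z" "k \<in> C" for z k
      using opt(2)[OF Zt[OF that(1)]] C that(2) by blast
  qed (fact C(1), rule optC)
  then have "continuous_on N opt" by (rule continuous_on_subset[OF _ NZ])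
  moreover have "open N" unfolding N_def by (intro open_Times open_ball open_greaterThanLessThan)
  moreover have "z0 \<in> N" using assms by (cases z0) (auto simp: N_def t0_def)
  moreover have "N \<subseteq> {z. snd z > 0}" using NZ Zt by blast
  ultimately show ?thesis using C optC NZ by (intro that[of N C]) auto
qed

text \<open>Every payoff solves the equation with the same potential, and the envelope theorem
  evaluates its gradient at the maximizer. The time component is thus already the equation for
  \<open>val\<close>.\<close>

lemma val_has_derivative:
  assumes "t > 0"
  shows "((\<lambda>z. val (fst z) (snd z)) has_derivative
    (\<lambda>h. (val_grad y t, sep_cost a b y - (norm (val_grad y t))\<^sup>2 / 2) \<bullet> h)) (at (y, t))"
proof -
  have "snd (y, t) > 0" using assms by simp
  from opt_local[OF this] obtain N C where N: "open N" "(y, t) \<in> N" "N \<subseteq> {z. snd z > 0}"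
    and C: "C \<subseteq> conj_epi \<Phi>" "\<And>z. z \<in> N \<Longrightarrow> opt z \<in> C" "continuous_on N opt" by metis
  have "((\<lambda>z. payoff z (opt z)) has_derivative (\<lambda>h. payoff_grad (y, t) (opt (y, t)) \<bullet> h)) (at (y, t))"
  proof (rule envelope_has_derivative[where G = payoff and D = payoff_grad and \<kappa> = opt and C = C and N = N])
    show "continuous_on (N \<times> C) (\<lambda>(z, k). payoff_grad z k)"
      unfolding case_prod_unfold
      by (rule continuous_on_subset[OF continuous_on_payoff_grad]) (use N in \<open>auto simp: subset_iff less_imp_le\<close>)
    show "payoff z k \<le> payoff z (opt z)" if "z \<in> N" "k \<in> C" for z k
      using opt(2)[of z k] N(3) C(1) that by blast
    show "((\<lambda>z. payoff z k) has_derivative (\<lambda>h. payoff_grad z k \<bullet> h)) (at z)" if "z \<in> N" "k \<in> C" for z k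
      using payoff_has_derivative[of z k] N(3) that by blast
  qed (fact N C)+
  then have "((\<lambda>z. val (fst z) (snd z)) has_derivative (\<lambda>h. payoff_grad (y, t) (opt (y, t)) \<bullet> h)) (at (y, t))"
    by (rule has_derivative_transform_within_open[OF _ N(1,2)]) (use N(3) val_eq_payoff_opt in \<open>metis mem_Collect_eq subsetD\<close>)
  then show ?thesis by (simp add: payoff_grad_def val_grad_def)
qed

lemma continuous_on_val_grad:
  "continuous_on {z. snd z > 0} (\<lambda>z. val_grad (fst z) (snd z))"
proof -
  have "open {z :: 'n spacetime. snd z > 0}" by (intro open_Collect_less continuous_intros)
  moreover have "isCont (\<lambda>z. val_grad (fst z) (snd z)) z0" if z0: "snd z0 > 0" for z0
  proof -
    obtain N C where N: "open N" "z0 \<in> N" "N \<subseteq> {z. snd z > 0}" "continuous_on N opt"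
      using opt_local[OF z0] by metis
    have "continuous_on N (\<lambda>z. (\<lambda>w. payoff_grad (fst w) (snd w)) (z, opt z))"
      by (rule continuous_on_compose2[OF continuous_on_payoff_grad])
         (use N in \<open>auto intro!: continuous_intros less_imp_le simp: subset_iff\<close>)
    then have "continuous_on N (\<lambda>z. fst (payoff_grad z (opt z)))"
      by (intro continuous_intros) simp
    then have "continuous_on N (\<lambda>z. val_grad (fst z) (snd z))"
      by (simp add: payoff_grad_def val_grad_def)
    then show ?thesis using N by (simp add: continuous_on_eq_continuous_at)
  qed
  ultimately show ?thesis by (simp add: continuous_on_eq_continuous_at)
qed

lemma continuous_on_val: "continuous_on (UNIV \<times> {0..}) (\<lambda>z. val (fst z) (snd z))"
  unfolding continuous_on_def
proof
  fix z0 :: "'n spacetime" assume z0: "z0 \<in> UNIV \<times> {0..}"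
  obtain y0 t0 where yt: "z0 = (y0, t0)" "t0 \<ge> 0" using z0 by (cases z0) auto
  show "((\<lambda>z. val (fst z) (snd z)) \<longlongrightarrow> val (fst z0) (snd z0)) (at z0 within UNIV \<times> {0..})"
  proof (cases "t0 > 0")
    case True
    then have "isCont (\<lambda>z. val (fst z) (snd z)) z0"
      using val_has_derivative yt has_derivative_continuous by blast
    then show ?thesis unfolding isCont_def by (rule Lim_at_imp_Lim_at_within)
  next
    case False
    then have t0: "t0 = 0" using yt by simp
    \<comment> \<open>An affine minorant touching at \<open>y0\<close> bounds \<open>val\<close>
      from below near (y0, 0), up to a term that vanishes with t.\<close>
    obtain p where p: "(p, p \<bullet> y0 - \<Phi> y0) \<in> conj_epi \<Phi>" by (rule conj_epi_exact[OF convex])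
    let ?l = "\<lambda>z :: 'n spacetime. p \<bullet> fst z - (p \<bullet> y0 - \<Phi> y0) - snd z * drift p (snd z)"
    let ?u = "\<lambda>z :: 'n spacetime. \<Phi> (fst z) + 2 * snd z * slope * l1 (fst z)"
    have "continuous_on UNIV ?l" unfolding drift_def by (intro continuous_intros) auto
    then have "(?l \<longlongrightarrow> ?l z0) (at z0 within UNIV \<times> {0..})"
      by (meson UNIV_I continuous_on_def tendsto_within_subset top_greatest)
    then have l: "(?l \<longlongrightarrow> \<Phi> y0) (at z0 within UNIV \<times> {0..})" by (simp add: yt t0)
    have "continuous_on UNIV ?u"
      by (intro continuous_intros continuous_on_compose2[OF convex_on_continuous[OF open_UNIV convex]]) auto
    then have "(?u \<longlongrightarrow> ?u z0) (at z0 within UNIV \<times> {0..})"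
      by (meson UNIV_I continuous_on_def tendsto_within_subset top_greatest)
    then have u: "(?u \<longlongrightarrow> \<Phi> y0) (at z0 within UNIV \<times> {0..})" by (simp add: yt t0)
    have "((\<lambda>z. val (fst z) (snd z)) \<longlongrightarrow> \<Phi> y0) (at z0 within UNIV \<times> {0..})"
    proof (rule tendsto_sandwich[OF _ _ l u])
      show "\<forall>\<^sub>F z in at z0 within UNIV \<times> {0..}. ?l z \<le> val (fst z) (snd z)"
        using val_lower_bound[OF _ p] by (auto simp: eventually_at_filter intro!: always_eventually)
      show "\<forall>\<^sub>F z in at z0 within UNIV \<times> {0..}. val (fst z) (snd z) \<le> ?u z"
        using val_upper_bound by (auto simp: eventually_at_filter intro!: always_eventually)
    qed
    then show ?thesis by (simp add: yt t0 val_zero)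
  qed
qed

end


section \<open>Comparison\<close>

text \<open>Carries the gradient along explicitly, so that a test function assembled from sums and
  compositions can be substituted into the equation.\<close>

definition grad_of :: "('a::real_inner \<Rightarrow> real) \<Rightarrow> ('a \<Rightarrow> 'a) \<Rightarrow> 'a set \<Rightarrow> bool" where
  "grad_of f D S \<longleftrightarrow> (\<forall>z\<in>S. (f has_derivative (\<lambda>h. D z \<bullet> h)) (at z)) \<and> continuous_on S D"

lemma grad_of_continuous:
  assumes "grad_of f D S"
  shows "continuous_on S f"
proof (intro continuous_at_imp_continuous_on ballI)
  fix z assume "z \<in> S"
  then have "(f has_derivative (\<lambda>h. D z \<bullet> h)) (at z)" using assms by (simp add: grad_of_def)
  then show "isCont f z" by (rule has_derivative_continuous)
qed

lemma grad_of_add: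
  assumes "grad_of f D S" "grad_of g E S"
  shows "grad_of (\<lambda>z. f z + g z) (\<lambda>z. D z + E z) S"
  unfolding grad_of_def
proof (intro conjI ballI)
  fix z assume "z \<in> S"
  then show "((\<lambda>z. f z + g z) has_derivative (\<lambda>h. (D z + E z) \<bullet> h)) (at z)"
    unfolding inner_add_left using assms by (intro has_derivative_add) (auto simp: grad_of_def)
qed (use assms in \<open>auto simp: grad_of_def intro: continuous_on_add\<close>)

lemma grad_of_diff:
  assumes "grad_of f D S" "grad_of g E S"
  shows "grad_of (\<lambda>z. f z - g z) (\<lambda>z. D z - E z) S"
  unfolding grad_of_def
proof (intro conjI ballI)
  fix z assume "z \<in> S"
  then show "((\<lambda>z. f z - g z) has_derivative (\<lambda>h. (D z - E z) \<bullet> h)) (at z)"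
    unfolding inner_diff_left using assms by (intro has_derivative_diff) (auto simp: grad_of_def)
qed (use assms in \<open>auto simp: grad_of_def intro: continuous_on_diff\<close>)

lemma grad_of_compose_real:
  assumes "grad_of f D S" and "\<And>s. (g has_real_derivative g' s) (at s)" and "continuous_on UNIV g'"
  shows "grad_of (\<lambda>z. g (f z)) (\<lambda>z. g' (f z) *\<^sub>R D z) S"
  unfolding grad_of_def
proof (intro conjI ballI)
  fix z assume "z \<in> S"
  then have "(f has_derivative (\<lambda>h. D z \<bullet> h)) (at z)" using assms(1) by (simp add: grad_of_def)
  from DERIV_compose_FDERIV[OF assms(2) this]
  show "((\<lambda>z. g (f z)) has_derivative (\<lambda>h. (g' (f z) *\<^sub>R D z) \<bullet> h)) (at z)"
    by (simp add: mult.commute)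
next
  have "continuous_on S f" using assms(1) by (rule grad_of_continuous)
  then have "continuous_on S (\<lambda>z. g' (f z))" by (intro continuous_on_compose2[OF assms(3)]) auto
  then show "continuous_on S (\<lambda>z. g' (f z) *\<^sub>R D z)"
    using assms(1) by (intro continuous_on_scaleR) (auto simp: grad_of_def)
qed

lemma grad_of_time: "grad_of (\<lambda>z :: 'a::real_inner \<times> real. c * snd z) (\<lambda>z. (0, c)) S"
  unfolding grad_of_def
  by (auto simp: inner_prod_def intro!: derivative_eq_intros continuous_intros)

lemma grad_of_cutoff:
  "grad_of (\<lambda>z :: 'a::real_inner \<times> real. k * pow32 (snd z - s))
     (\<lambda>z. (0, k * (3/2 * sqrt (max 0 (snd z - s))))) S"
  unfolding grad_of_def
  by (auto simp: inner_prod_def intro!: derivative_eq_intros continuous_intros)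

text \<open>Quadratic growth controls infinity. The factor exp (B * t) puts \<open>B\<close> times
  the weight into the time derivative, which absorbs transport terms bounded by that
  multiple.\<close>

definition weight :: "real \<Rightarrow> 'a::real_inner \<times> real \<Rightarrow> real" where
  "weight B z = (1 + fst z \<bullet> fst z) * exp (B * snd z)"

definition weight_grad :: "real \<Rightarrow> 'a::real_inner \<times> real \<Rightarrow> 'a \<times> real" where
  "weight_grad B z = ((2 * exp (B * snd z)) *\<^sub>R fst z, B * weight B z)"

lemma grad_of_weight: "grad_of (weight B) (weight_grad B) S"
  unfolding grad_of_def
proof (intro conjI ballI)
  fix z :: "'a \<times> real"
  have "((\<lambda>z. (1 + fst z \<bullet> fst z) * exp (B * snd z)) has_derivative
     (\<lambda>h. (1 + fst z \<bullet> fst z) * (B * snd h * exp (B * snd z)) + (fst z \<bullet> fst h + fst h \<bullet> fst z) * exp (B * snd z))) (at z)"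
    by (auto intro!: derivative_eq_intros)
  then show "(weight B has_derivative (\<lambda>h. weight_grad B z \<bullet> h)) (at z)"
    unfolding weight_def[abs_def]
    by (rule has_derivative_eq_rhs)
       (auto simp: fun_eq_iff weight_grad_def weight_def inner_prod_def inner_commute algebra_simps)
qed (simp add: weight_grad_def weight_def continuous_intros)

lemma weight_ge_one: "B \<ge> 0 \<Longrightarrow> snd z \<ge> 0 \<Longrightarrow> 1 + (norm (fst z))\<^sup>2 \<le> weight B z"
proof -
  assume "B \<ge> 0" "snd z \<ge> 0"
  then have "(1 + (norm (fst z))\<^sup>2) * 1 \<le> (1 + (norm (fst z))\<^sup>2) * exp (B * snd z)"
    by (intro mult_left_mono) auto
  then show ?thesis by (simp add: weight_def power2_norm_eq_inner)
qed

lemma weight_pos: "weight B z > 0"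
  unfolding weight_def by (intro mult_pos_pos add_pos_nonneg) auto

lemma two_norm_le: "2 * norm y \<le> 1 + y \<bullet> (y :: 'a::real_inner)"
  using zero_le_power2[of "norm y - 1"] by (simp add: power2_norm_eq_inner[symmetric] power2_diff)

text \<open>A viscosity test needs a full neighbourhood in time, so the top of the cylinder counts
  as boundary too. This is why the penalties contain a cutoff in time.\<close>

lemma cylinder_interior_max:
  fixes f :: "'a::euclidean_space \<times> real \<Rightarrow> real"
  assumes cont: "continuous_on (cball 0 r \<times> {0..T}) f"
    and z0: "z0 \<in> cball 0 r \<times> {0..T}" "f z0 > 0"
    and boundary: "\<And>y. y \<in> cball 0 r \<Longrightarrow> f (y, 0) \<le> 0" "\<And>y. y \<in> cball 0 r \<Longrightarrow> f (y, T) \<le> 0"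
      "\<And>y t. norm y = r \<Longrightarrow> t \<in> {0..T} \<Longrightarrow> f (y, t) \<le> 0"
  obtains y t where "norm y < r" "0 < t" "t < T" "\<forall>\<^sub>F z in nhds (y, t). f z \<le> f (y, t)"
proof -
  have "compact (cball (0::'a) r \<times> {0..T})" by (intro compact_Times compact_cball compact_Icc)
  then obtain z1 where z1: "z1 \<in> cball 0 r \<times> {0..T}" "\<And>z. z \<in> cball 0 r \<times> {0..T} \<Longrightarrow> f z \<le> f z1"
    using continuous_attains_sup[OF _ _ cont] z0 by blast
  obtain y t where yt: "z1 = (y, t)" by (cases z1)
  have pos: "f (y, t) > 0" using z1(2)[OF z0(1)] z0(2) yt by simp
  have in1: "norm y \<le> r" "0 \<le> t" "t \<le> T" using z1(1) yt by auto
  have ne: "norm y \<noteq> r" "t \<noteq> 0" "t \<noteq> T"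
    using boundary(1,2)[of y] boundary(3)[of y t] pos in1 by (force simp: not_le[symmetric])+
  show ?thesis
  proof (rule that)
    show "norm y < r" "0 < t" "t < T" using ne in1 by auto
    then have "(y, t) \<in> ball 0 r \<times> {0<..<T}" by simp
    moreover have "open (ball (0::'a) r \<times> {0<..<T})" by (intro open_Times open_ball open_greaterThanLessThan)
    ultimately have "\<forall>\<^sub>F z in nhds (y, t). z \<in> ball 0 r \<times> {0<..<T}" by (intro eventually_nhds_in_open)
    then show "\<forall>\<^sub>F z in nhds (y, t). f z \<le> f (y, t)"
      by eventually_elim (use z1(2) yt in auto)
  qed
qed

lemma cylinder_bound:
  fixes f :: "'a::euclidean_space \<times> real \<Rightarrow> real"
  assumes "continuous_on (cball 0 r \<times> {0..T}) f"
  obtains k where "k \<ge> 0" "\<And>z. z \<in> cball 0 r \<times> {0..T} \<Longrightarrow> \<bar>f z\<bar> \<le> k"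
proof -
  have "bounded (f ` (cball 0 r \<times> {0..T}))"
    by (intro compact_imp_bounded compact_continuous_image assms compact_Times compact_cball compact_Icc)
  then obtain k where "k > 0" "\<forall>v \<in> f ` (cball 0 r \<times> {0..T}). norm v \<le> k"
    unfolding bounded_pos by blast
  then show ?thesis by (intro that[of k]) auto
qed

context separable_hj
begin

text \<open>Functions of space and time are uncurried here, and test functions come with their full
  space-time gradient \<open>D\<close>.\<close>

definition hj_sub :: "('n spacetime \<Rightarrow> real) \<Rightarrow> bool" where
  "hj_sub W \<longleftrightarrow> (\<forall>\<psi> D y t. grad_of \<psi> D {z. snd z > 0} \<longrightarrow> t > 0 \<longrightarrow>
     (\<forall>\<^sub>F z in nhds (y, t). W z - \<psi> z \<le> W (y, t) - \<psi> (y, t)) \<longrightarrow>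
     snd (D (y, t)) + (norm (fst (D (y, t))))\<^sup>2 / 2 - sep_cost a b y \<le> 0)"

definition hj_super :: "('n spacetime \<Rightarrow> real) \<Rightarrow> bool" where
  "hj_super W \<longleftrightarrow> (\<forall>\<psi> D y t. grad_of \<psi> D {z. snd z > 0} \<longrightarrow> t > 0 \<longrightarrow>
     (\<forall>\<^sub>F z in nhds (y, t). W z - \<psi> z \<ge> W (y, t) - \<psi> (y, t)) \<longrightarrow>
     snd (D (y, t)) + (norm (fst (D (y, t))))\<^sup>2 / 2 - sep_cost a b y \<ge> 0)"

lemma grad_of_val:
  "grad_of (\<lambda>z. val (fst z) (snd z))
     (\<lambda>z. (val_grad (fst z) (snd z), sep_cost a b (fst z) - (norm (val_grad (fst z) (snd z)))\<^sup>2 / 2))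
     {z. snd z > 0}"
  unfolding grad_of_def
proof (intro conjI ballI)
  show "continuous_on {z. snd z > 0} (\<lambda>z. (val_grad (fst z) (snd z),
      sep_cost a b (fst z) - (norm (val_grad (fst z) (snd z)))\<^sup>2 / 2))"
    by (intro continuous_intros continuous_on_val_grad continuous_on_compose2[OF continuous_on_sep_cost[of UNIV]]) auto
qed (use val_has_derivative in auto)

lemma grad_of_sep_V:
  "grad_of (\<lambda>z. sep_V a b (fst z) (snd z) p)
     (\<lambda>z. (sep_grad a b (fst z) (snd z) p, sep_cost a b (fst z) - (norm (sep_grad a b (fst z) (snd z) p))\<^sup>2 / 2))
     {z. snd z > 0}"
  unfolding grad_of_def
proof (intro conjI ballI)
  have "continuous_on {z. snd z > 0} (\<lambda>z. (\<lambda>w. sep_grad a b (fst w) (fst (snd w)) (snd (snd w))) (fst z, snd z, p))"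
    by (rule continuous_on_compose2[OF continuous_on_sep_grad]) (auto intro!: continuous_intros)
  then show "continuous_on {z. snd z > 0} (\<lambda>z. (sep_grad a b (fst z) (snd z) p,
      sep_cost a b (fst z) - (norm (sep_grad a b (fst z) (snd z) p))\<^sup>2 / 2))"
    by (intro continuous_intros continuous_on_compose2[OF continuous_on_sep_cost[of UNIV]]) auto
qed (use sep_V_has_derivative in auto)

text \<open>Restriction to the line through y and x reduces this to the tangent inequality in one
  variable.\<close>

lemma val_grad_inequality:
  assumes "t > 0"
  shows "val y t + val_grad y t \<bullet> (x - y) \<le> val x t"
proof -
  define g where "g = (\<lambda>s. val (y + s *\<^sub>R (x - y)) t)"
  have "convex_on UNIV g"
  proof (intro convex_onI)
    fix l u v :: real assume l: "0 < l" "l < 1"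
    have "g ((1 - l) *\<^sub>R u + l *\<^sub>R v) = val ((1 - l) *\<^sub>R (y + u *\<^sub>R (x - y)) + l *\<^sub>R (y + v *\<^sub>R (x - y))) t"
      by (simp add: g_def algebra_simps)
    also have "\<dots> \<le> (1 - l) * g u + l * g v"
      using convex_onD[OF val_convex[of t], of l] l assms by (simp add: g_def)
    finally show "g ((1 - l) *\<^sub>R u + l *\<^sub>R v) \<le> (1 - l) * g u + l * g v" .
  qed simp
  moreover have "(g has_real_derivative val_grad y t \<bullet> (x - y)) (at 0)"
  proof -
    have "((\<lambda>s. (y + s *\<^sub>R (x - y), t)) has_derivative (\<lambda>s. (s *\<^sub>R (x - y), 0))) (at (0::real))"
      by (auto intro!: derivative_eq_intros)
    moreover have "((\<lambda>z. val (fst z) (snd z)) has_derivative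
      (\<lambda>h. (val_grad y t, sep_cost a b y - (norm (val_grad y t))\<^sup>2 / 2) \<bullet> h)) (at (y + 0 *\<^sub>R (x - y), t))"
      using val_has_derivative[OF assms] by simp
    ultimately have "((\<lambda>s. val (fst (y + s *\<^sub>R (x - y), t)) (snd (y + s *\<^sub>R (x - y), t))) has_derivative
       (\<lambda>s. (val_grad y t, sep_cost a b y - (norm (val_grad y t))\<^sup>2 / 2) \<bullet> (s *\<^sub>R (x - y), 0))) (at 0)"
      by (rule has_derivative_compose)
    then show ?thesis
      unfolding g_def by (intro has_derivative_imp_has_field_derivative) (auto simp: inner_prod_def)
  qed
  ultimately have "g 1 - g 0 \<ge> val_grad y t \<bullet> (x - y) * (1 - 0)"
    by (intro convex_on_imp_above_tangent[where A = UNIV]) auto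
  then show ?thesis by (simp add: g_def)
qed

text \<open>Convexity of \<open>val\<close> in space makes the backward characteristics contract, so the weight
  is a supersolution of the linearized equation.\<close>

lemma val_grad_radial_bound:
  assumes "T \<ge> 0"
  obtains B where "B \<ge> 0"
    "\<And>y t. 0 < t \<Longrightarrow> t \<le> T \<Longrightarrow> - B * (1 + y \<bullet> y) \<le> 2 * (val_grad y t \<bullet> y)"
proof -
  obtain p r where k: "(p, r) \<in> conj_epi \<Phi>" using conj_epi_nonempty by fast
  define c where "c = \<bar>r\<bar> + T * drift p T + \<bar>\<Phi> 0\<bar>"
  have "c \<ge> 0" using assms drift_nonneg by (auto simp: c_def)
  show ?thesis
  proof (rule that[of "norm p + 2 * c"])
    show "0 \<le> norm p + 2 * c" using \<open>c \<ge> 0\<close> by simp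
    fix y t assume t: "0 < t" "t \<le> T"
    \<comment> \<open>The tangent at y, evaluated at 0, bounds the radial component of the gradient
      below by \<open>val y t\<close> - \<open>val 0 t\<close>; an affine minorant bounds the first
      term from below, and \<Phi> 0 bounds the second from above.\<close>
    have "val y t - val_grad y t \<bullet> y \<le> val 0 t"
      using val_grad_inequality[OF t(1), of y 0] by simp
    moreover have "val 0 t \<le> \<Phi> 0" using val_upper_bound[of t 0] t by simp
    moreover have "p \<bullet> y - r - t * drift p t \<le> val y t" using val_lower_bound[OF _ k] t by simp
    moreover have "t * drift p t \<le> T * drift p T"
      using t drift_mono[of t T p] drift_nonneg[of p T] drift_nonneg[of p t] by (intro mult_mono) auto
    moreover have "- (norm p * norm y) \<le> p \<bullet> y"
      using Cauchy_Schwarz_ineq2[of p y] by simp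
    moreover have "norm p * (2 * norm y) \<le> norm p * (1 + y \<bullet> y)"
      using two_norm_le[of y] by (intro mult_left_mono) auto
    moreover have "c * 1 \<le> c * (1 + y \<bullet> y)" using \<open>c \<ge> 0\<close> by (intro mult_left_mono) auto
    ultimately show "- (norm p + 2 * c) * (1 + y \<bullet> y) \<le> 2 * (val_grad y t \<bullet> y)"
      unfolding c_def by (simp add: algebra_simps)
  qed
qed

lemma hj_sub_le_val:
  assumes cont: "continuous_on (UNIV \<times> {0..}) W" and sub: "hj_sub W"
    and init: "\<And>y. W (y, 0) \<le> \<Phi> y" and t0: "t0 \<ge> 0"
  shows "W (y0, t0) \<le> val y0 t0"
proof (rule ccontr)
  assume "\<not> ?thesis"
  then have gt: "W (y0, t0) > val y0 t0" by simp
  then have t0: "t0 > 0" using init[of y0] t0 val_zero[of y0] by (cases "t0 = 0") auto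
  define w where "w = (\<lambda>z. W z - val (fst z) (snd z))"
  have contw: "continuous_on (UNIV \<times> {0..}) w"
    unfolding w_def by (intro continuous_on_diff cont continuous_on_val)
  define T where "T = t0 + 1"
  obtain B where B: "B \<ge> 0"
    "\<And>y t. 0 < t \<Longrightarrow> t \<le> T \<Longrightarrow> - B * (1 + y \<bullet> y) \<le> 2 * (val_grad y t \<bullet> y)"
    using val_grad_radial_bound[of T] t0 by (auto simp: T_def)
  \<comment> \<open>With this threshold both cutoffs vanish at the base point, while on the sphere
    of radius \<open>r\<close> the weight is at least 1 + r^2 \<ge> R + 1.\<close>
  define R where "R = weight B (y0, t0)"
  define r where "r = R + norm y0 + 1"
  have R: "R \<ge> 1" using weight_ge_one[of B "(y0, t0)"] B t0 by (simp add: R_def) (smt (verit) zero_le_power2)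
  let ?K = "cball (0 :: real^'n) r \<times> {0..T}"
  have contK: "continuous_on ?K w" by (rule continuous_on_subset[OF contw]) auto
  obtain k where k: "k \<ge> 0" "\<And>z. z \<in> ?K \<Longrightarrow> \<bar>w z\<bar> \<le> k"
    using cylinder_bound[OF contK] by blast
  \<comment> \<open>Half of the excess pays for a positive slope in time; the other half keeps the
    difference positive at the base point.\<close>
  define \<eta> where "\<eta> = w (y0, t0) / (2 * t0)"
  have \<eta>: "\<eta> > 0" "w (y0, t0) - \<eta> * t0 > 0" using gt t0 by (auto simp: \<eta>_def w_def)
  define \<psi> where "\<psi> = (\<lambda>z :: 'n spacetime. \<eta> * snd z + k * pow32 (weight B z - R) + k * pow32 (snd z - t0))"
  define c where "c = (\<lambda>z :: 'n spacetime. k * (3/2 * sqrt (max 0 (weight B z - R))))"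
  define D\<psi> where "D\<psi> = (\<lambda>z :: 'n spacetime. (0, \<eta>) + c z *\<^sub>R weight_grad B z
      + (0, k * (3/2 * sqrt (max 0 (snd z - t0)))))"
  have grad\<psi>: "grad_of \<psi> D\<psi> S" for S
    unfolding \<psi>_def D\<psi>_def c_def
    by (intro grad_of_add grad_of_time grad_of_cutoff
          grad_of_compose_real[OF grad_of_weight, where g = "\<lambda>s. k * pow32 (s - R)" and g' = "\<lambda>s. k * (3/2 * sqrt (max 0 (s - R)))"])
       (auto intro!: derivative_eq_intros DERIV_chain2[OF DERIV_pow32] continuous_intros)
  have \<psi>_nonneg: "\<psi> z \<ge> 0" if "snd z \<ge> 0" for z
    using that \<eta> k by (auto simp: \<psi>_def pow32_def)
  have pow1: "pow32 s \<ge> 1" if "s \<ge> 1" for s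
  proof -
    have "1 * 1 \<le> s * sqrt s" using that by (intro mult_mono) auto
    then show ?thesis using that by (simp add: pow32_def)
  qed
  have cont\<psi>: "continuous_on ?K \<psi>" by (rule grad_of_continuous[OF grad\<psi>])
  obtain y t where yt: "norm y < r" "0 < t" "t < T"
    and max: "\<forall>\<^sub>F z in nhds (y, t). w z - \<psi> z \<le> w (y, t) - \<psi> (y, t)"
  proof (rule cylinder_interior_max[of r T "\<lambda>z. w z - \<psi> z" "(y0, t0)"])
    show "continuous_on ?K (\<lambda>z. w z - \<psi> z)" by (intro continuous_on_diff contK cont\<psi>)
    show "(y0, t0) \<in> ?K" using R t0 by (auto simp: r_def T_def)
    show "w (y0, t0) - \<psi> (y0, t0) > 0" using \<eta> by (simp add: \<psi>_def R_def pow32_def)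
    show "w (y, 0) - \<psi> (y, 0) \<le> 0" for y
      using init[of y] \<psi>_nonneg[of "(y, 0)"] by (simp add: w_def val_zero)
    show "w (y, T) - \<psi> (y, T) \<le> 0" if "y \<in> cball 0 r" for y
    proof -
      have "w (y, T) \<le> k" using k(2)[of "(y, T)"] that t0 by (simp add: T_def)
      moreover have "k * 1 \<le> k * pow32 (T - t0)" using k pow1 by (intro mult_left_mono) (auto simp: T_def)
      moreover have "0 \<le> \<eta> * T" "0 \<le> k * pow32 (weight B (y, T) - R)"
        using \<eta> t0 k by (auto simp: T_def pow32_def)
      ultimately show ?thesis unfolding \<psi>_def snd_conv by linarith
    qed
    show "w (y, t) - \<psi> (y, t) \<le> 0" if "norm y = r" "t \<in> {0..T}" for y t
    proof -
      have wk: "w (y, t) \<le> k" using k(2)[of "(y, t)"] that by simp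
      have "r * 1 \<le> r * r" using R by (intro mult_left_mono) (auto simp: r_def)
      moreover have "R + 1 \<le> r" by (simp add: r_def)
      ultimately have "R + 1 \<le> 1 + r * r" by linarith
      then have "1 \<le> weight B (y, t) - R"
        using weight_ge_one[of B "(y, t)"] B that by (simp add: power2_eq_square)
      then have "k * 1 \<le> k * pow32 (weight B (y, t) - R)" using k pow1 by (intro mult_left_mono) auto
      moreover have "0 \<le> \<eta> * t" "0 \<le> k * pow32 (t - t0)"
        using \<eta> that k by (auto simp: T_def pow32_def)
      ultimately show ?thesis using wk unfolding \<psi>_def snd_conv by linarith
    qed
  qed blast
  let ?g = "val_grad y t"
  have "\<forall>\<^sub>F z in nhds (y, t). W z - (val (fst z) (snd z) + \<psi> z)
      \<le> W (y, t) - (val (fst (y, t)) (snd (y, t)) + \<psi> (y, t))"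
    using max by eventually_elim (simp add: w_def)
  from sub[unfolded hj_sub_def, rule_format, OF grad_of_add[OF grad_of_val grad\<psi>] yt(2) this]
  have "(sep_cost a b y - (norm ?g)\<^sup>2 / 2 + snd (D\<psi> (y, t)))
      + (norm (?g + fst (D\<psi> (y, t))))\<^sup>2 / 2 - sep_cost a b y \<le> 0" by simp
  moreover have "(norm (?g + fst (D\<psi> (y, t))))\<^sup>2
     = (norm ?g)\<^sup>2 + 2 * (?g \<bullet> fst (D\<psi> (y, t))) + (norm (fst (D\<psi> (y, t))))\<^sup>2"
    by (simp add: power2_norm_eq_inner inner_add_left inner_add_right inner_commute)
  moreover have "(norm (fst (D\<psi> (y, t))))\<^sup>2 \<ge> 0" by simp
  ultimately have "snd (D\<psi> (y, t)) + ?g \<bullet> fst (D\<psi> (y, t)) \<le> 0" by argo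
  moreover have "snd (D\<psi> (y, t)) + ?g \<bullet> fst (D\<psi> (y, t)) =
     \<eta> + c (y, t) * exp (B * t) * (B * (1 + y \<bullet> y) + 2 * (?g \<bullet> y)) + k * (3/2 * sqrt (max 0 (t - t0)))"
    by (simp add: D\<psi>_def weight_grad_def weight_def algebra_simps)
  moreover have "c (y, t) * exp (B * t) * (B * (1 + y \<bullet> y) + 2 * (?g \<bullet> y)) \<ge> 0"
    using B(2)[of t y] yt k by (intro mult_nonneg_nonneg) (auto simp: c_def)
  moreover have "k * (3/2 * sqrt (max 0 (t - t0))) \<ge> 0" using k by simp
  ultimately show False using \<eta> by linarith
qed

text \<open>Here \<psi> is subtracted from the smooth function and the square of its gradient has
  the wrong sign. The time derivative must dominate it, which forces a small \<delta>; on the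
  lateral boundary the quadratic weight then has to beat the linear lower bound of w.\<close>

lemma hj_super_ge_sep_V:
  assumes cont: "continuous_on (UNIV \<times> {0..}) W" and super: "hj_super W"
    and init: "\<And>y. W (y, 0) \<ge> \<Phi> y" and t0: "t0 \<ge> 0"
    and lower: "\<And>T. T > 0 \<Longrightarrow> \<exists>C. \<forall>y. \<forall>t\<in>{0..T}. W (y, t) - \<alpha> \<bullet> y \<ge> C"
    and epi: "(p, r) \<in> conj_epi \<Phi>"
  shows "W (y0, t0) \<ge> sep_V a b y0 t0 p - r"
proof (rule ccontr)
  assume "\<not> ?thesis"
  then have lt: "W (y0, t0) < sep_V a b y0 t0 p - r" by simp
  have init': "W (y, 0) \<ge> sep_V a b y 0 p - r" for y
    using init[of y] conj_epiD[OF epi, of y] by (simp add: sep_V_zero)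
  then have t0: "t0 > 0" using lt t0 by (cases "t0 = 0") (auto simp: not_less[symmetric])
  define w where "w = (\<lambda>z. W z - sep_V a b (fst z) (snd z) p + r)"
  have "continuous_on (UNIV \<times> {0..}) (\<lambda>z. (\<lambda>w. sep_V a b (fst w) (fst (snd w)) (snd (snd w))) (fst z, snd z, p))"
    by (rule continuous_on_compose2[OF continuous_on_sep_V]) (auto intro!: continuous_intros)
  then have contw: "continuous_on (UNIV \<times> {0..}) w"
    unfolding w_def by (intro continuous_intros cont) simp
  define T where "T = t0 + 1"
  have T: "T > 0" using t0 by (simp add: T_def)
  obtain C0 where C0: "\<And>y t. t \<in> {0..T} \<Longrightarrow> W (y, t) - \<alpha> \<bullet> y \<ge> C0"
    using lower[OF T] by blast
  define A where "A = \<bar>C0\<bar> + norm \<alpha> + norm p + 2 * T * slope * CARD('n) + \<bar>r\<bar>"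
  have A: "A \<ge> 0" using T slope(2) by (auto simp: A_def)
  have wA: "w (y, t) \<ge> - A * (1 + norm y)" if t: "t \<in> {0..T}" for y t
  proof -
    have "2 * t * slope * l1 y \<le> 2 * T * slope * (CARD('n) * norm y)"
      using l1_le_norm[of y] t slope(2) T by (intro mult_mono mult_nonneg_nonneg sum_nonneg) auto
    moreover have "sep_V a b y t p \<le> p \<bullet> y + 2 * t * slope * l1 y"
      using sep_V_upper_bound_same t by simp
    moreover have "\<alpha> \<bullet> y \<ge> - (norm \<alpha> * norm y)" "p \<bullet> y \<le> norm p * norm y"
      using Cauchy_Schwarz_ineq2[of \<alpha> y] Cauchy_Schwarz_ineq2[of p y] by auto
    moreover have "0 \<le> norm \<alpha>" "0 \<le> norm p" "0 \<le> 2 * T * slope * CARD('n)"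
       "0 \<le> \<bar>C0\<bar> * norm y" "0 \<le> \<bar>r\<bar> * norm y" using T slope(2) by auto
    moreover have "A * (1 + norm y) = \<bar>C0\<bar> + norm \<alpha> + norm p + 2 * T * slope * CARD('n) + \<bar>r\<bar>
       + (\<bar>C0\<bar> * norm y + norm \<alpha> * norm y + norm p * norm y + 2 * T * slope * (CARD('n) * norm y) + \<bar>r\<bar> * norm y)"
      by (simp add: A_def algebra_simps)
    ultimately show ?thesis using C0[OF t, of y] unfolding w_def fst_conv snd_conv mult_minus_left by linarith
  qed
  define \<beta> where "\<beta> = l1 p + slope * T"
  have \<beta>0: "\<beta> \<ge> 0" using T slope(2) by (auto simp: \<beta>_def intro!: add_nonneg_nonneg sum_nonneg)
  have \<beta>: "norm (sep_grad a b y t p) \<le> \<beta>" if "0 \<le> t" "t \<le> T" for y t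
    using norm_sep_grad_le[OF that(1), of y p] mult_left_mono[OF that(2) slope(2)] by (simp add: \<beta>_def)
  \<comment> \<open>\<beta> absorbs the transport term, one unit the squared gradient, and the
    second unit leaves a strict inequality.\<close>
  define B where "B = \<beta> + 2"
  \<comment> \<open>The first bound keeps w + \<psi> negative at the base point. The second gives 2
    * \<delta> * exp (B * t) \<le> 1, by which the squared gradient is at most a multiple of
    \<open>E\<close> to the first power.\<close>
  define \<delta> where "\<delta> = min (- w (y0, t0) / (2 * weight B (y0, t0))) (1 / (2 * exp (B * T)))"
  have wneg: "w (y0, t0) < 0" using lt by (simp add: w_def)
  have wp: "weight B (y0, t0) > 0" by (rule weight_pos)
  have \<delta>: "\<delta> > 0" using wneg wp by (simp add: \<delta>_def divide_neg_pos)
  have \<delta>1: "\<delta> * weight B (y0, t0) < - w (y0, t0)"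
  proof -
    have "\<delta> * weight B (y0, t0) \<le> - w (y0, t0) / (2 * weight B (y0, t0)) * weight B (y0, t0)"
      using wp by (intro mult_right_mono) (auto simp: \<delta>_def)
    also have "\<dots> = - w (y0, t0) / 2" using wp by simp
    finally show ?thesis using wneg by simp
  qed
  have \<delta>2: "2 * (\<delta> * exp (B * t)) \<le> 1" if "t \<le> T" for t
  proof -
    have "\<delta> * exp (B * t) \<le> 1 / (2 * exp (B * T)) * exp (B * T)"
      using that \<delta> \<beta>0 by (intro mult_mono) (auto simp: \<delta>_def B_def)
    then show ?thesis by simp
  qed
  \<comment> \<open>Ensures \<delta> * \<rho> \<ge> 2 * A, so that \<delta> * \<rho>^2 exceeds A *
    (1 + \<rho>).\<close>
  define \<rho> where "\<rho> = 1 + 2 * A / \<delta> + norm y0"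
  have \<rho>: "\<rho> \<ge> 1" "\<rho> \<ge> norm y0" using A \<delta> by (auto simp: \<rho>_def)
  have \<rho>2: "A * (1 + \<rho>) \<le> \<delta> * (1 + \<rho>\<^sup>2)"
  proof -
    have "2 * A \<le> \<delta> * \<rho>" using \<delta> by (simp add: \<rho>_def distrib_left)
    then have "2 * A * \<rho> \<le> \<delta> * \<rho> * \<rho>" using \<rho> by (intro mult_right_mono) auto
    moreover have "A * 1 \<le> A * \<rho>" using A \<rho> by (intro mult_left_mono) auto
    ultimately show ?thesis using \<delta> by (simp add: power2_eq_square algebra_simps)
  qed
  let ?K = "cball (0 :: real^'n) \<rho> \<times> {0..T}"
  have contK: "continuous_on ?K w" by (rule continuous_on_subset[OF contw]) auto
  obtain k where k: "k \<ge> 0" "\<And>z. z \<in> ?K \<Longrightarrow> \<bar>w z\<bar> \<le> k"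
    using cylinder_bound[OF contK] by blast
  define \<psi> where "\<psi> = (\<lambda>z :: 'n spacetime. \<delta> * weight B z + k * pow32 (snd z - t0))"
  define D\<psi> where "D\<psi> = (\<lambda>z :: 'n spacetime. \<delta> *\<^sub>R weight_grad B z
      + (0, k * (3/2 * sqrt (max 0 (snd z - t0)))))"
  have grad\<psi>: "grad_of \<psi> D\<psi> S" for S
    unfolding \<psi>_def D\<psi>_def
    by (intro grad_of_add grad_of_cutoff
          grad_of_compose_real[OF grad_of_weight, where g = "\<lambda>s. \<delta> * s" and g' = "\<lambda>s. \<delta>"])
       (auto intro!: derivative_eq_intros continuous_intros)
  have cont\<psi>: "continuous_on ?K \<psi>" by (rule grad_of_continuous[OF grad\<psi>])
  have B0: "B \<ge> 0" using \<beta>0 by (simp add: B_def)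
  obtain y t where yt: "norm y < \<rho>" "0 < t" "t < T"
    and max: "\<forall>\<^sub>F z in nhds (y, t). - (w z + \<psi> z) \<le> - (w (y, t) + \<psi> (y, t))"
  proof (rule cylinder_interior_max[of \<rho> T "\<lambda>z. - (w z + \<psi> z)" "(y0, t0)"])
    show "continuous_on ?K (\<lambda>z. - (w z + \<psi> z))" by (intro continuous_intros contK cont\<psi>)
    show "(y0, t0) \<in> ?K" using \<rho> t0 by (auto simp: T_def)
    show "- (w (y0, t0) + \<psi> (y0, t0)) > 0" using \<delta>1 by (simp add: \<psi>_def pow32_def)
    show "- (w (y, 0) + \<psi> (y, 0)) \<le> 0" for y
    proof -
      have "0 \<le> \<delta> * weight B (y, 0)" using \<delta> weight_pos[of B "(y, 0)"] by simp
      then show ?thesis using init'[of y] t0 by (simp add: w_def \<psi>_def pow32_nonpos)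
    qed
    show "- (w (y, T) + \<psi> (y, T)) \<le> 0" if "y \<in> cball 0 \<rho>" for y
    proof -
      have "- k \<le> w (y, T)" using k(2)[of "(y, T)"] that T by simp
      moreover have "pow32 (T - t0) = 1" by (simp add: T_def pow32_def)
      moreover have "0 \<le> \<delta> * weight B (y, T)" using \<delta> weight_pos[of B "(y, T)"] by simp
      ultimately show ?thesis by (simp add: \<psi>_def)
    qed
    show "- (w (y, t) + \<psi> (y, t)) \<le> 0" if "norm y = \<rho>" "t \<in> {0..T}" for y t
    proof -
      have "1 + \<rho>\<^sup>2 \<le> weight B (y, t)" using weight_ge_one[of B "(y, t)"] B0 that by simp
      then have "\<delta> * (1 + \<rho>\<^sup>2) \<le> \<delta> * weight B (y, t)" using \<delta> by simp
      moreover have "- A * (1 + \<rho>) \<le> w (y, t)" using wA[of t y] that by simp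
      moreover have "0 \<le> k * pow32 (t - t0)" using k by (auto simp: pow32_def)
      ultimately show ?thesis using \<rho>2 unfolding \<psi>_def snd_conv mult_minus_left by linarith
    qed
  qed blast
  let ?g = "sep_grad a b y t p"
  have "\<forall>\<^sub>F z in nhds (y, t). W z - (sep_V a b (fst z) (snd z) p - \<psi> z)
      \<ge> W (y, t) - (sep_V a b (fst (y, t)) (snd (y, t)) p - \<psi> (y, t))"
    using max by eventually_elim (simp add: w_def)
  from super[unfolded hj_super_def, rule_format, OF grad_of_diff[OF grad_of_sep_V grad\<psi>] yt(2) this]
  have "(sep_cost a b y - (norm ?g)\<^sup>2 / 2 - snd (D\<psi> (y, t)))
      + (norm (?g - fst (D\<psi> (y, t))))\<^sup>2 / 2 - sep_cost a b y \<ge> 0" by simp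
  moreover have "(norm (?g - fst (D\<psi> (y, t))))\<^sup>2
     = (norm ?g)\<^sup>2 - 2 * (?g \<bullet> fst (D\<psi> (y, t))) + (norm (fst (D\<psi> (y, t))))\<^sup>2"
    by (simp add: power2_norm_eq_inner inner_diff_left inner_diff_right inner_commute)
  ultimately have 1: "snd (D\<psi> (y, t)) + ?g \<bullet> fst (D\<psi> (y, t)) \<le> (norm (fst (D\<psi> (y, t))))\<^sup>2 / 2"
    by argo
  define E where "E = \<delta> * exp (B * t)"
  have E: "E > 0" "2 * E \<le> 1" using \<delta> \<delta>2[of t] yt by (auto simp: E_def)
  have fstD: "fst (D\<psi> (y, t)) = (2 * E) *\<^sub>R y"
    and sndD: "snd (D\<psi> (y, t)) = B * E * (1 + y \<bullet> y) + k * (3/2 * sqrt (max 0 (t - t0)))"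
    by (simp_all add: D\<psi>_def weight_grad_def weight_def E_def)
  have "k * (3/2 * sqrt (max 0 (t - t0))) \<ge> 0" using k by simp
  moreover have "(norm (fst (D\<psi> (y, t))))\<^sup>2 / 2 = E * (2 * E * (y \<bullet> y))"
    unfolding fstD power2_norm_eq_inner inner_scaleR_left inner_scaleR_right by simp
  moreover have "2 * E * (y \<bullet> y) \<le> 1 * (y \<bullet> y)" using E by (intro mult_right_mono) auto
  then have "E * (2 * E * (y \<bullet> y)) \<le> E * (1 + y \<bullet> y)" using E by (intro mult_left_mono) auto
  moreover have "?g \<bullet> fst (D\<psi> (y, t)) \<ge> - (E * (\<beta> * (1 + y \<bullet> y)))"
  proof -
    have "\<bar>?g \<bullet> y\<bar> \<le> \<beta> * norm y"
      using Cauchy_Schwarz_ineq2[of ?g y] mult_right_mono[OF \<beta>[of t y], of "norm y"] yt by simp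
    then have "- (\<beta> * norm y) \<le> ?g \<bullet> y" by simp
    moreover have "\<beta> * (2 * norm y) \<le> \<beta> * (1 + y \<bullet> y)"
      using two_norm_le[of y] \<beta>0 by (intro mult_left_mono) auto
    ultimately have "- (\<beta> * (1 + y \<bullet> y)) \<le> 2 * (?g \<bullet> y)" by linarith
    then have "E * (- (\<beta> * (1 + y \<bullet> y))) \<le> E * (2 * (?g \<bullet> y))" using E by (intro mult_left_mono) auto
    then show ?thesis by (simp add: fstD)
  qed
  moreover have "E * (1 + y \<bullet> y) > 0" using E by (intro mult_pos_pos add_pos_nonneg) auto
  moreover have "B * E * (1 + y \<bullet> y) = E * (\<beta> * (1 + y \<bullet> y)) + 2 * (E * (1 + y \<bullet> y))"
    by (simp add: B_def algebra_simps)
  ultimately show False using 1 sndD by linarith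
qed

lemma hj_super_ge_val:
  assumes "continuous_on (UNIV \<times> {0..}) W" and "hj_super W"
    and "\<And>y. W (y, 0) \<ge> \<Phi> y" and "t \<ge> 0"
    and "\<And>T. T > 0 \<Longrightarrow> \<exists>C. \<forall>y. \<forall>t\<in>{0..T}. W (y, t) - \<alpha> \<bullet> y \<ge> C"
  shows "val y t \<le> W (y, t)"
  unfolding val_def
proof (rule cSUP_least[OF conj_epi_nonempty])
  fix k assume k: "k \<in> conj_epi \<Phi>"
  have "sep_V a b y t (fst k) - snd k \<le> W (y, t)"
    using k by (intro hj_super_ge_sep_V[OF assms]) auto
  then show "payoff (y, t) k \<le> W (y, t)" by (simp add: payoff_def)
qed

end


section \<open>Change of coordinates\<close>

lemma matrix_inv_left_right:
  fixes P :: "'a::semiring_1^'n^'n"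
  assumes "invertible P"
  shows "matrix_inv P ** P = mat 1" "P ** matrix_inv P = mat 1"
  using someI_ex[OF assms[unfolded invertible_def]] by (auto simp: matrix_inv_def)

definition coord :: "real^'n^'n \<Rightarrow> real^'n \<Rightarrow> real^'n \<Rightarrow> real^'n" where
  "coord P u0 x = matrix_inv P *v x - matrix_inv P *v u0"

lemma coord_inverse:
  assumes "invertible P"
  shows "coord P u0 (P *v y + u0) = y" "P *v coord P u0 x + u0 = x"
  by (simp_all add: coord_def matrix_vector_right_distrib matrix_vector_mult_diff_distrib
      matrix_vector_mul_assoc matrix_inv_left_right(1)[OF assms] matrix_inv_left_right(2)[OF assms])

lemma continuous_on_coord: "continuous_on S f \<Longrightarrow> continuous_on S (\<lambda>z. coord P u0 (f z))"
  unfolding coord_def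
  by (intro continuous_on_diff continuous_on_const bounded_linear.continuous_on[OF matrix_vector_mul_bounded_linear])

lemma coord_has_derivative:
  "((\<lambda>z. (coord P u0 (fst z), snd z)) has_derivative (\<lambda>h. (matrix_inv P *v fst h, snd h))) (at z)"
proof -
  have "((\<lambda>z. matrix_inv P *v fst z) has_derivative (\<lambda>h. matrix_inv P *v fst h)) (at z)"
    by (intro bounded_linear_imp_has_derivative
        bounded_linear_compose[OF matrix_vector_mul_bounded_linear bounded_linear_fst])
  from has_derivative_Pair[OF has_derivative_diff[OF this has_derivative_const]
      bounded_linear_imp_has_derivative[OF bounded_linear_snd]]
  show ?thesis unfolding coord_def by simp
qed

text \<open>By homogeneity - U is the gauge of the hull. One inequality writes P y, divided by its
  cost, as a convex combination of vertices; the other encloses the hull in a half-space whose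
  boundary contains that point.\<close>

lemma one_homogeneous_gauge:
  fixes P :: "real^'n^'n" and U :: "real^'n \<Rightarrow> real"
  assumes nonpos: "\<And>x. U x \<le> 0" and hom: "one_homogeneous (\<lambda>x. U (x + u0))"
    and P: "invertible P" and a: "\<And>j. a j > 0" and b: "\<And>j. b j > 0"
    and hull: "{x. U (x + u0) \<ge> - 1} =
         convex hull (\<Union>j. {(1 / a j) *\<^sub>R column j P, - ((1 / b j) *\<^sub>R column j P)})"
  shows "U (P *v y + u0) = - sep_cost a b y"
proof (rule antisym)
  have hom': "U (c *\<^sub>R x + u0) = c * U (x + u0)" if "c \<ge> 0" for c x
    using hom that by (simp add: one_homogeneous_def)
  have max0: "max (a j * s) (- b j * s) \<ge> 0" for j s
    using a[of j] b[of j] by (cases "s \<ge> 0") (auto simp: le_max_iff_disj mult_nonneg_nonpos)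
  have cost0: "sep_cost a b y \<ge> 0" unfolding sep_cost_def by (intro sum_nonneg max0)
  have col: "P *v y = (\<Sum>j\<in>UNIV. y $ j *\<^sub>R column j P)"
    by (simp add: matrix_mult_sum scalar_mult_eq_scaleR)
  show "- sep_cost a b y \<le> U (P *v y + u0)"
  proof (cases "sep_cost a b y = 0")
    case True
    have "max (a j * y $ j) (- b j * y $ j) = 0" for j
      using True max0 unfolding sep_cost_def by (subst (asm) sum_nonneg_eq_0_iff) auto
    then have "y $ j = 0" for j
      using a[of j] b[of j] by (smt (verit) mult_pos_pos mult_pos_neg mult_minus_left)
    then have "y = 0" by (simp add: vec_eq_iff)
    moreover have "U (0 *\<^sub>R 0 + u0) = 0" by (subst hom') simp_all
    ultimately show ?thesis using True by simp
  next
    case False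
    define h where "h = sep_cost a b y"
    have h: "h > 0" using False cost0 by (simp add: h_def)
    \<comment> \<open>Each coordinate enters with its share of the total cost, at the vertex on the
      side given by its sign.\<close>
    define c where "c = (\<lambda>j. max (a j * y $ j) (- b j * y $ j) / h)"
    define w where "w = (\<lambda>j. if y $ j \<ge> 0 then (1 / a j) *\<^sub>R column j P else - ((1 / b j) *\<^sub>R column j P))"
    let ?K = "convex hull (\<Union>j. {(1 / a j) *\<^sub>R column j P, - ((1 / b j) *\<^sub>R column j P)})"
    have "(\<Sum>j\<in>UNIV. c j *\<^sub>R w j) \<in> ?K"
    proof (rule convex_sum)
      show "(\<Sum>j\<in>UNIV. c j) = 1"
        using h by (simp add: c_def h_def sep_cost_def sum_divide_distrib[symmetric])
      show "c j \<ge> 0" for j using max0 h by (simp add: c_def)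
      show "w j \<in> ?K" for j by (intro hull_inc) (auto simp: w_def)
    qed (auto simp: convex_convex_hull)
    moreover have "c j *\<^sub>R w j = (1 / h) *\<^sub>R (y $ j *\<^sub>R column j P)" for j
    proof (cases "y $ j \<ge> 0")
      case True
      then show ?thesis using a[of j] by (simp add: c_def w_def max_slopes(1)[OF a b, simplified])
    next
      case F: False
      then show ?thesis using b[of j] by (simp add: c_def w_def max_slopes(2)[OF a b, simplified])
    qed
    ultimately have "(1 / h) *\<^sub>R (P *v y) \<in> ?K"
      unfolding col by (simp add: scaleR_sum_right)
    then have "- 1 \<le> U ((1 / h) *\<^sub>R (P *v y) + u0)" using hull by blast
    also have "\<dots> = U (P *v y + u0) / h" using h by (subst hom') auto
    finally show ?thesis using h by (simp add: h_def pos_le_divide_eq)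
  qed
  show "U (P *v y + u0) \<le> - sep_cost a b y"
  proof (rule ccontr)
    assume "\<not> ?thesis"
    then have gt: "U (P *v y + u0) > - sep_cost a b y" by simp
    \<comment> \<open>A level strictly between - U and the cost; it is positive even if U vanishes
      at the point, so division by it is possible.\<close>
    define l where "l = (sep_cost a b y - U (P *v y + u0)) / 2"
    have l: "l > 0" "- U (P *v y + u0) \<le> l" "l < sep_cost a b y"
      using gt nonpos[of "P *v y + u0"] by (auto simp: l_def)
    \<comment> \<open>The slopes active at y: \<sigma> attains the cost there and pairs with every
      vertex to at most 1.\<close>
    define \<sigma> :: "real^'n" where "\<sigma> = (\<chi> j. if y $ j \<ge> 0 then a j else - b j)"
    define L where "L = {x. (transpose (matrix_inv P) *v \<sigma>) \<bullet> x \<le> 1}"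
    have inner: "(transpose (matrix_inv P) *v \<sigma>) \<bullet> (P *v z) = \<sigma> \<bullet> z" for z
      by (simp add: dot_lmul_matrix matrix_vector_mul_assoc matrix_inv_left_right(1)[OF P])
    have \<sigma>y: "\<sigma> \<bullet> y = sep_cost a b y"
      unfolding inner_vec_def sep_cost_def
      using max_slopes[OF a b, simplified] by (intro sum.cong) (auto simp: \<sigma>_def)
    have "(transpose (matrix_inv P) *v \<sigma>) \<bullet> column j P = \<sigma> $ j" for j
      using inner[of "axis j 1"] by (simp only: matrix_vector_mult_basis inner_axis inner_real_def mult_1_right)
    moreover have "\<sigma> $ j \<le> a j" "- \<sigma> $ j \<le> b j" for j
      using a[of j] b[of j] by (auto simp: \<sigma>_def intro: order_trans[of _ 0])
    ultimately have "(\<Union>j. {(1 / a j) *\<^sub>R column j P, - ((1 / b j) *\<^sub>R column j P)}) \<subseteq> L"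
      using a b by (auto simp only: L_def UN_subset_iff inner_scaleR_right inner_minus_right insert_subset
          mem_Collect_eq empty_subsetI pos_divide_le_eq minus_divide_left times_divide_eq_left mult_1)
    moreover have "convex L" unfolding L_def by (rule convex_halfspace_le)
    ultimately have KL: "{x. U (x + u0) \<ge> - 1} \<subseteq> L" unfolding hull by (intro hull_minimal)
    have "U ((1 / l) *\<^sub>R (P *v y) + u0) = U (P *v y + u0) / l" using l by (subst hom') auto
    also have "\<dots> \<ge> - 1" using l by (simp add: pos_le_divide_eq)
    finally have "(1 / l) *\<^sub>R (P *v y) \<in> L" using KL by blast
    then have "sep_cost a b y / l \<le> 1" by (simp add: L_def inner \<sigma>y del: transpose_matrix_vector)
    then show False using l by (simp add: pos_divide_le_eq)
  qed
qed

text \<open>Evaluates \<open>deriv\<close> and the description operator in \<open>gradient\<close>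
  from one space-time derivative. The sign condition undoes the square root in
  \<open>norm_wrt\<close>.\<close>

lemma hj_operator_eq:
  fixes \<phi> :: "real^'n \<Rightarrow> real \<Rightarrow> real"
  assumes D: "((\<lambda>z. \<phi> (fst z) (snd z)) has_derivative (\<lambda>h. G \<bullet> h)) (at (x, t))"
    and pos: "fst G \<bullet> (M *v fst G) \<ge> 0"
  shows "hj_operator M U \<phi> x t = snd G + fst G \<bullet> (M *v fst G) / 2 + U x"
proof -
  have "((\<lambda>s. (x, s)) has_derivative (\<lambda>s. (0, s))) (at t)"
    by (auto intro!: derivative_eq_intros)
  from has_derivative_compose[OF this D, unfolded fst_conv snd_conv]
  have "((\<lambda>s. \<phi> x s) has_real_derivative snd G) (at t)"
    by (rule has_derivative_imp_has_field_derivative) (simp add: inner_prod_def)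
  then have 1: "deriv (\<lambda>s. \<phi> x s) t = snd G" by (rule DERIV_imp_deriv)
  have "((\<lambda>y. (y, t)) has_derivative (\<lambda>y. (y, 0))) (at x)"
    by (auto intro!: derivative_eq_intros)
  from has_derivative_compose[OF this D]
  have d: "((\<lambda>y. \<phi> y t) has_derivative (\<lambda>h. fst G \<bullet> h)) (at x)"
    by (simp add: inner_prod_def)
  have "gradient (\<lambda>y. \<phi> y t) x = fst G"
    unfolding gradient_def
  proof (rule the_equality)
    show "GDERIV (\<lambda>y. \<phi> y t) x :> fst G" using d by (simp add: gderiv_def inner_commute)
    fix g assume "GDERIV (\<lambda>y. \<phi> y t) x :> g"
    then have "((\<lambda>y. \<phi> y t) has_derivative (\<lambda>h. g \<bullet> h)) (at x)" by (simp add: gderiv_def inner_commute)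
    from has_derivative_unique[OF this d] have "g \<bullet> h = fst G \<bullet> h" for h by meson
    then show "g = fst G" by (metis vector_eq_rdot)
  qed
  then show ?thesis
    unfolding hj_operator_def 1 norm_wrt_def using pos by simp
qed

lemma continuously_differentiable_on_grad_of:
  assumes "grad_of f D S"
  shows "continuously_differentiable_on S f"
  unfolding continuously_differentiable_on_def
proof (intro exI[of _ "\<lambda>z. blinfun_inner_right (D z)"] conjI ballI)
  show "continuous_on S (\<lambda>z. blinfun_inner_right (D z))"
    using assms by (intro bounded_linear.continuous_on[OF bounded_linear_blinfun_inner_right]) (simp add: grad_of_def)
qed (use assms in \<open>simp add: grad_of_def\<close>)

definition pullback_grad :: "real^'n^'n \<Rightarrow> real^'n \<Rightarrow> ('n spacetime \<Rightarrow> 'n spacetime) \<Rightarrow> 'n spacetime \<Rightarrow> 'n spacetime" where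
  "pullback_grad P u0 D z = (transpose (matrix_inv P) *v fst (D (coord P u0 (fst z), snd z)), snd (D (coord P u0 (fst z), snd z)))"

lemma grad_of_pullback:
  fixes P :: "real^'n^'n"
  assumes "grad_of \<psi> D {z. snd z > 0}"
  shows "grad_of (\<lambda>z. \<psi> (coord P u0 (fst z), snd z)) (pullback_grad P u0 D) (UNIV \<times> {0<..})"
  unfolding grad_of_def
proof (intro conjI ballI)
  fix z :: "'n spacetime" assume z: "z \<in> UNIV \<times> {0<..}"
  then have "(\<psi> has_derivative (\<lambda>h. D (coord P u0 (fst z), snd z) \<bullet> h)) (at (coord P u0 (fst z), snd z))"
    using assms by (auto simp: grad_of_def)
  from has_derivative_compose[OF coord_has_derivative this]
  have "((\<lambda>z. \<psi> (coord P u0 (fst z), snd z)) has_derivative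
     (\<lambda>h. D (coord P u0 (fst z), snd z) \<bullet> (matrix_inv P *v fst h, snd h))) (at z)" .
  moreover have "p \<bullet> (matrix_inv P *v h) = (transpose (matrix_inv P) *v p) \<bullet> h" for p h
    by (simp add: dot_lmul_matrix[symmetric])
  ultimately show "((\<lambda>z. \<psi> (coord P u0 (fst z), snd z)) has_derivative (\<lambda>h. pullback_grad P u0 D z \<bullet> h)) (at z)"
    by (simp add: inner_prod_def pullback_grad_def)
next
  have "continuous_on (UNIV \<times> {0<..}) (\<lambda>z :: 'n spacetime. D (coord P u0 (fst z), snd z))"
  proof (rule continuous_on_compose2[where g = D and f = "\<lambda>z. (coord P u0 (fst z), snd z)" and t = "{z. snd z > 0}"])
    show "continuous_on {z. snd z > 0} D" using assms by (simp add: grad_of_def)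
    show "continuous_on (UNIV \<times> {0<..}) (\<lambda>z :: 'n spacetime. (coord P u0 (fst z), snd z))"
      by (intro continuous_on_Pair continuous_on_coord continuous_on_fst continuous_on_snd continuous_on_id)
  qed auto
  then show "continuous_on (UNIV \<times> {0<..}) (pullback_grad P u0 D)"
    unfolding pullback_grad_def
    by (intro continuous_on_Pair bounded_linear.continuous_on[OF matrix_vector_mul_bounded_linear]
        continuous_on_snd continuous_on_fst)
qed

text \<open>The reason for M = P P^T: gradients transform by the inverse transpose, so the M-norm of
  a pulled-back gradient is the Euclidean norm of the original one.\<close>

lemma pullback_quadratic:
  fixes P :: "real^'n^'n"
  assumes "invertible P"
  shows "(transpose (matrix_inv P) *v g) \<bullet> ((P ** transpose P) *v (transpose (matrix_inv P) *v g)) = (norm g)\<^sup>2"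
proof -
  have "transpose P *v (transpose (matrix_inv P) *v g) = g"
    unfolding matrix_vector_mul_assoc matrix_transpose_mul[symmetric] matrix_inv_left_right(1)[OF assms]
    by (simp add: transpose_mat)
  then have "(P ** transpose P) *v (transpose (matrix_inv P) *v g) = P *v g"
    by (metis matrix_vector_mul_assoc)
  moreover have "(transpose (matrix_inv P) *v g) \<bullet> (P *v g) = g \<bullet> (matrix_inv P *v (P *v g))"
    by (simp add: dot_lmul_matrix[symmetric])
  ultimately show ?thesis
    by (simp add: matrix_vector_mul_assoc matrix_inv_left_right(1)[OF assms] power2_norm_eq_inner)
qed

lemma hj_operator_pullback:
  fixes P :: "real^'n^'n"
  assumes P: "invertible P" and D: "grad_of \<psi> D {z. snd z > 0}" and t: "t > 0"
  shows "hj_operator (P ** transpose P) U (\<lambda>x t. \<psi> (coord P u0 x, t)) x t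
    = snd (D (coord P u0 x, t)) + (norm (fst (D (coord P u0 x, t))))\<^sup>2 / 2 + U x"
proof -
  have "((\<lambda>z. \<psi> (coord P u0 (fst z), snd z)) has_derivative (\<lambda>h. pullback_grad P u0 D (x, t) \<bullet> h)) (at (x, t))"
    using grad_of_pullback[OF D, of P u0] t by (simp add: grad_of_def)
  moreover have "fst (pullback_grad P u0 D (x, t)) \<bullet> ((P ** transpose P) *v fst (pullback_grad P u0 D (x, t)))
     = (norm (fst (D (coord P u0 x, t))))\<^sup>2"
    unfolding pullback_grad_def fst_conv snd_conv by (rule pullback_quadratic[OF P])
  moreover have "snd (pullback_grad P u0 D (x, t)) = snd (D (coord P u0 x, t))"
    by (simp add: pullback_grad_def)
  ultimately show ?thesis by (subst hj_operator_eq) auto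
qed


section \<open>Viscosity solutions and uniqueness\<close>

text \<open>By convexity a violation at y propagates proportionally along the segment to x, so the
  difference quotient is at most the fixed negative number - e arbitrarily close to x.\<close>

lemma frechet_subdifferential_convex:
  assumes conv: "convex_on UNIV f" and q: "q \<in> frechet_subdifferential f x"
  shows "f x + q \<bullet> (y - x) \<le> f y"
proof (rule ccontr)
  assume neg: "\<not> ?thesis"
  define X where "X = f y - f x - q \<bullet> (y - x)"
  have lt: "X < 0" using neg by (simp add: X_def)
  then have ne: "y \<noteq> x" by (auto simp: X_def)
  define e where "e = - X / norm (y - x)"
  have e: "e > 0" using lt ne by (simp add: e_def divide_neg_pos)
  have "ereal (- e) < Liminf (at x) (\<lambda>y. ereal ((f y - f x - q \<bullet> (y - x)) / norm (y - x)))"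
    using q e unfolding frechet_subdifferential_def by (auto intro: less_le_trans[of _ 0])
  then have "\<forall>\<^sub>F z in at x. ereal (- e) < ereal ((f z - f x - q \<bullet> (z - x)) / norm (z - x))"
    by (rule less_LiminfD)
  then obtain d where d: "d > 0"
    "\<And>z. z \<noteq> x \<Longrightarrow> dist z x < d \<Longrightarrow> - e < (f z - f x - q \<bullet> (z - x)) / norm (z - x)"
    by (auto simp: eventually_at)
  define s where "s = min 1 (d / (2 * norm (y - x)))"
  have s: "0 < s" "s \<le> 1" "s * norm (y - x) < d"
  proof -
    show "0 < s" "s \<le> 1" using d ne by (auto simp: s_def)
    have "s * norm (y - x) \<le> d / (2 * norm (y - x)) * norm (y - x)"
      by (intro mult_right_mono) (auto simp: s_def)
    then show "s * norm (y - x) < d" using d ne by simp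
  qed
  define z where "z = x + s *\<^sub>R (y - x)"
  have "z = (1 - s) *\<^sub>R x + s *\<^sub>R y" by (simp add: z_def algebra_simps)
  then have "f z \<le> (1 - s) * f x + s * f y"
    using convex_onD[OF conv, of s x y] s by simp
  then have "f z - f x - q \<bullet> (z - x) \<le> s * X"
    by (simp add: z_def X_def algebra_simps)
  then have "(f z - f x - q \<bullet> (z - x)) / norm (z - x) \<le> s * X / norm (z - x)"
    by (intro divide_right_mono) auto
  also have "\<dots> = - e" using s ne by (simp add: z_def e_def)
  finally show False using d(2)[of z] s ne by (simp add: z_def dist_norm)
qed

lemma ereal_cSUP_least:
  assumes "A \<noteq> {}" "\<And>x. x \<in> A \<Longrightarrow> ereal (f x) \<le> v"
  shows "ereal (SUP x\<in>A. f x) \<le> v"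
proof (cases v)
  case (real r)
  then show ?thesis using assms by (auto intro: cSUP_least)
next
  case MInf
  then show ?thesis using assms by auto
qed simp

context separable_hj
begin

text \<open>A slope with infinite conjugate contributes minus infinity to the supremum, and a finite
  conjugate is the best admissible r. The conjugate is never minus infinity, as testing at 0
  shows.\<close>

lemma SUP_legendre_eq_val:
  assumes "t \<ge> 0"
  shows "(SUP p. ereal (sep_V a b y t p) - legendre \<Phi> p) = ereal (val y t)"
proof (rule antisym)
  show "(SUP p. ereal (sep_V a b y t p) - legendre \<Phi> p) \<le> ereal (val y t)"
  proof (rule SUP_least)
    fix p
    have ge: "ereal (p \<bullet> x - \<Phi> x) \<le> legendre \<Phi> p" for x
      unfolding legendre_def by (rule SUP_upper) simp
    show "ereal (sep_V a b y t p) - legendre \<Phi> p \<le> ereal (val y t)"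
    proof (cases "legendre \<Phi> p")
      case (real r)
      then have "(p, r) \<in> conj_epi \<Phi>" using ge by (auto simp: conj_epi_def)
      then show ?thesis using payoff_le_val[OF assms, of "(p, r)" y] real by (simp add: payoff_def)
    next
      case MInf
      then show ?thesis using ge[of 0] by simp
    qed simp
  qed
  show "ereal (val y t) \<le> (SUP p. ereal (sep_V a b y t p) - legendre \<Phi> p)"
    unfolding val_def
  proof (rule ereal_cSUP_least)
    fix k assume k: "k \<in> conj_epi \<Phi>"
    have "legendre \<Phi> (fst k) \<le> ereal (snd k)"
      unfolding legendre_def using conj_epiD[OF k] by (intro SUP_least) simp
    then have "ereal (sep_V a b y t (fst k)) - ereal (snd k)
        \<le> ereal (sep_V a b y t (fst k)) - legendre \<Phi> (fst k)"
      by (intro ereal_minus_mono) auto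
    also have "\<dots> \<le> (SUP p. ereal (sep_V a b y t p) - legendre \<Phi> p)"
      by (rule SUP_upper) simp
    finally show "ereal (payoff (y, t) k) \<le> (SUP p. ereal (sep_V a b y t p) - legendre \<Phi> p)"
      by (simp add: payoff_def)
  qed (rule conj_epi_nonempty)
qed

end

text \<open>\<open>V\<close> is tied to \<open>val\<close> only at nonnegative times, so derivatives
  are transferred on the open set t > 0.\<close>

locale affine_hj = separable_hj a b "\<lambda>y. \<Phi> (P *v y + u0)"
  for a b :: "'n::finite \<Rightarrow> real" and \<Phi> :: "real^'n \<Rightarrow> real" and P :: "real^'n^'n" and u0 :: "real^'n" +
  fixes U :: "real^'n \<Rightarrow> real" and V :: "real^'n \<Rightarrow> real \<Rightarrow> real"
  assumes P: "invertible P" and U: "\<And>y. U (P *v y + u0) = - sep_cost a b y"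
    and V: "\<And>x t. t \<ge> 0 \<Longrightarrow> V x t = val (coord P u0 x) t"
begin

lemma U_coord: "U x = - sep_cost a b (coord P u0 x)"
  using U[of "coord P u0 x"] by (simp add: coord_inverse[OF P])

lemma coord_continuous_on_half:
  fixes W :: "'n spacetime \<Rightarrow> real"
  assumes "continuous_on (UNIV \<times> {0..}) W"
  shows "continuous_on (UNIV \<times> {0..}) (\<lambda>z. W (coord P u0 (fst z), snd z))"
proof (rule continuous_on_compose2[where g = W and f = "\<lambda>z. (coord P u0 (fst z), snd z)", OF assms])
  show "continuous_on (UNIV \<times> {0..}) (\<lambda>z :: 'n spacetime. (coord P u0 (fst z), snd z))"
    by (intro continuous_on_Pair continuous_on_coord continuous_on_fst continuous_on_snd continuous_on_id)
qed auto

lemma continuous_on_V: "continuous_on (UNIV \<times> {0..}) (\<lambda>(x, t). V x t)"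
  using coord_continuous_on_half[OF continuous_on_val]
  by (rule continuous_on_eq) (auto simp: V)

lemma V_zero: "V x 0 = \<Phi> x"
  by (simp add: V val_zero coord_inverse[OF P])

abbreviation "val_D \<equiv> (\<lambda>z. (val_grad (fst z) (snd z), sep_cost a b (fst z) - (norm (val_grad (fst z) (snd z)))\<^sup>2 / 2))"

lemma grad_of_V: "grad_of (\<lambda>z. V (fst z) (snd z)) (pullback_grad P u0 val_D) (UNIV \<times> {0<..})"
  unfolding grad_of_def
proof (intro conjI ballI)
  note G = grad_of_pullback[OF grad_of_val, of P u0, unfolded fst_conv snd_conv]
  show "continuous_on (UNIV \<times> {0<..}) (pullback_grad P u0 val_D)"
    using G by (simp add: grad_of_def)
  fix z :: "'n spacetime" assume z: "z \<in> UNIV \<times> {0<..}"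
  have "((\<lambda>z. val (coord P u0 (fst z)) (snd z)) has_derivative (\<lambda>h. pullback_grad P u0 val_D z \<bullet> h)) (at z)"
    using G z unfolding grad_of_def by blast
  then show "((\<lambda>z. V (fst z) (snd z)) has_derivative (\<lambda>h. pullback_grad P u0 val_D z \<bullet> h)) (at z)"
    by (rule has_derivative_transform_within_open[OF _ open_Times[OF open_UNIV open_greaterThan] z])
       (auto simp: V)
qed

text \<open>The operator sees only first-order data at the point, so one computation serves
  \<open>V\<close> and every test function touching it.\<close>

lemma hj_operator_same_derivative:
  fixes \<phi> :: "real^'n \<Rightarrow> real \<Rightarrow> real"
  assumes "((\<lambda>z. \<phi> (fst z) (snd z)) has_derivative (\<lambda>h. pullback_grad P u0 val_D (x, t) \<bullet> h)) (at (x, t))"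
  shows "hj_operator (P ** transpose P) U \<phi> x t = 0"
proof -
  have "fst (pullback_grad P u0 val_D (x, t)) \<bullet> ((P ** transpose P) *v fst (pullback_grad P u0 val_D (x, t)))
     = (norm (val_grad (coord P u0 x) t))\<^sup>2"
    unfolding pullback_grad_def fst_conv snd_conv by (rule pullback_quadratic[OF P])
  moreover have "snd (pullback_grad P u0 val_D (x, t))
     = sep_cost a b (coord P u0 x) - (norm (val_grad (coord P u0 x) t))\<^sup>2 / 2"
    by (simp add: pullback_grad_def)
  ultimately show ?thesis
    by (subst hj_operator_eq[OF assms]) (simp_all add: U_coord)
qed

lemma V_derivative:
  assumes "t > 0"
  shows "((\<lambda>z. V (fst z) (snd z)) has_derivative (\<lambda>h. pullback_grad P u0 val_D (x, t) \<bullet> h)) (at (x, t))"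
  using grad_of_V assms by (simp add: grad_of_def)

lemma C1_solution_V: "C1_solution (P ** transpose P) U \<Phi> V"
  unfolding C1_solution_def
proof (intro conjI allI impI)
  show "continuously_differentiable_on (UNIV \<times> {0<..}) (\<lambda>(x, t). V x t)"
    using continuously_differentiable_on_grad_of[OF grad_of_V] by (simp add: case_prod_unfold)
  show "hj_operator (P ** transpose P) U V x t = 0" if "t > 0" for x t
    by (rule hj_operator_same_derivative[OF V_derivative[OF that]])
qed (use continuous_on_V V_zero in auto)

text \<open>\<open>V\<close> minus the test function is differentiable with a local extremum, so the
  derivatives coincide; this settles both viscosity inequalities.\<close>

lemma touching_hj_operator:
  assumes C1: "continuously_differentiable_on (UNIV \<times> {0<..}) (\<lambda>(y, s). \<phi> y s)" and t: "t > 0"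
    and ext: "(\<forall>\<^sub>F (y, s) in nhds (x, t). V y s - \<phi> y s \<le> V x t - \<phi> x t)
      \<or> (\<forall>\<^sub>F (y, s) in nhds (x, t). V y s - \<phi> y s \<ge> V x t - \<phi> x t)"
  shows "hj_operator (P ** transpose P) U \<phi> x t = 0"
proof -
  obtain \<phi>' where "((\<lambda>(y, s). \<phi> y s) has_derivative blinfun_apply (\<phi>' (x, t))) (at (x, t))"
    using C1 t unfolding continuously_differentiable_on_def by blast
  then have \<phi>: "((\<lambda>z. \<phi> (fst z) (snd z)) has_derivative blinfun_apply (\<phi>' (x, t))) (at (x, t))"
    by (simp add: case_prod_unfold)
  let ?f = "\<lambda>z. V (fst z) (snd z) - \<phi> (fst z) (snd z)"
  have d: "(?f has_derivative (\<lambda>h. pullback_grad P u0 val_D (x, t) \<bullet> h - blinfun_apply (\<phi>' (x, t)) h)) (at (x, t))"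
    by (intro has_derivative_diff V_derivative[OF t] \<phi>)
  have "(\<forall>\<^sub>F z in nhds (x, t). ?f z \<le> ?f (x, t)) \<or> (\<forall>\<^sub>F z in nhds (x, t). ?f (x, t) \<le> ?f z)"
    using ext by (simp add: case_prod_unfold)
  then obtain S where S: "open S" "(x, t) \<in> S" "(\<forall>z\<in>S. ?f z \<le> ?f (x, t)) \<or> (\<forall>z\<in>S. ?f (x, t) \<le> ?f z)"
    unfolding eventually_nhds by blast
  have "(\<lambda>h. pullback_grad P u0 val_D (x, t) \<bullet> h - blinfun_apply (\<phi>' (x, t)) h) = (\<lambda>h. 0)"
    by (rule differential_zero_maxmin[OF S(2,1) d S(3)])
  then have "blinfun_apply (\<phi>' (x, t)) = (\<lambda>h. pullback_grad P u0 val_D (x, t) \<bullet> h)"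
    by (simp add: fun_eq_iff)
  then show ?thesis using \<phi> by (intro hj_operator_same_derivative) simp
qed

lemma viscosity_solution_V: "viscosity_solution (P ** transpose P) U \<Phi> V"
  unfolding viscosity_solution_def viscosity_subsolution_def viscosity_supersolution_def
proof (intro conjI allI impI)
  fix \<phi> :: "real^'n \<Rightarrow> real \<Rightarrow> real" and x and t :: real
  assume C1: "continuously_differentiable_on (UNIV \<times> {0<..}) (\<lambda>(y, s). \<phi> y s)" and t: "t > 0"
  show "hj_operator (P ** transpose P) U \<phi> x t \<le> 0"
    if "\<forall>\<^sub>F (y, s) in nhds (x, t). V y s - \<phi> y s \<le> V x t - \<phi> x t"
    using touching_hj_operator[OF C1 t disjI1[OF that]] by simp
  show "hj_operator (P ** transpose P) U \<phi> x t \<ge> 0"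
    if "\<forall>\<^sub>F (y, s) in nhds (x, t). V y s - \<phi> y s \<ge> V x t - \<phi> x t"
    using touching_hj_operator[OF C1 t disjI2[OF that]] by simp
qed (rule continuous_on_V V_zero)+

lemma V_convex:
  assumes "t \<ge> 0"
  shows "convex_on UNIV (\<lambda>x. V x t)"
proof (rule convex_onI)
  fix s :: real and x y :: "real^'n" assume s: "0 < s" "s < 1"
  have "coord P u0 ((1 - s) *\<^sub>R x + s *\<^sub>R y) = (1 - s) *\<^sub>R coord P u0 x + s *\<^sub>R coord P u0 y"
    by (simp add: coord_def algebra_simps)
  then show "V ((1 - s) *\<^sub>R x + s *\<^sub>R y) t \<le> (1 - s) * V x t + s * V y t"
    using convex_onD[OF val_convex[OF assms], of s "coord P u0 x" "coord P u0 y"] s assms by (simp add: V)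
qed simp

lemma local_seminorm_V: "local_seminorm V R < \<infinity>"
proof -
  let ?K = "cball (0 :: real^'n) (R + 1) \<times> {0..R}"
  have "continuous_on ?K (\<lambda>(x, t). V x t)"
    by (rule continuous_on_subset[OF continuous_on_V]) auto
  from cylinder_bound[OF this]
  obtain m where m': "\<And>z. z \<in> ?K \<Longrightarrow> \<bar>(\<lambda>(x, t). V x t) z\<bar> \<le> m" by blast
  have m: "\<bar>V x t\<bar> \<le> m" if "norm x \<le> R + 1" "t \<in> {0..R}" for x t
    using m'[of "(x, t)"] that by simp
  have "local_seminorm V R \<le> ereal (3 * m)"
    unfolding local_seminorm_def
  proof (rule Sup_least, clarify)
    fix x t q assume x: "x \<in> cball 0 R" and t: "t \<in> {0..R}" and q: "q \<in> frechet_subdifferential (\<lambda>y. V y t) x"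
    \<comment> \<open>A unit step in the direction of q turns the subgradient inequality into norm q
      \<le> V y t - V x t \<le> 2 * m; hence the radius R + 1.\<close>
    define y where "y = x + sgn q"
    have "norm y \<le> norm x + norm (sgn q)" unfolding y_def by (rule norm_triangle_ineq)
    then have "norm y \<le> R + 1" using x by (simp add: norm_sgn split: if_splits)
    then have "\<bar>V y t\<bar> \<le> m" "\<bar>V x t\<bar> \<le> m" using m x t by auto
    moreover have "V x t + q \<bullet> (y - x) \<le> V y t"
      using frechet_subdifferential_convex[OF V_convex q] t by simp
    moreover have "q \<bullet> (y - x) = norm q"
      by (cases "q = 0") (simp_all add: y_def sgn_div_norm power2_norm_eq_inner[symmetric] power2_eq_square)
    ultimately have "\<bar>V x t\<bar> + norm q \<le> 3 * m" by linarith
    then show "ereal (\<bar>V x t\<bar> + norm q) \<le> ereal (3 * m)" by simp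
  qed
  then show ?thesis using le_less_trans by fastforce
qed

lemma V_in_uniqueness_class: "V \<in> uniqueness_class"
proof -
  obtain p r where k: "(p, r) \<in> conj_epi (\<lambda>y. \<Phi> (P *v y + u0))" using conj_epi_nonempty by fast
  define \<alpha> where "\<alpha> = transpose (matrix_inv P) *v p"
  have "\<exists>C. \<forall>x. \<forall>t\<in>{0..T}. V x t - \<alpha> \<bullet> x \<ge> C" if "T > 0" for T
  proof (intro exI allI ballI)
    fix x t assume t: "t \<in> {0..T}"
    have "\<alpha> \<bullet> x = p \<bullet> (matrix_inv P *v x)" by (simp add: \<alpha>_def dot_lmul_matrix[symmetric])
    then have "p \<bullet> coord P u0 x = \<alpha> \<bullet> x - p \<bullet> (matrix_inv P *v u0)"
      by (simp add: coord_def inner_diff_right)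
    moreover have "p \<bullet> coord P u0 x - r - t * drift p t \<le> V x t"
      using val_lower_bound[OF _ k] t by (simp add: V)
    moreover have "t * drift p t \<le> T * drift p T"
      using t drift_mono[of t T p] drift_nonneg by (intro mult_mono) auto
    ultimately show "V x t - \<alpha> \<bullet> x \<ge> - (p \<bullet> (matrix_inv P *v u0)) - r - T * drift p T" by linarith
  qed
  then show ?thesis
    unfolding uniqueness_class_def using continuous_on_V local_seminorm_V by blast
qed

lemma eventually_coord:
  fixes t :: real
  assumes "\<forall>\<^sub>F z in nhds (coord P u0 x, t). Q z"
  shows "\<forall>\<^sub>F (y, s) in nhds (x, t). Q (coord P u0 y, s)"
proof -
  have "isCont (\<lambda>z. (coord P u0 (fst z), snd z)) (x, t)"
    using coord_has_derivative has_derivative_continuous by blast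
  then have "filterlim (\<lambda>z. (coord P u0 (fst z), snd z)) (nhds (coord P u0 x, t)) (nhds (x, t))"
    using tendsto_at_iff_tendsto_nhds[of "\<lambda>z. (coord P u0 (fst z), snd z)" "(x, t)"] by (simp add: isCont_def)
  from eventually_compose_filterlim[OF assms this] show ?thesis by (simp add: case_prod_unfold)
qed

text \<open>The comparison takes place in the new coordinates: test functions for \<open>W'\<close>
  are pulled back to test functions for \<open>W\<close>, where the operator takes the separated
  form. The slope \<alpha> of the lower bound is transformed by the transpose of P.\<close>

lemma viscosity_unique:
  assumes W: "W \<in> uniqueness_class" "viscosity_solution (P ** transpose P) U \<Phi> W" and t: "t \<ge> 0"
  shows "W x t = V x t"
proof -
  define W' where "W' = (\<lambda>z. W (P *v fst z + u0) (snd z))"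
  have W'_coord: "W' (coord P u0 x, t) = W x t" for x t by (simp add: W'_def coord_inverse[OF P])
  have cont: "continuous_on (UNIV \<times> {0..}) W'"
  proof -
    have "continuous_on (UNIV \<times> {0..}) (\<lambda>z. (\<lambda>(x, t). W x t) (P *v fst z + u0, snd z))"
    proof (rule continuous_on_compose2[where g = "\<lambda>(x, t). W x t" and f = "\<lambda>z. (P *v fst z + u0, snd z)" and t = "UNIV \<times> {0..}"])
      show "continuous_on (UNIV \<times> {0..}) (\<lambda>(x, t). W x t)" using W by (simp add: uniqueness_class_def)
      show "continuous_on (UNIV \<times> {0..}) (\<lambda>z :: 'n spacetime. (P *v fst z + u0, snd z))"
        by (intro continuous_on_Pair continuous_on_add continuous_on_const continuous_on_snd continuous_on_id
            bounded_linear.continuous_on[OF matrix_vector_mul_bounded_linear] continuous_on_fst)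
    qed auto
    then show ?thesis by (simp add: W'_def)
  qed
  have init: "W' (y, 0) = \<Phi> (P *v y + u0)" for y
    using W(2) by (simp add: W'_def viscosity_solution_def)
  have C1: "continuously_differentiable_on (UNIV \<times> {0<..}) (\<lambda>(y, s). \<psi> (coord P u0 y, s))"
    if "grad_of \<psi> D {z. snd z > 0}" for \<psi> :: "'n spacetime \<Rightarrow> real" and D
    using continuously_differentiable_on_grad_of[OF grad_of_pullback[OF that]] by (simp add: case_prod_unfold)
  have op: "hj_operator (P ** transpose P) U (\<lambda>x t. \<psi> (coord P u0 x, t)) (P *v y + u0) t
     = snd (D (y, t)) + (norm (fst (D (y, t))))\<^sup>2 / 2 - sep_cost a b y"
    if "grad_of \<psi> D {z. snd z > 0}" "t > 0" for \<psi> :: "'n spacetime \<Rightarrow> real" and D y t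
    using hj_operator_pullback[OF P that, of U u0 "P *v y + u0"] by (simp add: coord_inverse[OF P] U)
  have ev: "\<forall>\<^sub>F (x, s) in nhds (P *v y + u0, t). Q (W x s - \<psi> (coord P u0 x, s))"
    if "\<forall>\<^sub>F z in nhds (y, t). Q (W' z - \<psi> z)" for Q \<psi> y and t :: real
    using eventually_coord[where x = "P *v y + u0" and t = t and Q = "\<lambda>z. Q (W' z - \<psi> z)"] that
    unfolding W'_coord by (simp add: coord_inverse[OF P])
  have sub: "hj_sub W'"
    unfolding hj_sub_def
  proof (intro allI impI)
    fix \<psi> D y t
    assume D: "grad_of \<psi> D {z. snd z > 0}" and t: "t > 0"
      and max: "\<forall>\<^sub>F z in nhds (y, t). W' z - \<psi> z \<le> W' (y, t) - \<psi> (y, t)"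
    have "\<forall>\<^sub>F (x, s) in nhds (P *v y + u0, t). W x s - \<psi> (coord P u0 x, s)
        \<le> W (P *v y + u0) t - \<psi> (coord P u0 (P *v y + u0), t)"
      using ev[OF max] by (simp add: coord_inverse[OF P] W'_def)
    with C1[OF D] t W(2)
    have "hj_operator (P ** transpose P) U (\<lambda>x t. \<psi> (coord P u0 x, t)) (P *v y + u0) t \<le> 0"
      unfolding viscosity_solution_def viscosity_subsolution_def by blast
    then show "snd (D (y, t)) + (norm (fst (D (y, t))))\<^sup>2 / 2 - sep_cost a b y \<le> 0"
      by (simp add: op[OF D t])
  qed
  have super: "hj_super W'"
    unfolding hj_super_def
  proof (intro allI impI)
    fix \<psi> D y t
    assume D: "grad_of \<psi> D {z. snd z > 0}" and t: "t > 0"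
      and max: "\<forall>\<^sub>F z in nhds (y, t). W' z - \<psi> z \<ge> W' (y, t) - \<psi> (y, t)"
    have "\<forall>\<^sub>F (x, s) in nhds (P *v y + u0, t). W x s - \<psi> (coord P u0 x, s)
        \<ge> W (P *v y + u0) t - \<psi> (coord P u0 (P *v y + u0), t)"
      using ev[OF max] by (simp add: coord_inverse[OF P] W'_def)
    with C1[OF D] t W(2)
    have "hj_operator (P ** transpose P) U (\<lambda>x t. \<psi> (coord P u0 x, t)) (P *v y + u0) t \<ge> 0"
      unfolding viscosity_solution_def viscosity_supersolution_def by blast
    then show "snd (D (y, t)) + (norm (fst (D (y, t))))\<^sup>2 / 2 - sep_cost a b y \<ge> 0"
      by (simp add: op[OF D t])
  qed
  obtain \<alpha> where \<alpha>: "\<And>T. T > 0 \<Longrightarrow> \<exists>C. \<forall>x. \<forall>t\<in>{0..T}. W x t - \<alpha> \<bullet> x \<ge> C"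
    using W(1) unfolding uniqueness_class_def by blast
  have lower: "\<exists>C. \<forall>y. \<forall>t\<in>{0..T}. W' (y, t) - (transpose P *v \<alpha>) \<bullet> y \<ge> C" if T: "T > 0" for T
  proof -
    obtain C where C: "\<And>x t. t \<in> {0..T} \<Longrightarrow> W x t - \<alpha> \<bullet> x \<ge> C" using \<alpha>[OF T] by blast
    have "W' (y, t) - (transpose P *v \<alpha>) \<bullet> y \<ge> C + \<alpha> \<bullet> u0" if "t \<in> {0..T}" for y t
    proof -
      have "(transpose P *v \<alpha>) \<bullet> y = \<alpha> \<bullet> (P *v y)" by (simp add: dot_lmul_matrix[symmetric])
      then show ?thesis using C[OF that, of "P *v y + u0"] by (simp add: W'_def inner_add_right)
    qed
    then show ?thesis by blast
  qed
  have "W' (coord P u0 x, t) = val (coord P u0 x) t"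
    by (rule antisym[OF hj_sub_le_val[OF cont sub _ t] hj_super_ge_val[OF cont super _ t lower]])
       (simp_all add: init)
  then show ?thesis by (simp add: W'_coord V t)
qed

end

theorem proposition2p5:
  fixes \<Phi> U :: "real^'n \<Rightarrow> real"
    and u0 :: "real^'n"
    and P M :: "real^'n^'n"
    and a b :: "'n \<Rightarrow> real"
    and V :: "real^'n \<Rightarrow> real \<Rightarrow> real"
    and Vext :: "real^'n \<Rightarrow> real \<Rightarrow> ereal"
  assumes "convex_on UNIV \<Phi>"
    and "\<And>x. U x \<le> 0"
    and "piecewise_affine U"
    and "concave_on UNIV U"
    and "one_homogeneous (\<lambda>x. U (x + u0))"
    and "invertible P"
    and "\<And>j. a j > 0"
    and "\<And>j. b j > 0"
    and "{x. U (x + u0) \<ge> - 1} =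
         convex hull (\<Union>j. {(1 / a j) *\<^sub>R column j P, - ((1 / b j) *\<^sub>R column j P)})"
    and M_def: "M = P ** transpose P"
    and Vext_def: "Vext = (\<lambda>x t. SUP p :: real^'n.
          ereal (\<Sum>i\<in>UNIV. V1 ((matrix_inv P *v x - matrix_inv P *v u0) $ i) t (p $ i) (a i) (b i))
          - legendre (\<lambda>y. \<Phi> (P *v y + u0)) p)"
    and V_def: "V = (\<lambda>x t. real_of_ereal (Vext x t))"
  shows "(\<forall>x. \<forall>t\<ge>0. \<bar>Vext x t\<bar> \<noteq> \<infinity>) \<and>
         C1_solution M U \<Phi> V \<and>
         (growth_condition \<Phi> \<longrightarrow>
            V \<in> uniqueness_class \<and> viscosity_solution M U \<Phi> V \<and>
            (\<forall>W \<in> uniqueness_class. viscosity_solution M U \<Phi> W \<longrightarrow>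
               (\<forall>x. \<forall>t\<ge>0. W x t = V x t)))"
proof -
  have conv: "convex_on UNIV (\<lambda>y. \<Phi> (P *v y + u0))"
  proof (rule convex_onI)
    fix s :: real and x y :: "real^'n" assume s: "0 < s" "s < 1"
    have "P *v ((1 - s) *\<^sub>R x + s *\<^sub>R y) + u0 = (1 - s) *\<^sub>R (P *v x + u0) + s *\<^sub>R (P *v y + u0)"
      by (simp add: algebra_simps)
    then show "\<Phi> (P *v ((1 - s) *\<^sub>R x + s *\<^sub>R y) + u0) \<le> (1 - s) * \<Phi> (P *v x + u0) + s * \<Phi> (P *v y + u0)"
      using convex_onD[OF assms(1), of s "P *v x + u0" "P *v y + u0"] s by simp
  qed simp
  interpret separable_hj a b "\<lambda>y. \<Phi> (P *v y + u0)"
    by unfold_locales (fact assms(7) assms(8) conv)+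
  \<comment> \<open>The supremum is finite at nonnegative times, so \<open>real_of_ereal\<close>
    loses nothing there.\<close>
  have Vext: "Vext x t = ereal (val (coord P u0 x) t)" if "t \<ge> 0" for x t
    using SUP_legendre_eq_val[OF that, of "coord P u0 x"]
    by (simp add: Vext_def sep_V_def coord_def)
  interpret affine_hj a b \<Phi> P u0 U V
  proof unfold_locales
    show "invertible P" by fact
    show "U (P *v y + u0) = - sep_cost a b y" for y
      by (rule one_homogeneous_gauge[OF assms(2,5,6,7,8,9)])
    show "V x t = val (coord P u0 x) t" if "t \<ge> 0" for x t
      using Vext[OF that] by (simp add: V_def)
  qed
  show ?thesis
    unfolding M_def
  proof (intro conjI allI impI ballI)
    show "\<bar>Vext x t\<bar> \<noteq> \<infinity>" if "t \<ge> 0" for x t using Vext[OF that] by simp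
  qed (rule C1_solution_V V_in_uniqueness_class viscosity_solution_V viscosity_unique | assumption)+
qed

end
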